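(* Let $X \subseteq \mathbb{C}^N$ be a closed complex algebraic subset, equipped with the Euclidean (strong) topology inherited from $\mathbb{C}^N$, and let $f: X \to X$ be a polynomial map. Suppose that $f$ is an open map, that $X - f(X)$ is finite, and that $\Omega \subseteq X$ is a cofinite subset of $X$ (i.e. $X-\Omega$ is finite) with $f(\Omega) \subseteq \Omega$. Then there is an integer $K > 0$ such that $f^K(\Omega) = f^{k}(\Omega)$ for all $k \ge K$. Moreover, the stable image $\bigcap_{k>0} f^k(\Omega)$ is an open cofinite subset of $\Omega$.
   Context: $f^k$ denotes the $k$-fold composition $f\circ f\circ\cdots\circ f$. A polynomial map $X\to X$ is the restriction of a polynomial map $\mathbb{C}^N\to\mathbb{C}^N$ that sends $X$ into $X$. *)

theory Defs
  imports "HOL-Analysis.Analysis"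
begin

inductive poly_fun :: "(complex ^ 'n \<Rightarrow> complex) \<Rightarrow> bool" where
  const: "poly_fun (\<lambda>x. c)"
| coord: "poly_fun (\<lambda>x. x $ i)"
| add: "poly_fun p \<Longrightarrow> poly_fun q \<Longrightarrow> poly_fun (\<lambda>x. p x + q x)"
| mult: "poly_fun p \<Longrightarrow> poly_fun q \<Longrightarrow> poly_fun (\<lambda>x. p x * q x)"

definition poly_map :: "(complex ^ 'n \<Rightarrow> complex ^ 'n) \<Rightarrow> bool" where
  "poly_map F \<longleftrightarrow> (\<forall>i. poly_fun (\<lambda>x. F x $ i))"

definition algebraic_set :: "(complex ^ 'n) set \<Rightarrow> bool" where
  "algebraic_set X \<longleftrightarrow> (\<exists>P. (\<forall>p\<in>P. poly_fun p) \<and> X = {x. \<forall>p\<in>P. p x = 0})"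

end

theory Submission
  imports Defs "HOL-Computational_Algebra.Fundamental_Theorem_Algebra"
begin

text \<open>
  Put \<open>D\<^sub>k = f^k(X) - f^(k+1)(X)\<close>. These sets are finite and of non-increasing size, so if none is
  empty, some orbit \<open>y\<^sub>0, y\<^sub>1, \<dots>\<close> satisfies \<open>f\<^sup>-\<^sup>1(y\<^sub>n\<^sub>+\<^sub>1) = {y\<^sub>n}\<close> for all \<open>n\<close> while \<open>y\<^sub>0\<close> is not in
  \<open>f^m(X)\<close>. As \<open>f\<close> is open, the points with two preimages form an open constructible set, so by the
  coincidence of Zariski and Euclidean closures of constructible sets no point with two preimages
  lies in the Zariski closure of the \<open>y\<^sub>n\<^sub>+\<^sub>1\<close>. By the Nullstellensatz, this and \<open>y\<^sub>0 \<notin> f^m(X)\<close> are witnessed by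
  polynomial identities over a finitely generated subring \<open>R\<close> of the complex numbers. Modulo a prime
  of \<open>R\<close> with finite residue field the orbit repeats; the first identity makes it purely
  periodic, and then \<open>y\<^sub>0\<close> lies in the image of \<open>f^m\<close> modulo the prime, against the second
  (the argument of Ax). Once \<open>f\<close> maps \<open>Y = f^k(X)\<close> onto itself, it also maps \<open>\<Omega> \<inter> Y\<close> onto itself by counting
  the finite complement.
\<close>

section \<open>Polynomial functions in countably many variables\<close>

text \<open>Uniqueness of preimages along an orbit concerns infinitely many points and is not by
  itself a polynomial condition, so it says nothing modulo a prime. Extending it to a Zariski closed
  set turns it into the insolvability of one polynomial system in two points and auxiliary inverses,
  and a certificate for that involves only finitely many numbers. It is then applied to pairs of
  points of the orbit itself: these solve the equations of the closed set exactly, so only the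
  coincidence of their images has to be read modulo the prime. The comparison of closures is proved
  by induction on the dimension, through projections with finite fibres. Its analytic ingredients
  are compactness, bounds for roots, and the fact that a quotient of polynomials which stays bounded
  on bounded sets is a polynomial.\<close>

inductive polynomial_fun :: "((nat \<Rightarrow> complex) \<Rightarrow> complex) \<Rightarrow> bool" where
  const: "polynomial_fun (\<lambda>v. c)"
| coord: "polynomial_fun (\<lambda>v. v i)"
| add: "polynomial_fun p \<Longrightarrow> polynomial_fun q \<Longrightarrow> polynomial_fun (\<lambda>v. p v + q v)"
| mult: "polynomial_fun p \<Longrightarrow> polynomial_fun q \<Longrightarrow> polynomial_fun (\<lambda>v. p v * q v)"

lemma polynomial_fun_on_line:
  assumes "polynomial_fun p"
  shows "\<exists>P. \<forall>t. p (\<lambda>i. a i + t * b i) = poly P t"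
  using assms
proof induction
  case (const c)
  show ?case by (rule exI[of _ "[:c:]"]) simp
next
  case (coord i)
  show ?case by (rule exI[of _ "[:a i, b i:]"]) simp
next
  case (add p q)
  then obtain P Q where "\<forall>t. p (\<lambda>i. a i + t * b i) = poly P t" "\<forall>t. q (\<lambda>i. a i + t * b i) = poly Q t"
    by blast
  then show ?case by (intro exI[of _ "P + Q"]) simp
next
  case (mult p q)
  then obtain P Q where "\<forall>t. p (\<lambda>i. a i + t * b i) = poly P t" "\<forall>t. q (\<lambda>i. a i + t * b i) = poly Q t"
    by blast
  then show ?case by (intro exI[of _ "P * Q"]) simp
qed

text \<open>Over an infinite field nothing is lost by taking polynomials as functions, and ring
  identities can be checked pointwise. Infinitely many variables leave room for auxiliary points and
  inverses without changing the type.\<close>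

typedef mpol = "{p. polynomial_fun p}" morphisms ev Abs_mpol
  by (rule exI[of _ "\<lambda>v. 0"]) (simp add: polynomial_fun.const)

setup_lifting type_definition_mpol

lemma mpol_eqI: "(\<And>v. ev p v = ev q v) \<Longrightarrow> p = q"
  using ev_inject by blast

instantiation mpol :: idom
begin
lift_definition zero_mpol :: mpol is "\<lambda>v. 0" by (rule polynomial_fun.const)
lift_definition one_mpol :: mpol is "\<lambda>v. 1" by (rule polynomial_fun.const)
lift_definition plus_mpol :: "mpol \<Rightarrow> mpol \<Rightarrow> mpol" is "\<lambda>p q v. p v + q v" by (rule polynomial_fun.add)
lift_definition times_mpol :: "mpol \<Rightarrow> mpol \<Rightarrow> mpol" is "\<lambda>p q v. p v * q v" by (rule polynomial_fun.mult)
lift_definition uminus_mpol :: "mpol \<Rightarrow> mpol" is "\<lambda>p v. - p v"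
  using polynomial_fun.mult[OF polynomial_fun.const[of "-1"]] by simp
lift_definition minus_mpol :: "mpol \<Rightarrow> mpol \<Rightarrow> mpol" is "\<lambda>p q v. p v - q v"
  using polynomial_fun.add[OF _ polynomial_fun.mult[OF polynomial_fun.const[of "-1"]]] by fastforce
instance
proof
  fix p q :: mpol
  assume "p \<noteq> 0" "q \<noteq> 0"
  then obtain v w where v: "ev p v \<noteq> 0" and w: "ev q w \<noteq> 0"
    by (metis mpol_eqI zero_mpol.rep_eq)
  \<comment> \<open>On the line joining \<open>v\<close> and \<open>w\<close> both polynomials are
    nonzero, so the absence of zero divisors is inherited from one variable.\<close>
  let ?l = "\<lambda>t i. v i + t * (w i - v i)"
  obtain P Q where P: "\<forall>t. ev p (?l t) = poly P t" and Q: "\<forall>t. ev q (?l t) = poly Q t"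
    using polynomial_fun_on_line ev by (metis mem_Collect_eq)
  have "poly P 0 \<noteq> 0" "poly Q 1 \<noteq> 0" using P[rule_format, of 0] Q[rule_format, of 1] v w by auto
  then have "P * Q \<noteq> 0" by auto
  then obtain t where "poly (P * Q) t \<noteq> 0" using poly_all_0_iff_0 by blast
  then have "ev (p * q) (?l t) \<noteq> 0" using P Q by (simp add: times_mpol.rep_eq)
  then show "p * q \<noteq> 0" by (metis zero_mpol.rep_eq)
qed (transfer, simp add: algebra_simps fun_eq_iff; fail)+
end

lemmas ev_simps [simp] = zero_mpol.rep_eq one_mpol.rep_eq plus_mpol.rep_eq times_mpol.rep_eq
  uminus_mpol.rep_eq minus_mpol.rep_eq

lift_definition Cst :: "complex \<Rightarrow> mpol" is "\<lambda>c v. c" by (rule polynomial_fun.const)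
lift_definition Var :: "nat \<Rightarrow> mpol" is "\<lambda>i v. v i" by (rule polynomial_fun.coord)

declare Cst.rep_eq [simp] Var.rep_eq [simp]

lemma mpol_induct [case_names Cst Var add mult]:
  assumes "\<And>c. P (Cst c)" "\<And>i. P (Var i)" "\<And>p q. P p \<Longrightarrow> P q \<Longrightarrow> P (p + q)"
    "\<And>p q. P p \<Longrightarrow> P q \<Longrightarrow> P (p * q)"
  shows "P p"
proof -
  have "polynomial_fun f \<Longrightarrow> P (Abs_mpol f)" for f
  proof (induction rule: polynomial_fun.induct)
    case (const c) then show ?case using assms(1)[of c] by (simp add: Cst_def)
  next
    case (coord i) then show ?case using assms(2)[of i] by (simp add: Var_def)
  next
    case (add p q) then show ?case using assms(3)[OF add.IH]
      by (simp add: plus_mpol_def Abs_mpol_inverse)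
  next
    case (mult p q) then show ?case using assms(4)[OF mult.IH]
      by (simp add: times_mpol_def Abs_mpol_inverse)
  qed
  from this[of "ev p"] show ?thesis using ev[of p] by (simp add: ev_inverse)
qed

lemma ev_sum [simp]: "ev (sum f A) v = (\<Sum>x\<in>A. ev (f x) v)"
  by (induction A rule: infinite_finite_induct) auto

lemma ev_prod [simp]: "ev (prod f A) v = (\<Prod>x\<in>A. ev (f x) v)"
  by (induction A rule: infinite_finite_induct) auto

lemma ev_power [simp]: "ev (p ^ n) v = ev p v ^ n"
  by (induction n) auto

lemma mpol_neq_0_iff: "p \<noteq> 0 \<longleftrightarrow> (\<exists>v. ev p v \<noteq> 0)"
  by (metis mpol_eqI zero_mpol.rep_eq)

lemma mpol_subst: "\<exists>q. \<forall>v. ev q v = ev p (\<lambda>i. ev (s i) v)"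
proof (induction p rule: mpol_induct)
  case (Cst c) then show ?case by (intro exI[of _ "Cst c"]) simp
next
  case (Var i) then show ?case by (intro exI[of _ "s i"]) simp
next
  case (add p q) then show ?case by (metis plus_mpol.rep_eq)
next
  case (mult p q) then show ?case by (metis times_mpol.rep_eq)
qed

definition subst :: "(nat \<Rightarrow> mpol) \<Rightarrow> mpol \<Rightarrow> mpol" where
  "subst s p = (SOME q. \<forall>v. ev q v = ev p (\<lambda>i. ev (s i) v))"

lemma ev_subst [simp]: "ev (subst s p) v = ev p (\<lambda>i. ev (s i) v)"
  using someI_ex[OF mpol_subst[of p s]] by (simp add: subst_def)

lemma continuous_on_ev [continuous_intros]: "continuous_on A (ev p)"
proof -
  have "continuous_on A (\<lambda>v. ev p v)"
  proof (induction p rule: mpol_induct)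
    case (Var i)
    then show ?case by (auto intro: continuous_on_product_then_coordinatewise continuous_intros)
  qed (auto intro!: continuous_intros)
  then show ?thesis by simp
qed

section \<open>Polynomials in one distinguished variable, with coefficients specialised at a
  point\<close>

definition evp :: "(nat \<Rightarrow> complex) \<Rightarrow> mpol poly \<Rightarrow> complex poly" where
  "evp v = map_poly (\<lambda>a. ev a v)"

lemma coeff_evp [simp]: "coeff (evp v P) i = ev (coeff P i) v"
  by (simp add: evp_def coeff_map_poly)

lemma evp_simps [simp]:
  "evp v 0 = 0" "evp v 1 = 1" "evp v (P + Q) = evp v P + evp v Q" "evp v (P - Q) = evp v P - evp v Q"
  "evp v (- P) = - evp v P" "evp v (P * Q) = evp v P * evp v Q"
  "evp v (smult a P) = smult (ev a v) (evp v P)" "evp v (pCons a P) = pCons (ev a v) (evp v P)"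
  "evp v (monom a n) = monom (ev a v) n"
  by (auto simp: poly_eq_iff coeff_mult coeff_pCons coeff_monom split: nat.split)

lemma evp_power [simp]: "evp v (P ^ n) = evp v P ^ n"
  by (induction n) auto

lemma evp_sum [simp]: "evp v (sum f A) = (\<Sum>x\<in>A. evp v (f x))"
  by (induction A rule: infinite_finite_induct) auto

lemma evp_prod [simp]: "evp v (prod f A) = (\<Prod>x\<in>A. evp v (f x))"
  by (induction A rule: infinite_finite_induct) auto

lemma degree_evp_le: "degree (evp v P) \<le> degree P"
  by (rule degree_le) (simp add: coeff_eq_0)

lemma degree_evp: "ev (lead_coeff P) v \<noteq> 0 \<Longrightarrow> degree (evp v P) = degree P"
  by (rule antisym[OF degree_evp_le le_degree]) simp

text \<open>One \<open>P\<close> serves all \<open>v\<close> and \<open>t\<close>. Suitable choices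
  of \<open>s\<close> and \<open>r\<close> isolate a single coordinate, scale the whole point, or
  expand along the lines through a fixed point; all three are used below.\<close>

lemma mpol_expand:
  "\<exists>P. \<forall>v t. ev p (\<lambda>i. ev (s i) v + t * ev (r i) v) = poly (evp v P) t"
proof (induction p rule: mpol_induct)
  case (Cst c) then show ?case by (intro exI[of _ "[:Cst c:]"]) simp
next
  case (Var i) then show ?case by (intro exI[of _ "[:s i, r i:]"]) simp
next
  case (add p q)
  then obtain P Q where "\<forall>v t. ev p (\<lambda>i. ev (s i) v + t * ev (r i) v) = poly (evp v P) t"
    "\<forall>v t. ev q (\<lambda>i. ev (s i) v + t * ev (r i) v) = poly (evp v Q) t" by blast
  then show ?case by (intro exI[of _ "P + Q"]) simp
next
  case (mult p q)
  then obtain P Q where "\<forall>v t. ev p (\<lambda>i. ev (s i) v + t * ev (r i) v) = poly (evp v P) t"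
    "\<forall>v t. ev q (\<lambda>i. ev (s i) v + t * ev (r i) v) = poly (evp v Q) t" by blast
  then show ?case by (intro exI[of _ "P * Q"]) simp
qed

lemma mpol_expand_coord: "\<exists>P. \<forall>v t. ev p (v(i := t)) = poly (evp v P) t"
proof -
  obtain P where "\<forall>v t. ev p (\<lambda>j. ev (if j = i then 0 else Var j) v + t * ev (if j = i then 1 else 0) v)
      = poly (evp v P) t"
    using mpol_expand[of p "\<lambda>j. if j = i then 0 else Var j" "\<lambda>j. if j = i then 1 else 0"] by auto
  moreover have "(\<lambda>j. ev (if j = i then 0 else Var j) v + t * ev (if j = i then 1 else 0) v) = v(i := t)" for v t
    by auto
  ultimately show ?thesis by auto
qed

lemma ev_poly [simp]: "ev (poly P p) v = poly (evp v P) (ev p v)"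
  by (induction P) auto

section \<open>Constructible sets and quantifier elimination\<close>

text \<open>A single inequation suffices because several can be multiplied together; finite unions
  of these sets are the Zariski-constructible sets.\<close>

definition basic_set :: "mpol list \<Rightarrow> mpol \<Rightarrow> (nat \<Rightarrow> complex) set" where
  "basic_set L g = {v. (\<forall>p\<in>set L. ev p v = 0) \<and> ev g v \<noteq> 0}"

definition constructible :: "(nat \<Rightarrow> complex) set \<Rightarrow> bool" where
  "constructible A \<longleftrightarrow> (\<exists>F. finite F \<and> A = (\<Union>(L, g)\<in>F. basic_set L g))"

lemma constructible_basic: "constructible (basic_set L g)"
  unfolding constructible_def by (rule exI[of _ "{(L, g)}"]) simp

lemma constructible_empty: "constructible {}"
  unfolding constructible_def by (rule exI[of _ "{}"]) simp

lemma constructible_Un: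
  assumes "constructible A" "constructible B"
  shows "constructible (A \<union> B)"
proof -
  obtain F G where "finite F" "A = (\<Union>(L, g)\<in>F. basic_set L g)" "finite G" "B = (\<Union>(L, g)\<in>G. basic_set L g)"
    using assms unfolding constructible_def by blast
  then show ?thesis unfolding constructible_def by (intro exI[of _ "F \<union> G"]) simp
qed

lemma constructible_UN: "finite I \<Longrightarrow> (\<And>i. i \<in> I \<Longrightarrow> constructible (A i)) \<Longrightarrow> constructible (\<Union>i\<in>I. A i)"
  by (induction I rule: finite_induct) (auto intro: constructible_empty constructible_Un)

lemma constructible_Int:
  assumes "constructible A" "constructible B"
  shows "constructible (A \<inter> B)"
proof -
  obtain F G where F: "finite F" "A = (\<Union>x\<in>F. basic_set (fst x) (snd x))"
    and G: "finite G" "B = (\<Union>x\<in>G. basic_set (fst x) (snd x))"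
    using assms unfolding constructible_def case_prod_beta by blast
  have int: "basic_set (L @ M) (g * h) = basic_set L g \<inter> basic_set M h" for L M g h
    by (auto simp: basic_set_def)
  have "A \<inter> B = (\<Union>x\<in>F. \<Union>y\<in>G. basic_set (fst x) (snd x) \<inter> basic_set (fst y) (snd y))"
    unfolding F G by (simp only: Int_UN_distrib2)
  then show ?thesis using F(1) G(1) by (simp add: int[symmetric] constructible_UN constructible_basic)
qed

lemma constructible_zero: "constructible {v. ev p v = 0}"
  using constructible_basic[of "[p]" 1] by (simp add: basic_set_def)

lemma constructible_nonzero: "constructible {v. ev p v \<noteq> 0}"
  using constructible_basic[of "[]" p] by (simp add: basic_set_def)

lemma constructible_UNIV: "constructible UNIV"
  using constructible_zero[of 0] by simp

lemma constructible_INT: "finite I \<Longrightarrow> (\<And>i. i \<in> I \<Longrightarrow> constructible (A i)) \<Longrightarrow> constructible (\<Inter>i\<in>I. A i)"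
  by (induction I rule: finite_induct) (auto intro: constructible_UNIV constructible_Int)

lemma constructible_Compl:
  assumes "constructible A"
  shows "constructible (- A)"
proof -
  obtain F where F: "finite F" "A = (\<Union>x\<in>F. basic_set (fst x) (snd x))"
    using assms unfolding constructible_def case_prod_beta by blast
  have "- basic_set L g = (\<Union>p\<in>set L. {v. ev p v \<noteq> 0}) \<union> {v. ev g v = 0}" for L g
    by (auto simp: basic_set_def)
  then have "constructible (- basic_set L g)" for L g
    by (auto intro!: constructible_Un constructible_UN constructible_zero constructible_nonzero)
  moreover have "- A = (\<Inter>x\<in>F. - basic_set (fst x) (snd x))" unfolding F by blast
  ultimately show ?thesis using F(1) by (auto intro!: constructible_INT)
qed

lemma constructible_subst:
  assumes "constructible A"
  shows "constructible {v. (\<lambda>i. ev (s i) v) \<in> A}"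
proof -
  obtain F where F: "finite F" "A = (\<Union>x\<in>F. basic_set (fst x) (snd x))"
    using assms unfolding constructible_def case_prod_beta by blast
  have "{v. (\<lambda>i. ev (s i) v) \<in> A} = (\<Union>x\<in>F. basic_set (map (subst s) (fst x)) (subst s (snd x)))"
    unfolding F by (auto simp: basic_set_def)
  then show ?thesis using F(1) by (auto intro!: constructible_UN constructible_basic)
qed

text \<open>Dropping the leading term of a polynomial or replacing it by a pseudo-remainder decreases the
  weight, which is positive even for the zero polynomial so that zero entries can be discarded.\<close>

definition elim_weight :: "mpol poly \<Rightarrow> nat" where
  "elim_weight p = (if p = 0 then 1 else degree p + 2)"

definition drop_lead :: "mpol poly \<Rightarrow> mpol poly" where
  "drop_lead p = p - monom (lead_coeff p) (degree p)"

lemma elim_weight_drop_lead: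
  assumes "p \<noteq> 0"
  shows "elim_weight (drop_lead p) < elim_weight p"
proof -
  have "coeff (drop_lead p) i = 0" if "i \<ge> degree p" for i
    using that by (auto simp: drop_lead_def coeff_eq_0)
  then have "drop_lead p = 0 \<or> degree (drop_lead p) < degree p"
    by (metis leading_coeff_0_iff not_le)
  then show ?thesis using assms by (auto simp: elim_weight_def)
qed

lemma evp_drop_lead: "ev (lead_coeff p) v = 0 \<Longrightarrow> evp v (drop_lead p) = evp v p"
  by (simp add: drop_lead_def)

text \<open>Division over the coefficient ring costs a power of the leading coefficient. At points
  where that coefficient is nonzero the power is a harmless scalar \<open>c\<close>, so the
  pseudo-remainder specialises to a remainder up to scaling.\<close>

lemma pseudo_mod_evp:
  assumes "p \<noteq> 0" "ev (lead_coeff p) v \<noteq> 0"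
  obtains c Q where "c \<noteq> 0" "smult c (evp v q) = evp v p * Q + evp v (pseudo_mod q p)"
proof -
  obtain s r where sr: "pseudo_divmod q p = (s, r)" by fastforce
  have "smult (lead_coeff p ^ (Suc (degree q) - degree p)) q = p * s + pseudo_mod q p"
    using pseudo_divmod(1)[OF assms(1) sr] sr by (simp add: pseudo_mod_def)
  from arg_cong[OF this, of "evp v"] show ?thesis using assms by (intro that) auto
qed

lemma constructible_evp_nonzero: "constructible {v. evp v r \<noteq> 0}"
proof -
  have "{v. evp v r \<noteq> 0} = (\<Union>i\<in>{..degree r}. {v. ev (coeff r i) v \<noteq> 0})"
    by (auto simp: poly_eq_iff) (metis atMost_iff coeff_eq_0 linorder_not_less zero_mpol.rep_eq)
  then show ?thesis by (simp add: constructible_UN constructible_nonzero)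
qed

text \<open>Euclid's algorithm with parameters: where the leading coefficient of \<open>p\<close>
  vanishes, its term is dropped; elsewhere \<open>q\<close> is replaced by its remainder modulo
  \<open>p\<close>. This ends with at most one equation, where solvability becomes a question of
  divisibility.\<close>

lemma constructible_exists_root:
  "constructible {v. \<exists>t. (\<forall>p\<in>set L. poly (evp v p) t = 0) \<and> poly (evp v g) t \<noteq> 0}"
proof (induction "sum_list (map elim_weight L)" arbitrary: L rule: less_induct)
  case less
  let ?S = "\<lambda>L. {v. \<exists>t. (\<forall>p\<in>set L. poly (evp v p) t = 0) \<and> poly (evp v g) t \<noteq> 0}"
  consider "L = []" | "0 \<in> set L" | p where "L = [p]" "p \<noteq> 0"
    | p q M where "set L = set (p # q # M)" "degree p \<le> degree q" "p \<noteq> 0" "q \<noteq> 0"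
      "sum_list (map elim_weight L) = elim_weight p + elim_weight q + sum_list (map elim_weight M)"
  proof (cases L)
    case Nil then show ?thesis using that by blast
  next
    case (Cons a M)
    show ?thesis
    proof (cases M)
      case Nil then show ?thesis using that Cons by (cases "a = 0") auto
    next
      case (Cons b N)
      show ?thesis
      proof (cases "0 \<in> set L")
        case False
        have L: "L = a # b # N" using \<open>L = a # M\<close> Cons by simp
        show ?thesis
        proof (cases "degree a \<le> degree b")
          case True then show ?thesis using that(4)[of a b N] L False by auto
        next
          case nle: False then show ?thesis using that(4)[of b a N] L False by auto
        qed
      qed (use that in blast)
    qed
  qed
  then show ?case
  proof cases
    case 1
    have "?S L = {v. evp v g \<noteq> 0}" using 1 by (auto simp: poly_all_0_iff_0[symmetric])
    then show ?thesis by (simp add: constructible_evp_nonzero)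
  next
    case 2
    then obtain M N where L: "L = M @ 0 # N" by (meson split_list)
    have "constructible (?S (M @ N))" by (rule less) (simp add: L elim_weight_def)
    moreover have "?S L = ?S (M @ N)" unfolding L by simp
    ultimately show ?thesis by simp
  next
    case (3 p)
    \<comment> \<open>No root of \<open>p\<close> has multiplicity above \<open>degree p\<close>, so
      \<open>g\<close> vanishes at all roots of \<open>p\<close> exactly when \<open>p\<close>
      divides \<open>g ^ degree p\<close>, that is, when this remainder vanishes.\<close>
    let ?r = "pseudo_mod (g ^ degree p) p"
    have *: "(\<exists>t. poly (evp v p) t = 0 \<and> poly (evp v g) t \<noteq> 0) \<longleftrightarrow> evp v ?r \<noteq> 0"
      if a: "ev (lead_coeff p) v \<noteq> 0" for v
    proof -
      obtain c Q where c: "c \<noteq> 0" "smult c (evp v (g ^ degree p)) = evp v p * Q + evp v ?r"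
        using pseudo_mod_evp[OF 3(2) a] by blast
      have d: "degree (evp v p) = degree p" using a by (rule degree_evp)
      have "evp v p \<noteq> 0" using a by (metis coeff_0 coeff_evp)
      have "(\<exists>t. poly (evp v p) t = 0 \<and> poly (evp v g) t \<noteq> 0) \<longleftrightarrow> \<not> evp v p dvd evp v g ^ degree p"
        using nullstellensatz_univariate[of "evp v p" "evp v g"] d \<open>evp v p \<noteq> 0\<close> by auto
      also have "evp v p dvd evp v g ^ degree p \<longleftrightarrow> evp v p dvd smult c (evp v (g ^ degree p))"
        using c(1) by (simp add: dvd_smult_iff)
      also have "\<dots> \<longleftrightarrow> evp v p dvd evp v ?r" unfolding c(2) by (simp add: dvd_add_right_iff)
      also have "\<dots> \<longleftrightarrow> evp v ?r = 0"
      proof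
        assume dvd: "evp v p dvd evp v ?r"
        show "evp v ?r = 0"
        proof (rule ccontr)
          assume "evp v ?r \<noteq> 0"
          then have "?r \<noteq> 0" by auto
          then have "degree ?r < degree p" using pseudo_mod(2)[OF 3(2), of "g ^ degree p"] by simp
          moreover have "degree (evp v p) \<le> degree (evp v ?r)"
            using dvd \<open>evp v ?r \<noteq> 0\<close> by (rule dvd_imp_degree_le)
          ultimately show False using d degree_evp_le[of v ?r] by simp
        qed
      qed simp
      finally show ?thesis by simp
    qed
    have eq: "?S L = {v. ev (lead_coeff p) v = 0} \<inter> ?S [drop_lead p] \<union> {v. ev (lead_coeff p) v \<noteq> 0} \<inter> {v. evp v ?r \<noteq> 0}"
      (is "_ = ?R")
    proof (rule set_eqI)
      fix v show "v \<in> ?S L \<longleftrightarrow> v \<in> ?R"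
        using *[of v] evp_drop_lead[of p v] by (cases "ev (lead_coeff p) v = 0") (simp_all add: 3(1))
    qed
    have "constructible (?S [drop_lead p])"
      by (rule less) (simp add: 3(1) elim_weight_drop_lead[OF 3(2)])
    then show ?thesis unfolding eq
      by (intro constructible_Un constructible_Int constructible_zero constructible_nonzero constructible_evp_nonzero)
  next
    case (4 p q M)
    let ?r = "pseudo_mod q p"
    have *: "poly (evp v p) t = 0 \<and> poly (evp v q) t = 0 \<longleftrightarrow> poly (evp v p) t = 0 \<and> poly (evp v ?r) t = 0"
      if a: "ev (lead_coeff p) v \<noteq> 0" for v t
    proof -
      obtain c Q where c: "c \<noteq> 0" "smult c (evp v q) = evp v p * Q + evp v ?r"
        using pseudo_mod_evp[OF 4(3) a] by blast
      from arg_cong[OF c(2), of "\<lambda>p. poly p t"]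
      have "c * poly (evp v q) t = poly (evp v p) t * poly Q t + poly (evp v ?r) t" by simp
      then show ?thesis using c(1) by auto
    qed
    have eq: "?S L = {v. ev (lead_coeff p) v = 0} \<inter> ?S (drop_lead p # q # M) \<union> {v. ev (lead_coeff p) v \<noteq> 0} \<inter> ?S (p # ?r # M)"
      (is "_ = ?R")
    proof (rule set_eqI)
      fix v show "v \<in> ?S L \<longleftrightarrow> v \<in> ?R"
        using *[of v] evp_drop_lead[of p v] by (cases "ev (lead_coeff p) v = 0") (auto simp: 4(1))
    qed
    have c1: "constructible (?S (drop_lead p # q # M))"
      by (rule less) (simp add: 4(5) elim_weight_drop_lead[OF 4(3)])
    have "elim_weight ?r < elim_weight q"
      using pseudo_mod(2)[OF 4(3), of q] 4(2,4) by (auto simp: elim_weight_def)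
    then have c2: "constructible (?S (p # ?r # M))"
      by (intro less) (simp add: 4(5))
    show ?thesis unfolding eq
      by (intro constructible_Un constructible_Int constructible_zero constructible_nonzero c1 c2)
  qed
qed

lemma basic_set_fibre:
  "\<exists>M g'. \<forall>v t. v(i := t) \<in> basic_set L g \<longleftrightarrow> (\<forall>p\<in>set M. poly (evp v p) t = 0) \<and> poly (evp v g') t \<noteq> 0"
proof -
  obtain E where E: "\<And>p v t. ev p (v(i := t)) = poly (evp v (E p)) t"
    using mpol_expand_coord[of _ i] by metis
  show ?thesis by (rule exI[of _ "map E L"], rule exI[of _ "E g"]) (simp add: basic_set_def E)
qed

text \<open>Chevalley's theorem. The ambient space never shrinks: a projected set merely becomes
  independent of the coordinate \<open>i\<close>.\<close>

theorem constructible_project: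
  assumes "constructible A"
  shows "constructible {v. \<exists>t. v(i := t) \<in> A}"
proof -
  obtain F where F: "finite F" "A = (\<Union>x\<in>F. basic_set (fst x) (snd x))"
    using assms unfolding constructible_def case_prod_beta by blast
  have "constructible {v. \<exists>t. v(i := t) \<in> basic_set L g}" for L g
    using basic_set_fibre[of i L g] constructible_exists_root by auto
  moreover have "{v. \<exists>t. v(i := t) \<in> A} = (\<Union>x\<in>F. {v. \<exists>t. v(i := t) \<in> basic_set (fst x) (snd x)})"
    unfolding F by auto
  ultimately show ?thesis using F(1) by (simp add: constructible_UN)
qed

lemma constructible_project_set:
  assumes "finite I" "constructible A"
  shows "constructible {v. \<exists>w\<in>A. \<forall>j. j \<notin> I \<longrightarrow> v j = w j}"
  using assms(1)
proof (induction I rule: finite_induct)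
  case empty
  have "{v. \<exists>w\<in>A. \<forall>j. j \<notin> {} \<longrightarrow> v j = w j} = A" by (auto simp: fun_eq_iff[symmetric])
  then show ?case using assms(2) by simp
next
  case (insert i I)
  have eq: "{v. \<exists>w\<in>A. \<forall>j. j \<notin> insert i I \<longrightarrow> v j = w j} = {v. \<exists>t. v(i := t) \<in> {v. \<exists>w\<in>A. \<forall>j. j \<notin> I \<longrightarrow> v j = w j}}"
  proof (intro Collect_cong iffI)
    fix v assume "\<exists>w\<in>A. \<forall>j. j \<notin> insert i I \<longrightarrow> v j = w j"
    then obtain w where "w \<in> A" "\<forall>j. j \<notin> insert i I \<longrightarrow> v j = w j" by blast
    then show "\<exists>t. v(i := t) \<in> {v. \<exists>w\<in>A. \<forall>j. j \<notin> I \<longrightarrow> v j = w j}"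
      by (intro exI[of _ "w i"]) auto
  qed (auto split: if_splits)
  show ?case unfolding eq by (rule constructible_project[OF insert.IH])
qed

section \<open>Subrings and ideals\<close>

definition subring_set :: "'a :: comm_ring_1 set \<Rightarrow> bool" where
  "subring_set S \<longleftrightarrow> 1 \<in> S \<and> (\<forall>x\<in>S. \<forall>y\<in>S. x - y \<in> S \<and> x * y \<in> S)"

lemma subring_setD:
  assumes "subring_set S"
  shows "1 \<in> S" "0 \<in> S" "x \<in> S \<Longrightarrow> y \<in> S \<Longrightarrow> x - y \<in> S" "x \<in> S \<Longrightarrow> y \<in> S \<Longrightarrow> x * y \<in> S"
    "x \<in> S \<Longrightarrow> - x \<in> S" "x \<in> S \<Longrightarrow> y \<in> S \<Longrightarrow> x + y \<in> S"
proof -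
  show 1: "1 \<in> S" and d: "x \<in> S \<Longrightarrow> y \<in> S \<Longrightarrow> x - y \<in> S" and "x \<in> S \<Longrightarrow> y \<in> S \<Longrightarrow> x * y \<in> S" for x y
    using assms by (auto simp: subring_set_def)
  show 0: "0 \<in> S" using d[OF 1 1] by simp
  show m: "- x \<in> S" if "x \<in> S" for x using d[OF 0 that] by simp
  show "x \<in> S \<Longrightarrow> y \<in> S \<Longrightarrow> x + y \<in> S" using d[OF _ m, of x y] by simp
qed

lemma subring_set_sum: "subring_set S \<Longrightarrow> (\<And>i. i \<in> I \<Longrightarrow> f i \<in> S) \<Longrightarrow> sum f I \<in> S"
  by (induction I rule: infinite_finite_induct) (auto simp: subring_setD)

text \<open>The \<open>S\<close>-linear combinations of \<open>E\<close>. Adding one multiple at a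
  time lets an induction over membership read off the finitely many multipliers, which
  \<open>certificate_over_subring\<close> relies on.\<close>

inductive_set ideal_over :: "'a :: comm_ring_1 set \<Rightarrow> 'a set \<Rightarrow> 'a set" for S E where
  zero: "0 \<in> ideal_over S E"
| step: "x \<in> ideal_over S E \<Longrightarrow> e \<in> E \<Longrightarrow> c \<in> S \<Longrightarrow> x + c * e \<in> ideal_over S E"

lemma ideal_over_base: "subring_set S \<Longrightarrow> e \<in> E \<Longrightarrow> e \<in> ideal_over S E"
  using ideal_over.step[OF ideal_over.zero, of e E 1 S] by (simp add: subring_setD)

lemma ideal_over_add:
  assumes "x \<in> ideal_over S E" "y \<in> ideal_over S E"
  shows "x + y \<in> ideal_over S E"
  using assms(2)
  by (induction y rule: ideal_over.induct) (auto simp: add.assoc[symmetric] assms(1) intro: ideal_over.step)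

lemma ideal_over_mult:
  assumes "subring_set S" "c \<in> S" "x \<in> ideal_over S E"
  shows "c * x \<in> ideal_over S E"
  using assms(3)
proof (induction x rule: ideal_over.induct)
  case (step x e d)
  then show ?case using ideal_over.step[of "c * x" S E e "c * d"] subring_setD(4)[OF assms(1,2)]
    by (simp add: algebra_simps)
qed (simp add: ideal_over.zero)

lemma ideal_over_diff:
  assumes "subring_set S" "x \<in> ideal_over S E" "y \<in> ideal_over S E"
  shows "x - y \<in> ideal_over S E"
  using ideal_over_add[OF assms(2) ideal_over_mult[OF assms(1) _ assms(3), of "-1"]] subring_setD[OF assms(1)]
  by simp

lemma ideal_over_subset:
  assumes "subring_set S" "E \<subseteq> ideal_over S F"
  shows "ideal_over S E \<subseteq> ideal_over S F"
proof
  fix x assume "x \<in> ideal_over S E"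
  then show "x \<in> ideal_over S F"
    by induction (use assms in \<open>auto intro: ideal_over.zero ideal_over_add ideal_over_mult\<close>)
qed

lemma ideal_over_mono: "subring_set S \<Longrightarrow> E \<subseteq> F \<Longrightarrow> ideal_over S E \<subseteq> ideal_over S F"
  by (rule ideal_over_subset) (auto intro: ideal_over_base)

lemma ideal_over_in_subring:
  assumes "subring_set S" "E \<subseteq> S" "x \<in> ideal_over S E"
  shows "x \<in> S"
  using assms(3) by induction (use assms(1,2) in \<open>auto simp: subring_setD\<close>)

definition ideal_in :: "'a :: comm_ring_1 set \<Rightarrow> 'a set \<Rightarrow> bool" where
  "ideal_in R M \<longleftrightarrow> M \<subseteq> R \<and> 0 \<in> M \<and> (\<forall>x\<in>M. \<forall>y\<in>M. x + y \<in> M) \<and> (\<forall>c\<in>R. \<forall>x\<in>M. c * x \<in> M)"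

lemma ideal_inD:
  assumes "ideal_in R M"
  shows "x \<in> M \<Longrightarrow> x \<in> R" "0 \<in> M" "x \<in> M \<Longrightarrow> y \<in> M \<Longrightarrow> x + y \<in> M" "c \<in> R \<Longrightarrow> x \<in> M \<Longrightarrow> c * x \<in> M"
  using assms by (auto simp: ideal_in_def)

lemma ideal_in_diff:
  assumes "subring_set R" "ideal_in R M" "x \<in> M" "y \<in> M"
  shows "x - y \<in> M"
proof -
  have "- 1 \<in> R" using subring_setD(1,5)[OF assms(1)] by blast
  then have "x + (- 1) * y \<in> M" using ideal_inD(3,4)[OF assms(2)] assms(3,4) by blast
  then show ?thesis by simp
qed

lemma ideal_in_sum: "ideal_in R M \<Longrightarrow> (\<And>i. i \<in> I \<Longrightarrow> f i \<in> M) \<Longrightarrow> sum f I \<in> M"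
  by (induction I rule: infinite_finite_induct) (auto simp: ideal_inD)

lemma ideal_in_ideal_over: "subring_set R \<Longrightarrow> E \<subseteq> R \<Longrightarrow> ideal_in R (ideal_over R E)"
  using ideal_over_in_subring[of R E]
  by (auto simp: ideal_in_def intro: ideal_over.zero ideal_over_add ideal_over_mult)

lemma ideal_in_extend:
  assumes R: "subring_set R" and M: "ideal_in R M" and x: "x \<in> R"
  obtains J where "ideal_in R J" "M \<subseteq> J" "x \<in> J" "\<And>a. a \<in> J \<Longrightarrow> \<exists>m\<in>M. \<exists>r\<in>R. a = m + r * x"
proof -
  define J where "J = {m + r * x |m r. m \<in> M \<and> r \<in> R}"
  have MJ: "M \<subseteq> J"
  proof
    fix m assume "m \<in> M"
    then show "m \<in> J" unfolding J_def using subring_setD(2)[OF R]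
      by (intro CollectI exI[of _ m] exI[of _ 0]) simp
  qed
  have xJ: "x \<in> J" unfolding J_def using subring_setD(1)[OF R] ideal_inD(2)[OF M]
    by (intro CollectI exI[of _ 0] exI[of _ 1]) simp
  have "ideal_in R J" unfolding ideal_in_def
  proof (intro conjI ballI subsetI)
    show "0 \<in> J" using MJ ideal_inD(2)[OF M] by blast
  next
    fix a assume "a \<in> J"
    then obtain m r where a: "a = m + r * x" "m \<in> M" "r \<in> R" by (auto simp: J_def)
    show "a \<in> R" using a x ideal_inD(1)[OF M] subring_setD[OF R] by simp
    show "a + b \<in> J" if bJ: "b \<in> J" for b
    proof -
      obtain m' r' where b: "b = m' + r' * x" "m' \<in> M" "r' \<in> R" using bJ by (auto simp: J_def)
      have "a + b = (m + m') + (r + r') * x" by (simp add: a b algebra_simps)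
      then show ?thesis unfolding J_def using a b ideal_inD(3)[OF M] subring_setD(6)[OF R] by blast
    qed
  next
    fix d a assume d: "d \<in> R" and "a \<in> J"
    then obtain m r where a: "a = m + r * x" "m \<in> M" "r \<in> R" by (auto simp: J_def)
    have "d * a = d * m + (d * r) * x" by (simp add: a algebra_simps)
    then show "d * a \<in> J" unfolding J_def using a d ideal_inD(4)[OF M] subring_setD(4)[OF R] by blast
  qed
  then show ?thesis using that MJ xJ unfolding J_def by blast
qed

abbreviation gen_ideal :: "'a :: comm_ring_1 set \<Rightarrow> 'a set" where
  "gen_ideal \<equiv> ideal_over UNIV"

lemma subring_set_UNIV: "subring_set UNIV"
  by (simp add: subring_set_def)

lemmas gen_ideal_base = ideal_over_base[OF subring_set_UNIV]
lemmas gen_ideal_mult = ideal_over_mult[OF subring_set_UNIV UNIV_I]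
lemmas gen_ideal_diff = ideal_over_diff[OF subring_set_UNIV]

section \<open>Generic fibres\<close>

lemma gen_ideal_evp_root:
  assumes "h \<in> gen_ideal L" "\<And>p. p \<in> L \<Longrightarrow> poly (evp v p) t = 0"
  shows "poly (evp v h) t = 0"
  using assms by (induction h rule: ideal_over.induct) auto

text \<open>The pseudo-remainder of \<open>p\<close> by \<open>d\<close> stays in \<open>J\<close>
  and has smaller degree, so it vanishes. Thus \<open>d\<close> acts like a generator over the
  fraction field, without that field being constructed.\<close>

lemma min_degree_pseudo_dvd:
  fixes J :: "'a :: idom poly set"
  assumes "d \<in> J" "d \<noteq> 0" "\<And>r. r \<in> J \<Longrightarrow> r \<noteq> 0 \<Longrightarrow> degree d \<le> degree r"
    and "\<And>c q. smult c p - d * q \<in> J"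
  obtains c q where "c \<noteq> 0" "smult c p = d * q"
proof -
  obtain c q where c: "c \<noteq> 0" "smult c p = d * q + pseudo_mod p d"
    using pseudo_mod(1)[OF assms(2)] by blast
  have "pseudo_mod p d = smult c p - d * q" using c(2) by simp
  then have "pseudo_mod p d \<in> J" using assms(4) by simp
  then have "pseudo_mod p d = 0"
    using pseudo_mod(2)[OF assms(2), of p] assms(3) by fastforce
  then show ?thesis using c that by simp
qed

lemma exists_min_degree:
  fixes J :: "'a :: zero poly set"
  assumes "p \<in> J" "p \<noteq> 0"
  obtains d where "d \<in> J" "d \<noteq> 0" "\<And>r. r \<in> J \<Longrightarrow> r \<noteq> 0 \<Longrightarrow> degree d \<le> degree r"
  using ex_has_least_nat[of "\<lambda>r. r \<in> J \<and> r \<noteq> 0" p degree] assms by auto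

text \<open>An element of least degree in the saturation of the ideal by powers of \<open>g\<close> vanishes, over a
  generic point, exactly at the common roots of the ideal at which \<open>g\<close> does not vanish.\<close>

lemma generic_fibre_roots:
  assumes "finite L" "p0 \<in> L" "p0 \<noteq> 0"
  obtains b \<theta> where "b \<noteq> 0" "\<theta> \<noteq> 0"
    "\<And>v t. ev b v \<noteq> 0 \<Longrightarrow> ev (lead_coeff \<theta>) v \<noteq> 0"
    "\<And>v t. ev b v \<noteq> 0 \<Longrightarrow>
       (\<forall>p\<in>L. poly (evp v p) t = 0) \<and> poly (evp v g) t \<noteq> 0 \<longleftrightarrow> poly (evp v \<theta>) t = 0"
proof -
  define J where "J = {p. \<exists>a k. a \<noteq> 0 \<and> smult a (p * g ^ k) \<in> gen_ideal L}"
  have LJ: "p \<in> J" if "p \<in> L" for p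
    unfolding J_def using gen_ideal_base[OF that] by (intro CollectI exI[of _ 1] exI[of _ 0]) simp
  have closed: "smult c p - q * r \<in> J" if pq: "p \<in> J" "q \<in> J" for p q r c
  proof -
    obtain a k a' k' where a: "a \<noteq> 0" "smult a (p * g ^ k) \<in> gen_ideal L"
      "a' \<noteq> 0" "smult a' (q * g ^ k') \<in> gen_ideal L"
      using pq unfolding J_def by blast
    have "smult (a * a') ((smult c p - q * r) * g ^ (k + k')) =
        smult (a' * c) (g ^ k') * smult a (p * g ^ k) - smult a (r * g ^ k) * smult a' (q * g ^ k')"
      by (simp add: algebra_simps power_add smult_diff_right)
    also have "\<dots> \<in> gen_ideal L" by (intro gen_ideal_diff gen_ideal_mult a)
    finally show ?thesis unfolding J_def using a(1,3) by (intro CollectI exI[of _ "a * a'"] exI[of _ "k + k'"]) simp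
  qed
  obtain \<theta> where \<theta>: "\<theta> \<in> J" "\<theta> \<noteq> 0" "\<And>r. r \<in> J \<Longrightarrow> r \<noteq> 0 \<Longrightarrow> degree \<theta> \<le> degree r"
    using exists_min_degree[OF LJ[OF assms(2)] assms(3)] by blast
  obtain a k where a: "a \<noteq> 0" "smult a (\<theta> * g ^ k) \<in> gen_ideal L" using \<theta>(1) unfolding J_def by auto
  have "\<exists>c q. c \<noteq> 0 \<and> smult c p = \<theta> * q" if "p \<in> L" for p
    using min_degree_pseudo_dvd[of \<theta> J p, OF \<theta>] closed[OF LJ[OF that] \<theta>(1)] by metis
  then obtain C Q where C: "\<And>p. p \<in> L \<Longrightarrow> C p \<noteq> 0 \<and> smult (C p) p = \<theta> * Q p" by metis
  \<comment> \<open>Up to coefficients, \<open>d\<close> is a greatest common divisor of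
    \<open>\<theta>\<close> and \<open>g\<close>. If it had positive degree, dividing it out of
    \<open>\<theta>\<close> would give a smaller element of \<open>J\<close>, because one further
    factor \<open>g\<close> supplies \<open>d\<close> again.\<close>
  let ?I = "gen_ideal {\<theta>, g}"
  have "\<theta> \<in> ?I" by (simp add: gen_ideal_base)
  then obtain d where d: "d \<in> ?I" "d \<noteq> 0" "\<And>r. r \<in> ?I \<Longrightarrow> r \<noteq> 0 \<Longrightarrow> degree d \<le> degree r"
    using exists_min_degree[of \<theta> ?I] \<theta>(2) by blast
  have dI: "smult c p - d * q \<in> ?I" if "p \<in> ?I" for c p q
    using gen_ideal_diff[OF gen_ideal_mult[OF that, of "[:c:]"] gen_ideal_mult[OF d(1), of q]]
    by (simp add: mult.commute)
  have "degree d = 0"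
  proof (rule ccontr)
    assume deg: "degree d \<noteq> 0"
    obtain c \<theta>' where c: "c \<noteq> 0" "smult c \<theta> = d * \<theta>'"
      using min_degree_pseudo_dvd[of d ?I \<theta>, OF d dI] by (auto simp: gen_ideal_base)
    obtain c' g' where c': "c' \<noteq> 0" "smult c' g = d * g'"
      using min_degree_pseudo_dvd[of d ?I g, OF d dI] by (auto simp: gen_ideal_base)
    have nz: "\<theta>' \<noteq> 0" using c \<theta>(2) by auto
    have "degree \<theta> = degree d + degree \<theta>'"
      using arg_cong[OF c(2), of degree] c(1) d(2) nz by (simp add: degree_mult_eq)
    have "smult (a * c') (\<theta>' * g ^ Suc k) = smult a ((d * \<theta>') * g ^ k * g')"
      using c'(2) by (simp add: algebra_simps) (metis (no_types, lifting) mult.commute mult.left_commute mult_smult_left mult_smult_right smult_smult)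
    also have "\<dots> = smult c g' * smult a (\<theta> * g ^ k)" unfolding c(2)[symmetric] by (simp add: algebra_simps)
    also have "\<dots> \<in> gen_ideal L" by (intro gen_ideal_mult a)
    finally have "\<theta>' \<in> J" unfolding J_def using a(1) c'(1)
      by (intro CollectI exI[of _ "a * c'"] exI[of _ "Suc k"]) simp
    then show False using \<theta>(3)[OF _ nz] deg \<open>degree \<theta> = degree d + degree \<theta>'\<close> by simp
  qed
  then obtain d0 where d0: "d = [:d0:]" by (metis degree_eq_zeroE)
  \<comment> \<open>The factors respectively keep the degree of \<open>\<theta>\<close>, make its
    membership in \<open>J\<close> usable, make \<open>\<theta>\<close> and \<open>g\<close>
    coprime, and make every \<open>p\<close> in \<open>L\<close> divisible by
    \<open>\<theta>\<close> after specialisation.\<close>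
  define b where "b = lead_coeff \<theta> * a * d0 * prod C L"
  have "b \<noteq> 0" using \<theta>(2) a(1) d(2) d0 C assms(1) by (auto simp: b_def)
  moreover have "(\<forall>p\<in>L. poly (evp v p) t = 0) \<and> poly (evp v g) t \<noteq> 0 \<longleftrightarrow> poly (evp v \<theta>) t = 0"
    if b: "ev b v \<noteq> 0" for v t
  proof -
    have nz: "ev a v \<noteq> 0" "ev d0 v \<noteq> 0" "\<And>p. p \<in> L \<Longrightarrow> ev (C p) v \<noteq> 0"
      using b assms(1) by (auto simp: b_def)
    have 1: "poly (evp v \<theta>) t = 0" if "\<forall>p\<in>L. poly (evp v p) t = 0" "poly (evp v g) t \<noteq> 0"
      using gen_ideal_evp_root[OF a(2), of v t] that nz(1) by simp
    have 2: "poly (evp v p) t = 0" if "poly (evp v \<theta>) t = 0" "p \<in> L" for p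
    proof -
      have "ev (C p) v * poly (evp v p) t = poly (evp v (smult (C p) p)) t" by simp
      also have "\<dots> = 0" using C[OF that(2)] that(1) by simp
      finally show ?thesis using nz(3)[OF that(2)] by simp
    qed
    have 3: "poly (evp v g) t \<noteq> 0" if "poly (evp v \<theta>) t = 0"
      using gen_ideal_evp_root[OF d(1), of v t] that nz(2) d0 by auto
    show ?thesis using 1 2 3 by blast
  qed
  ultimately show ?thesis using \<theta>(2) by (intro that[of b \<theta>]) (auto simp: b_def)
qed

lemma infinite_nonroots: "evp v g \<noteq> 0 \<Longrightarrow> infinite {t. poly (evp v g) t \<noteq> 0}"
  using poly_roots_finite[of "evp v g"] infinite_UNIV_char_0[where 'a = complex]
  by (metis Collect_neg_eq finite_compl)

lemma constructible_generic_roots: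
  assumes "constructible B" "\<And>v. finite {t. v(i := t) \<in> B}"
  obtains b \<theta> where "b \<noteq> 0" "\<theta> \<noteq> 0" "\<And>v. ev b v \<noteq> 0 \<Longrightarrow> ev (lead_coeff \<theta>) v \<noteq> 0"
    "\<And>v t. ev b v \<noteq> 0 \<Longrightarrow> v(i := t) \<in> B \<longleftrightarrow> poly (evp v \<theta>) t = 0"
proof -
  have basic: "\<exists>b \<theta>. b \<noteq> 0 \<and> \<theta> \<noteq> 0 \<and> (\<forall>v. ev b v \<noteq> 0 \<longrightarrow> ev (lead_coeff \<theta>) v \<noteq> 0 \<and>
      (\<forall>t. v(i := t) \<in> basic_set L g \<longleftrightarrow> poly (evp v \<theta>) t = 0))"
    if fin: "\<And>v. finite {t. v(i := t) \<in> basic_set L g}" for L g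
  proof -
    obtain M g' where M: "\<And>v t. v(i := t) \<in> basic_set L g \<longleftrightarrow> (\<forall>p\<in>set M. poly (evp v p) t = 0) \<and> poly (evp v g') t \<noteq> 0"
      using basic_set_fibre by metis
    show ?thesis
    proof (cases "\<exists>p\<in>set M. p \<noteq> 0")
      case True
      then obtain p where p: "p \<in> set M" "p \<noteq> 0" by blast
      show ?thesis
        using generic_fibre_roots[OF finite_set p, of g'] unfolding M by metis
    next
      \<comment> \<open>Without a nonzero equation a nonempty fibre would be cofinite, so finiteness
        forces \<open>g'\<close> to vanish identically on every fibre, and
        \<open>\<theta> = 1\<close> describes the empty fibre.\<close>
      case False
      then have "poly (evp v p) t = 0" if "p \<in> set M" for p v t using that by auto
      then have "finite {t. poly (evp v g') t \<noteq> 0}" for v using fin[of v] by (simp add: M)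
      then have "evp v g' = 0" for v using infinite_nonroots by blast
      then show ?thesis by (intro exI[of _ 1]) (simp add: M)
    qed
  qed
  obtain F where F: "finite F" "B = (\<Union>x\<in>F. basic_set (fst x) (snd x))"
    using assms unfolding constructible_def case_prod_beta by blast
  have "finite {t. v(i := t) \<in> basic_set (fst x) (snd x)}" if "x \<in> F" for x v
    by (rule finite_subset[OF _ assms(2)[of v]]) (use that F in auto)
  then have "\<exists>b \<theta>. b \<noteq> 0 \<and> \<theta> \<noteq> 0 \<and> (\<forall>v. ev b v \<noteq> 0 \<longrightarrow> ev (lead_coeff \<theta>) v \<noteq> 0 \<and>
      (\<forall>t. v(i := t) \<in> basic_set (fst x) (snd x) \<longleftrightarrow> poly (evp v \<theta>) t = 0))" if "x \<in> F" for x
    using that by (intro basic) blast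
  then obtain b \<theta> where b: "\<And>x. x \<in> F \<Longrightarrow> b x \<noteq> 0 \<and> \<theta> x \<noteq> 0 \<and> (\<forall>v. ev (b x) v \<noteq> 0 \<longrightarrow> ev (lead_coeff (\<theta> x)) v \<noteq> 0 \<and>
      (\<forall>t. v(i := t) \<in> basic_set (fst x) (snd x) \<longleftrightarrow> poly (evp v (\<theta> x)) t = 0))"
    by metis
  show ?thesis
  proof (rule that)
    show "prod b F \<noteq> 0" "prod \<theta> F \<noteq> 0" using F(1) b by auto
    fix v assume "ev (prod b F) v \<noteq> 0"
    then have nz: "ev (b x) v \<noteq> 0" if "x \<in> F" for x using that F(1) by auto
    have "lead_coeff (prod \<theta> F) = (\<Prod>x\<in>F. lead_coeff (\<theta> x))" by (rule lead_coeff_prod)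
    then show "ev (lead_coeff (prod \<theta> F)) v \<noteq> 0" using b nz F(1) by simp
    show "v(i := t) \<in> B \<longleftrightarrow> poly (evp v (prod \<theta> F)) t = 0" for t
      unfolding F(2) using b nz F(1) by (auto simp: poly_prod)
  qed
qed

section \<open>Bounded quotients of polynomials\<close>

lemma eventually_nonroot:
  fixes b :: "complex poly"
  assumes "b \<noteq> 0"
  shows "\<forall>\<^sub>F t in at t0. poly b t \<noteq> 0"
proof -
  have "open (- {t. poly b t = 0} \<union> {t0})"
  proof -
    have "closed ({t. poly b t = 0} - {t0})" using poly_roots_finite[OF assms] by (intro finite_imp_closed) simp
    moreover have "- {t. poly b t = 0} \<union> {t0} = - ({t. poly b t = 0} - {t0})" by auto
    ultimately show ?thesis using open_Compl by metis
  qed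
  then show ?thesis unfolding eventually_at_topological
    by (intro exI[of _ "- {t. poly b t = 0} \<union> {t0}"]) auto
qed

text \<open>Zeros of \<open>b\<close> are isolated, so continuity extends the estimate across them;
  the radius \<open>R + 1\<close> in the hypothesis leaves room for nearby points.\<close>

lemma poly_bounded_quotient_generic:
  fixes p q b :: "complex poly"
  assumes "b \<noteq> 0" "\<And>t. norm t \<le> R + 1 \<Longrightarrow> poly b t \<noteq> 0 \<Longrightarrow> norm (poly p t) \<le> C * norm (poly q t)"
    and "norm t \<le> R"
  shows "norm (poly p t) \<le> C * norm (poly q t)"
proof (rule tendsto_le)
  show "((\<lambda>t. C * norm (poly q t)) \<longlongrightarrow> C * norm (poly q t)) (at t)"
    "((\<lambda>t. norm (poly p t)) \<longlongrightarrow> norm (poly p t)) (at t)"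
    by (auto intro!: tendsto_intros poly_isCont[unfolded isCont_def])
  have "\<forall>\<^sub>F s in at t. dist s t < 1"
    by (metis (no_types, lifting) eventually_at zero_less_one)
  then show "\<forall>\<^sub>F s in at t. norm (poly p s) \<le> C * norm (poly q s)"
    using eventually_nonroot[OF assms(1)]
  proof eventually_elim
    case (elim s)
    then have "norm s \<le> R + 1" using assms(3) norm_triangle_ineq2[of s t] by (simp add: dist_norm)
    then show ?case using assms(2) elim by blast
  qed
qed simp

text \<open>The bound makes every root of \<open>q\<close> a root of \<open>p\<close>. Cancelling
  the common linear factor keeps the bound off that root, and continuity restores it there.\<close>

lemma poly_dvd_of_bounded_quotient:
  fixes p q :: "complex poly"
  assumes "q \<noteq> 0" "\<And>R. \<exists>C. \<forall>t. norm t \<le> R \<longrightarrow> norm (poly p t) \<le> C * norm (poly q t)"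
  shows "q dvd p"
  using assms
proof (induction "degree q" arbitrary: p q)
  case 0
  then show ?case by (metis is_unit_iff_degree unit_imp_dvd)
next
  case (Suc n)
  obtain r where r: "poly q r = 0"
    using fundamental_theorem_of_algebra[of q] Suc(2) by (metis constant_degree nat.simps(3))
  then obtain q' where q': "q = [:- r, 1:] * q'" by (metis dvd_def poly_eq_0_iff_dvd)
  have "poly p r = 0" using Suc(4)[of "norm r"] r by fastforce
  then obtain p' where p': "p = [:- r, 1:] * p'" by (metis dvd_def poly_eq_0_iff_dvd)
  have "q' \<noteq> 0" using q' Suc.prems(1) by auto
  then have deg: "n = degree q'" using Suc(2) unfolding q' by (simp add: degree_mult_eq del: mult_pCons_left)
  have "q' dvd p'"
  proof (rule Suc(1)[OF deg \<open>q' \<noteq> 0\<close>])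
    fix R :: real
    obtain C where C: "\<And>t. norm t \<le> R + 1 \<Longrightarrow> norm (poly p t) \<le> C * norm (poly q t)"
      using Suc(4)[of "R + 1"] by blast
    have off: "norm (poly p' t) \<le> C * norm (poly q' t)" if "norm t \<le> R + 1" "t \<noteq> r" for t
    proof -
      have "norm (t - r) * norm (poly p' t) \<le> norm (t - r) * (C * norm (poly q' t))"
        using C[OF that(1)] unfolding p' q' by (simp add: norm_mult[symmetric] algebra_simps)
      then show ?thesis using that(2) by simp
    qed
    have "norm (poly p' t) \<le> C * norm (poly q' t)" if "norm t \<le> R" for t
      by (rule poly_bounded_quotient_generic[of "[:- r, 1:]" R p' C q' t, OF _ _ that]) (use off in auto)
    then show "\<exists>C. \<forall>t. norm t \<le> R \<longrightarrow> norm (poly p' t) \<le> C * norm (poly q' t)" by blast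
  qed
  then show ?case unfolding p' q' by (rule mult_dvd_mono[OF dvd_refl])
qed

text \<open>\<open>Q\<close> is the power series \<open>P / L\<close> cut off below degree
  \<open>n\<close>, computed one coefficient at a time. Only the constant coefficient of
  \<open>L\<close> is inverted, so \<open>Q\<close> has coefficients in the same ring.\<close>

lemma poly_power_series_div:
  fixes P L :: "'a :: comm_ring_1 poly"
  assumes "coeff L 0 * u = 1"
  shows "\<exists>Q S. P = L * Q + monom 1 n * S \<and> (\<forall>i\<ge>n. coeff Q i = 0)"
proof (induction n)
  case 0
  show ?case by (rule exI[of _ 0], rule exI[of _ P]) simp
next
  case (Suc n)
  then obtain Q S where QS: "P = L * Q + monom 1 n * S" "\<And>i. i \<ge> n \<Longrightarrow> coeff Q i = 0" by blast
  define c where "c = coeff S 0 * u"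
  have "coeff (S - smult c L) 0 = 0" using assms by (simp add: c_def mult.commute[of u] mult.assoc)
  then obtain S' where S': "S - smult c L = pCons 0 S'" by (metis coeff_pCons_0 pCons_cases)
  have "S = smult c L + monom 1 1 * S'" using S' by (simp add: algebra_simps monom_altdef)
  moreover have "monom c n = smult c (monom 1 n)" "monom (1 :: 'a) (Suc n) = monom 1 n * monom 1 1"
    by (simp_all add: smult_monom mult_monom)
  ultimately have "P = L * (Q + monom c n) + monom 1 (Suc n) * S'"
    unfolding QS(1) by (simp add: algebra_simps)
  moreover have "\<forall>i\<ge>Suc n. coeff (Q + monom c n) i = 0" using QS(2) by simp
  ultimately show ?case by blast
qed

text \<open>Restricting to the lines through a point where \<open>l\<close> does not vanish reduces divisibility to one
  variable; the quotients on the lines fit together because their Taylor coefficients at the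
  base point come from formal division of power series.\<close>

lemma mpol_dvd_of_bounded_quotient:
  assumes "b \<noteq> 0" "\<And>v. ev b v \<noteq> 0 \<Longrightarrow> ev l v \<noteq> 0"
    and bounded: "\<And>R. \<exists>C. \<forall>v. (\<forall>i<N. norm (v i) \<le> R) \<longrightarrow> ev b v \<noteq> 0 \<longrightarrow> norm (ev a v) \<le> C * norm (ev l v)"
  shows "l dvd a"
proof -
  obtain x where bx: "ev b x \<noteq> 0" using assms(1) mpol_neq_0_iff by blast
  have "\<exists>P. \<forall>v t. ev p (\<lambda>i. x i + t * v i) = poly (evp v P) t" for p
    using mpol_expand[of p "\<lambda>i. Cst (x i)" Var] by simp
  then obtain E where E: "\<And>p v t. ev p (\<lambda>i. x i + t * v i) = poly (evp v (E p)) t" by metis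
  have lx: "ev l x \<noteq> 0" using assms(2) bx .
  have E0: "ev (coeff (E p) 0) v = ev p x" for p v using E[of p 0 v] by (simp add: poly_0_coeff_0)
  \<comment> \<open>The quotient on any line has degree at most that of \<open>E a\<close>, so
    nothing is lost by cutting off at \<open>n\<close>.\<close>
  define n where "n = Suc (degree (E a))"
  have "coeff (E l) 0 * Cst (1 / ev l x) = 1" using lx by (intro mpol_eqI) (simp add: E0)
  then obtain Q S where QS: "E a = E l * Q + monom 1 n * S" "\<And>i. i \<ge> n \<Longrightarrow> coeff Q i = 0"
    using poly_power_series_div by metis
  have main: "evp v (E a) = evp v (E l) * evp v Q" for v
  proof -
    have l0: "coeff (evp v (E l)) 0 \<noteq> 0" and b0: "coeff (evp v (E b)) 0 \<noteq> 0" using E0 lx bx by simp_all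
    have "evp v (E l) dvd evp v (E a)"
    proof (rule poly_dvd_of_bounded_quotient)
      show "evp v (E l) \<noteq> 0" using l0 by (metis coeff_0)
      fix R :: real
      define R' where "R' = (\<Sum>i<N. norm (x i) + (\<bar>R\<bar> + 1) * norm (v i))"
      obtain C where C: "\<And>w. (\<forall>i<N. norm (w i) \<le> R') \<Longrightarrow> ev b w \<noteq> 0 \<Longrightarrow> norm (ev a w) \<le> C * norm (ev l w)"
        using bounded[of R'] by blast
      have "norm (poly (evp v (E a)) t) \<le> C * norm (poly (evp v (E l)) t)" if t: "norm t \<le> R" for t
      proof (rule poly_bounded_quotient_generic[OF _ _ t])
        show "evp v (E b) \<noteq> 0" using b0 by (metis coeff_0)
        fix s assume s: "norm s \<le> R + 1" "poly (evp v (E b)) s \<noteq> 0"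
        have "norm (x i + s * v i) \<le> R'" if "i < N" for i
        proof -
          have "norm (x i + s * v i) \<le> norm (x i) + norm s * norm (v i)"
            by (metis norm_mult norm_triangle_ineq)
          also have "\<dots> \<le> norm (x i) + (\<bar>R\<bar> + 1) * norm (v i)"
            using s(1) by (intro add_left_mono mult_right_mono) auto
          also have "\<dots> \<le> R'" unfolding R'_def
            using that by (intro member_le_sum) auto
          finally show ?thesis .
        qed
        then show "norm (poly (evp v (E a)) s) \<le> C * norm (poly (evp v (E l)) s)"
          using C[of "\<lambda>i. x i + s * v i"] s(2) by (simp add: E)
      qed
      then show "\<exists>C. \<forall>t. norm t \<le> R \<longrightarrow> norm (poly (evp v (E a)) t) \<le> C * norm (poly (evp v (E l)) t)"
        by blast
    qed
    then obtain \<kappa> where \<kappa>: "evp v (E a) = evp v (E l) * \<kappa>" by blast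
    have "coeff \<kappa> i = 0" if "i \<ge> n" for i
    proof (cases "\<kappa> = 0")
      case False
      have "evp v (E l) \<noteq> 0" using l0 by (metis coeff_0)
      then have "degree \<kappa> \<le> degree (evp v (E a))" using False by (simp add: \<kappa> degree_mult_eq)
      also have "\<dots> \<le> degree (E a)" by (rule degree_evp_le)
      finally show ?thesis using that by (intro coeff_eq_0) (simp add: n_def)
    qed simp
    then have small: "coeff (\<kappa> - evp v Q) i = 0" if "i \<ge> n" for i using QS(2) that by simp
    have "evp v (E l) * (\<kappa> - evp v Q) = monom 1 n * evp v S"
      using arg_cong[OF QS(1), of "evp v"] unfolding \<kappa> by (simp add: algebra_simps)
    then have low: "coeff (evp v (E l) * (\<kappa> - evp v Q)) i = 0" if "i < n" for i
      using that by (simp add: coeff_monom_mult)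
    \<comment> \<open>The product with \<open>E l\<close> has no terms below \<open>n\<close> and
      the constant coefficient of \<open>E l\<close> is nonzero, so the coefficients vanish
      successively from below.\<close>
    have "coeff (\<kappa> - evp v Q) i = 0" for i
    proof (induction i rule: less_induct)
      case (less i)
      show ?case
      proof (cases "i < n")
        case True
        have "0 = (\<Sum>j\<le>i. coeff (evp v (E l)) j * coeff (\<kappa> - evp v Q) (i - j))"
          using low[OF True] by (simp add: coeff_mult)
        also have "\<dots> = (\<Sum>j\<in>{0}. coeff (evp v (E l)) j * coeff (\<kappa> - evp v Q) (i - j))"
          using less by (intro sum.mono_neutral_right) auto
        finally show ?thesis using l0 by simp
      qed (use small in simp)
    qed
    then have "\<kappa> - evp v Q = 0" by (intro poly_eqI) simp
    then show ?thesis using \<kappa> by simp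
  qed
  \<comment> \<open>The parameter value 1 on the line from \<open>x\<close> in direction
    \<open>w - x\<close> returns to \<open>w\<close>.\<close>
  define q where "q = subst (\<lambda>i. Var i - Cst (x i)) (poly Q 1)"
  have "a = l * q"
  proof (rule mpol_eqI)
    fix w
    let ?v = "\<lambda>i. w i - x i"
    have "ev p w = poly (evp ?v (E p)) 1" for p using E[of p 1 ?v] by simp
    then show "ev a w = ev (l * q) w" by (simp add: main q_def)
  qed
  then show ?thesis by simp
qed

section \<open>Finite projections\<close>

lemma complex_poly_factor_induct [consumes 1, case_names const factor]:
  assumes "p \<noteq> (0 :: complex poly)" "\<And>c. c \<noteq> 0 \<Longrightarrow> P [:c:]"
    and "\<And>r q. q \<noteq> 0 \<Longrightarrow> P q \<Longrightarrow> P ([:- r, 1:] * q)"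
  shows "P p"
  using assms(1)
proof (induction "degree p" arbitrary: p)
  case 0
  then show ?case by (metis assms(2) degree_eq_zeroE pCons_0_0)
next
  case (Suc n)
  obtain r where "poly p r = 0"
    using fundamental_theorem_of_algebra[of p] Suc(2) by (metis constant_degree nat.simps(3))
  then obtain q where q: "p = [:- r, 1:] * q" by (metis dvd_def poly_eq_0_iff_dvd)
  have "q \<noteq> 0" using q Suc.prems by auto
  then have "n = degree q" using Suc(2) unfolding q by (simp add: degree_mult_eq del: mult_pCons_left)
  then show ?case unfolding q using assms(3) Suc(1) \<open>q \<noteq> 0\<close> by blast
qed

text \<open>Multiplying by a linear factor whose root has norm at most \<open>C\<close> enlarges a
  bound on the coefficients by at most the factor \<open>1 + C\<close>.\<close>

lemma norm_coeff_le_of_roots: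
  fixes p :: "complex poly"
  assumes "p \<noteq> 0" "\<And>t. poly p t = 0 \<Longrightarrow> norm t \<le> C" "C \<ge> 0"
  shows "norm (coeff p j) \<le> (1 + C) ^ degree p * norm (lead_coeff p)"
  using assms(1,2)
proof (induction p arbitrary: j rule: complex_poly_factor_induct)
  case (const c)
  then show ?case by (simp add: coeff_pCons split: nat.split)
next
  case (factor r q)
  have deg: "degree ([:- r, 1:] * q) = Suc (degree q)"
    using factor(1) by (simp add: degree_mult_eq del: mult_pCons_left)
  have lc: "lead_coeff ([:- r, 1:] * q) = lead_coeff q"
    by (simp only: lead_coeff_mult) simp
  have IH: "norm (coeff q j) \<le> (1 + C) ^ degree q * norm (lead_coeff q)" for j
    by (rule factor(2)) (use factor(3) in simp)
  have r: "norm r \<le> C" by (rule factor(3)) simp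
  have "norm (coeff ([:- r, 1:] * q) j) \<le> (1 + C) * ((1 + C) ^ degree q * norm (lead_coeff q))"
  proof -
    have 1: "coeff ([:- r, 1:] * q) j = (if j = 0 then 0 else coeff q (j - 1)) - r * coeff q j"
      by (cases j) auto
    have "norm (coeff ([:- r, 1:] * q) j) \<le> norm (if j = 0 then 0 else coeff q (j - 1)) + norm r * norm (coeff q j)"
      unfolding 1 by (metis norm_mult norm_triangle_ineq4)
    also have "\<dots> \<le> (1 + C) ^ degree q * norm (lead_coeff q) + C * ((1 + C) ^ degree q * norm (lead_coeff q))"
      using IH r assms(3) by (intro add_mono mult_mono) auto
    finally show ?thesis by (simp add: algebra_simps)
  qed
  then show ?case unfolding lc unfolding deg by (simp add: mult.assoc del: mult_pCons_left)
qed

text \<open>Up to sign, the value at 0 is the leading coefficient times the product of the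
  roots.\<close>

lemma norm_poly_0_ge_of_roots:
  fixes p :: "complex poly"
  assumes "p \<noteq> 0" "\<And>t. poly p t = 0 \<Longrightarrow> \<rho> \<le> norm t" "\<rho> \<ge> 0"
  shows "\<rho> ^ degree p * norm (lead_coeff p) \<le> norm (poly p 0)"
  using assms(1,2)
proof (induction p rule: complex_poly_factor_induct)
  case (factor r q)
  have deg: "degree ([:- r, 1:] * q) = Suc (degree q)"
    using factor(1) by (simp add: degree_mult_eq del: mult_pCons_left)
  have lc: "lead_coeff ([:- r, 1:] * q) = lead_coeff q"
    by (simp only: lead_coeff_mult) simp
  have IH: "\<rho> ^ degree q * norm (lead_coeff q) \<le> norm (poly q 0)"
    by (rule factor(2)) (use factor(3) in simp)
  have "\<rho> \<le> norm r" by (rule factor(3)) simp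
  then have "\<rho> * (\<rho> ^ degree q * norm (lead_coeff q)) \<le> norm r * norm (poly q 0)"
    using IH assms(3) by (intro mult_mono) auto
  then show ?case unfolding lc unfolding deg by (simp add: norm_mult mult.assoc del: mult_pCons_left)
qed simp

lemma monic_root_bound:
  fixes p :: "complex poly"
  assumes "lead_coeff p = 1" "poly p t = 0" "\<And>i. norm (coeff p i) \<le> C"
  shows "norm t \<le> 1 + C * degree p"
proof (rule ccontr)
  assume *: "\<not> norm t \<le> 1 + C * degree p"
  have "C \<ge> 0" using assms(3)[of 0] norm_ge_zero order_trans by blast
  then have t1: "norm t \<ge> 1" using * by (smt (verit) mult_nonneg_nonneg of_nat_0_le_iff)
  obtain n where n: "degree p = Suc n"
  proof (cases "degree p")
    case 0
    then show ?thesis using assms(1,2) by (auto elim!: degree_eq_zeroE)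
  qed
  have "t ^ Suc n + (\<Sum>i\<le>n. coeff p i * t ^ i) = 0"
    using assms(1,2) by (simp add: poly_altdef n algebra_simps)
  then have "t ^ Suc n = - (\<Sum>i\<le>n. coeff p i * t ^ i)" by (simp add: eq_neg_iff_add_eq_0)
  then have "norm t ^ Suc n = norm (\<Sum>i\<le>n. coeff p i * t ^ i)" by (metis norm_minus_cancel norm_power)
  also have "\<dots> \<le> (\<Sum>i\<le>n. C * norm t ^ n)"
  proof (rule sum_norm_le)
    fix i assume "i \<in> {..n}"
    then have "norm t ^ i \<le> norm t ^ n" using t1 by (intro power_increasing) auto
    then show "norm (coeff p i * t ^ i) \<le> C * norm t ^ n"
      unfolding norm_mult norm_power using assms(3) \<open>C \<ge> 0\<close> by (intro mult_mono) auto
  qed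
  also have "\<dots> = (C * degree p) * norm t ^ n" by (simp add: n)
  finally have "norm t * norm t ^ n \<le> (C * degree p) * norm t ^ n" by simp
  moreover have "norm t ^ n > 0" using t1 by (intro zero_less_power) linarith
  ultimately have "norm t \<le> C * degree p" by (simp add: mult_le_cancel_right)
  then show False using * by simp
qed

section \<open>Cylinders and triangular systems of monic equations\<close>

definition vars_below :: "nat \<Rightarrow> mpol \<Rightarrow> bool" where
  "vars_below d p \<longleftrightarrow> (\<forall>v w. (\<forall>i<d. v i = w i) \<longrightarrow> ev p v = ev p w)"

lemma vars_belowD: "vars_below d p \<Longrightarrow> (\<And>i. i < d \<Longrightarrow> v i = w i) \<Longrightarrow> ev p v = ev p w"
  unfolding vars_below_def by blast

text \<open>Subsets of \<open>N\<close>-dimensional space appear as sets of sequences whose later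
  coordinates are free; \<open>trunc\<close> selects the representative that is 0 there.\<close>

definition cylinder :: "nat \<Rightarrow> (nat \<Rightarrow> complex) set \<Rightarrow> bool" where
  "cylinder N A \<longleftrightarrow> (\<forall>v w. (\<forall>i<N. v i = w i) \<longrightarrow> v \<in> A \<longrightarrow> w \<in> A)"

lemma cylinderD: "cylinder N A \<Longrightarrow> v \<in> A \<Longrightarrow> (\<And>i. i < N \<Longrightarrow> v i = w i) \<Longrightarrow> w \<in> A"
  unfolding cylinder_def by blast

definition trunc :: "nat \<Rightarrow> (nat \<Rightarrow> complex) \<Rightarrow> nat \<Rightarrow> complex" where
  "trunc n v = (\<lambda>i. if i < n then v i else 0)"

text \<open>Fixing the later coordinates to be 0 makes the set compact in the product
  topology.\<close>

definition polydisc :: "nat \<Rightarrow> real \<Rightarrow> (nat \<Rightarrow> complex) set" where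
  "polydisc n R = {v. (\<forall>i<n. norm (v i) \<le> R) \<and> (\<forall>i\<ge>n. v i = 0)}"

lemma compact_polydisc: "compact (polydisc n R)"
proof -
  have "polydisc n R = PiE UNIV (\<lambda>i. if i < n then cball (0::complex) R else {0})"
  proof (rule set_eqI)
    fix v :: "nat \<Rightarrow> complex"
    have "v \<in> PiE UNIV (\<lambda>i. if i < n then cball (0::complex) R else {0}) \<longleftrightarrow> (\<forall>i. v i \<in> (if i < n then cball (0::complex) R else {0}))"
      by (simp add: PiE_UNIV_domain Pi_iff)
    also have "\<dots> \<longleftrightarrow> (\<forall>i. (i < n \<longrightarrow> norm (v i) \<le> R) \<and> (i \<ge> n \<longrightarrow> v i = 0))"
      by (intro iff_allI) auto
    finally show "v \<in> polydisc n R \<longleftrightarrow> v \<in> PiE UNIV (\<lambda>i. if i < n then cball (0::complex) R else {0})"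
      by (auto simp: polydisc_def)
  qed
  moreover have "compactin (product_topology (\<lambda>i. euclidean) UNIV) (PiE UNIV (\<lambda>i. if i < n then cball (0::complex) R else {0}))"
    by (subst compactin_PiE) auto
  ultimately show ?thesis by (simp add: euclidean_product_topology)
qed

lemma ev_bounded_polydisc: "\<exists>C. \<forall>v\<in>polydisc n R. norm (ev p v) \<le> C"
proof -
  have "bounded (ev p ` polydisc n R)"
    by (intro compact_imp_bounded compact_continuous_image continuous_on_ev compact_polydisc)
  then show ?thesis unfolding bounded_iff by auto
qed

text \<open>A triangular system of monic equations makes the projection to the first \<open>d\<close> coordinates finite.\<close>

definition tower_eqs :: "nat \<Rightarrow> nat \<Rightarrow> (nat \<Rightarrow> mpol poly) \<Rightarrow> bool" where
  "tower_eqs d N \<Psi> \<longleftrightarrow> (\<forall>i. d \<le> i \<and> i < N \<longrightarrow> lead_coeff (\<Psi> i) = 1 \<and> (\<forall>k. vars_below i (coeff (\<Psi> i) k)))"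

definition tower_sols :: "nat \<Rightarrow> nat \<Rightarrow> (nat \<Rightarrow> mpol poly) \<Rightarrow> (nat \<Rightarrow> complex) set" where
  "tower_sols d N \<Psi> = {v. \<forall>i. d \<le> i \<and> i < N \<longrightarrow> poly (evp v (\<Psi> i)) (v i) = 0}"

lemma evp_vars_below: "(\<And>k. vars_below n (coeff P k)) \<Longrightarrow> (\<And>i. i < n \<Longrightarrow> v i = w i) \<Longrightarrow> evp v P = evp w P"
  by (intro poly_eqI) (simp add: vars_belowD[of n _ v w])

lemma monic_evp:
  assumes "lead_coeff P = 1"
  shows "lead_coeff (evp v P) = 1" "degree (evp v P) = degree P" "evp v P \<noteq> 0"
proof -
  show deg: "degree (evp v P) = degree P" using degree_evp[of P v] assms by simp
  show "lead_coeff (evp v P) = 1" unfolding deg using assms by simp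
  then show "evp v P \<noteq> 0" by (metis leading_coeff_0_iff zero_neq_one)
qed

text \<open>The projection is proper: the coefficients of \<open>\<Psi> n\<close> depend only on
  coordinates already bounded, hence are bounded by compactness, and a monic polynomial with bounded
  coefficients has bounded roots.\<close>

lemma tower_bounded:
  assumes "tower_eqs d N \<Psi>" "d \<le> N"
  shows "\<exists>R'. \<forall>v\<in>tower_sols d N \<Psi>. (\<forall>i<d. norm (v i) \<le> R) \<longrightarrow> (\<forall>i<N. norm (v i) \<le> R')"
  using assms(2,1)
proof (induction N rule: dec_induct)
  case base then show ?case by blast
next
  case (step n)
  then have "tower_eqs d n \<Psi>" by (simp add: tower_eqs_def)
  then obtain R' where R': "\<And>v. v \<in> tower_sols d n \<Psi> \<Longrightarrow> \<forall>i<d. norm (v i) \<le> R \<Longrightarrow> \<forall>i<n. norm (v i) \<le> R'"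
    using step by blast
  have \<Psi>: "lead_coeff (\<Psi> n) = 1" "\<And>k. vars_below n (coeff (\<Psi> n) k)"
    using step by (auto simp: tower_eqs_def)
  have "\<exists>C. \<forall>v\<in>polydisc n R'. norm (ev (coeff (\<Psi> n) k) v) \<le> C" for k by (rule ev_bounded_polydisc)
  then obtain C where C: "\<And>k v. v \<in> polydisc n R' \<Longrightarrow> norm (ev (coeff (\<Psi> n) k) v) \<le> C k" by metis
  define C' where "C' = (\<Sum>k\<le>degree (\<Psi> n). \<bar>C k\<bar>)"
  have "\<forall>i<Suc n. norm (v i) \<le> max R' (1 + C' * degree (\<Psi> n))"
    if v: "v \<in> tower_sols d (Suc n) \<Psi>" "\<forall>i<d. norm (v i) \<le> R" for v
  proof -
    have "v \<in> tower_sols d n \<Psi>" using v by (auto simp: tower_sols_def)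
    then have vR: "\<forall>i<n. norm (v i) \<le> R'" using R' v by blast
    then have polydisc: "trunc n v \<in> polydisc n R'" by (auto simp: polydisc_def trunc_def)
    have eq: "evp v (\<Psi> n) = evp (trunc n v) (\<Psi> n)" by (rule evp_vars_below[OF \<Psi>(2)]) (simp add: trunc_def)
    have "norm (coeff (evp v (\<Psi> n)) k) \<le> C'" for k
    proof (cases "k \<le> degree (\<Psi> n)")
      case True
      have "norm (coeff (evp v (\<Psi> n)) k) \<le> \<bar>C k\<bar>" unfolding eq using C[OF polydisc, of k] by simp
      also have "\<dots> \<le> C'" unfolding C'_def using True by (intro member_le_sum) auto
      finally show ?thesis .
    qed (auto simp: coeff_eq_0 C'_def intro!: sum_nonneg)
    moreover have "poly (evp v (\<Psi> n)) (v n) = 0" using v step.hyps by (simp add: tower_sols_def)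
    ultimately have "norm (v n) \<le> 1 + C' * degree (\<Psi> n)"
      using monic_root_bound[OF monic_evp(1)[OF \<Psi>(1)], of v "v n" C'] monic_evp(2)[OF \<Psi>(1)] by metis
    then show ?thesis using vR by (auto simp: less_Suc_eq le_max_iff_disj)
  qed
  then show ?case by blast
qed

lemma tower_finite:
  assumes "tower_eqs d N \<Psi>" "d \<le> N"
  shows "finite {v \<in> tower_sols d N \<Psi>. (\<forall>i<d. v i = z i) \<and> (\<forall>i\<ge>N. v i = 0)}"
  using assms(2,1)
proof (induction N rule: dec_induct)
  case base
  have "{v \<in> tower_sols d d \<Psi>. (\<forall>i<d. v i = z i) \<and> (\<forall>i\<ge>d. v i = 0)} \<subseteq> {trunc d z}"
    by (auto simp: trunc_def fun_eq_iff)
  then show ?case using finite_subset by blast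
next
  case (step n)
  let ?F = "\<lambda>n. {v \<in> tower_sols d n \<Psi>. (\<forall>i<d. v i = z i) \<and> (\<forall>i\<ge>n. v i = 0)}"
  have fin: "finite (?F n)" using step by (auto simp: tower_eqs_def)
  have \<Psi>: "lead_coeff (\<Psi> n) = 1" "\<And>k. vars_below n (coeff (\<Psi> n) k)"
    using step by (auto simp: tower_eqs_def)
  have "?F (Suc n) \<subseteq> (\<Union>w\<in>?F n. (\<lambda>t. w(n := t)) ` {t. poly (evp w (\<Psi> n)) t = 0})"
  proof
    fix v assume v: "v \<in> ?F (Suc n)"
    have eq: "evp (v(n := 0)) (\<Psi> i) = evp v (\<Psi> i)" if "i \<le> n" "d \<le> i" for i
      by (rule evp_vars_below[of i]) (use step that in \<open>auto simp: tower_eqs_def\<close>)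
    then have "v(n := 0) \<in> ?F n" using v step.hyps
      by (auto simp: tower_sols_def)
    moreover have "poly (evp (v(n := 0)) (\<Psi> n)) (v n) = 0" using v step.hyps eq[of n] by (auto simp: tower_sols_def)
    ultimately show "v \<in> (\<Union>w\<in>?F n. (\<lambda>t. w(n := t)) ` {t. poly (evp w (\<Psi> n)) t = 0})"
      by (intro UN_I[of "v(n := 0)"] image_eqI[of _ _ "v n"]) auto
  qed
  moreover have "finite {t. poly (evp w (\<Psi> n)) t = 0}" for w
    using monic_evp(3)[OF \<Psi>(1)] by (rule poly_roots_finite)
  ultimately show ?case using fin by (auto intro: finite_subset)
qed

text \<open>Each factor of the product is 1 at \<open>z\<close> and 0 at one other point of
  \<open>F\<close>, so \<open>l\<close> is 0 at \<open>z\<close> and 1 on the rest of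
  \<open>F\<close>.\<close>

lemma separating_polynomial:
  assumes "finite F" "\<And>x. x \<in> F \<Longrightarrow> \<forall>i\<ge>N. x i = 0" "\<forall>i\<ge>N. z i = 0"
  obtains l where "ev l z = 0" "\<And>x. x \<in> F \<Longrightarrow> ev l x = 0 \<Longrightarrow> x = z" "vars_below N l"
proof -
  have "\<exists>i<N. y i \<noteq> z i" if "y \<in> F - {z}" for y
    using that assms(2)[of y] assms(3) by (metis Diff_iff ext insertI1 not_le)
  then obtain i where i: "\<And>y. y \<in> F - {z} \<Longrightarrow> i y < N \<and> y (i y) \<noteq> z (i y)" by metis
  define f where "f y = Cst (1 / (z (i y) - y (i y))) * (Var (i y) - Cst (y (i y)))" for y
  define l where "l = 1 - prod f (F - {z})"
  show ?thesis
  proof (rule that)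
    have "ev (f y) z = 1" if "y \<in> F - {z}" for y using i[OF that] by (auto simp: f_def)
    then show "ev l z = 0" by (simp add: l_def)
    show "x = z" if "x \<in> F" "ev l x = 0" for x
    proof (rule ccontr)
      assume "x \<noteq> z"
      then have "(\<Prod>y\<in>F - {z}. ev (f y) x) = 0"
        using that assms(1) by (intro prod_zero) (auto intro!: bexI[of _ x] simp: f_def)
      then show False using that by (simp add: l_def)
    qed
    show "vars_below N l" unfolding vars_below_def
    proof (intro allI impI)
      fix v w :: "nat \<Rightarrow> complex" assume vw: "\<forall>i<N. v i = w i"
      have "ev (f y) v = ev (f y) w" if "y \<in> F - {z}" for y
        using i[OF that] vw by (simp add: f_def)
      then show "ev l v = ev l w" by (simp add: l_def)
    qed
  qed
qed

definition monic_of :: "nat \<Rightarrow> (nat \<Rightarrow> 'a :: comm_ring_1) \<Rightarrow> 'a poly" where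
  "monic_of D f = monom 1 D + (\<Sum>j<D. monom (f j) j)"

lemma coeff_monic_of: "coeff (monic_of D f) k = (if k < D then f k else if k = D then 1 else 0)"
  by (auto simp: monic_of_def coeff_sum)

lemma degree_monic_of: "degree (monic_of D f) = D"
  by (rule antisym[OF degree_le le_degree]) (auto simp: coeff_monic_of)

lemma lead_coeff_monic_of: "lead_coeff (monic_of D f) = 1"
  by (simp add: degree_monic_of coeff_monic_of)

text \<open>As \<open>p (x + t l) = p (t (l + x / t))\<close>, dividing by \<open>t^D\<close> with \<open>D = degree G\<close> and letting \<open>t\<close> tend to
  infinity shows that the coefficient of \<open>t^D\<close> does not depend on \<open>x\<close>.\<close>

lemma lead_coeff_along_direction:
  assumes G: "\<And>v t. ev p (\<lambda>i. t * v i) = poly (evp v G) t"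
    and P: "\<And>t. ev p (\<lambda>i. x i + t * l i) = poly P t"
  shows "degree P \<le> degree G" "coeff P (degree G) = ev (lead_coeff G) l"
proof -
  let ?D = "degree G"
  have key: "coeff P n = (if n = ?D then ev (lead_coeff G) l else 0)" if n: "n \<ge> degree P" "n \<ge> ?D" for n
  proof -
    \<comment> \<open>With \<open>u = 1 / t\<close>, both \<open>L\<close> and \<open>H\<close>
      equal \<open>u ^ n * poly P (1 / u)\<close> away from 0. Being continuous they agree at 0,
      where only top coefficients survive.\<close>
    define L where "L u = (\<Sum>k\<le>n. coeff P k * u ^ (n - k))" for u
    define H where "H u = u ^ (n - ?D) * (\<Sum>j\<le>?D. ev (coeff G j) (\<lambda>i. l i + u * x i) * u ^ (?D - j))" for u
    have eq: "L u = H u" if u: "u \<noteq> 0" for u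
    proof -
      have "poly P (1 / u) = (\<Sum>k\<le>n. coeff P k * (1 / u) ^ k)"
        unfolding poly_altdef using n(1) by (intro sum.mono_neutral_left) (auto simp: coeff_eq_0)
      then have 1: "u ^ n * poly P (1 / u) = L u" unfolding L_def
        by (simp add: sum_distrib_left) (intro sum.cong, auto simp: u power_diff field_simps)
      have "(\<lambda>i. 1 / u * (l i + u * x i)) = (\<lambda>i. x i + 1 / u * l i)" using u by (auto simp: field_simps)
      then have "poly P (1 / u) = poly (evp (\<lambda>i. l i + u * x i) G) (1 / u)"
        using G[of "1 / u" "\<lambda>i. l i + u * x i"] P[of "1 / u"] by simp
      also have "\<dots> = (\<Sum>j\<le>?D. ev (coeff G j) (\<lambda>i. l i + u * x i) * (1 / u) ^ j)"
        unfolding poly_altdef using degree_evp_le[of "\<lambda>i. l i + u * x i" G]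
        by (intro sum.mono_neutral_cong_left) (auto simp: coeff_eq_0 simp flip: coeff_evp)
      finally have "u ^ ?D * poly P (1 / u) = (\<Sum>j\<le>?D. ev (coeff G j) (\<lambda>i. l i + u * x i) * u ^ (?D - j))"
        by (simp add: sum_distrib_left) (intro sum.cong, auto simp: u power_diff field_simps)
      then have "H u = u ^ (n - ?D) * (u ^ ?D * poly P (1 / u))" unfolding H_def by simp
      also have "\<dots> = u ^ n * poly P (1 / u)" using n(2) by (simp add: mult.assoc[symmetric] power_add[symmetric])
      finally show ?thesis using 1 by simp
    qed
    have "\<exists>Q. \<forall>u. ev q (\<lambda>i. l i + u * x i) = poly Q u" for q
      using mpol_expand[of q "\<lambda>i. Cst (l i)" "\<lambda>i. Cst (x i)"] by auto
    then obtain Q where Q: "\<And>q u. ev q (\<lambda>i. l i + u * x i) = poly (Q q) u" by metis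
    have cL: "isCont L 0" unfolding L_def by (intro continuous_intros)
    have cH: "isCont H 0" unfolding H_def Q by (intro continuous_intros)
    have "(L \<longlongrightarrow> H 0) (at 0)"
    proof (rule Lim_transform_eventually)
      show "(H \<longlongrightarrow> H 0) (at 0)" using cH by (simp add: isCont_def)
      show "\<forall>\<^sub>F u in at 0. H u = L u" unfolding eventually_at_filter by (simp add: eq)
    qed
    moreover have "(L \<longlongrightarrow> L 0) (at 0)" using cL by (simp add: isCont_def)
    ultimately have "L 0 = H 0" using tendsto_unique[OF trivial_limit_at] by blast
    moreover have "L 0 = coeff P n"
    proof -
      have "L 0 = (\<Sum>k\<in>{n}. coeff P k * 0 ^ (n - k))" unfolding L_def
        by (rule sum.mono_neutral_right) auto
      then show ?thesis by simp
    qed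
    moreover have "H 0 = (if n = ?D then ev (lead_coeff G) l else 0)"
    proof -
      have "(\<Sum>j\<le>?D. ev (coeff G j) (\<lambda>i. l i + 0 * x i) * 0 ^ (?D - j)) = (\<Sum>j\<in>{?D}. ev (coeff G j) l * 0 ^ (?D - j))"
        by (rule sum.mono_neutral_cong_right) auto
      then show ?thesis using n(2) by (auto simp: H_def)
    qed
    ultimately show ?thesis by simp
  qed
  show le: "degree P \<le> ?D"
  proof (rule ccontr)
    assume "\<not> degree P \<le> ?D"
    then have "lead_coeff P = 0" "P \<noteq> 0" using key[of "degree P"] by auto
    then show False by simp
  qed
  show "coeff P ?D = ev (lead_coeff G) l" using key[OF le] by simp
qed

text \<open>The linear step of Noether normalization: shearing along a direction on which the top
  homogeneous form of \<open>b\<close> is nonzero makes \<open>b\<close> monic in coordinate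
  \<open>e\<close>, up to the constant \<open>c\<close>.\<close>

lemma exists_monic_direction:
  assumes "b \<noteq> 0" "vars_below (Suc e) b"
  obtains l c \<Psi> where "l e = 1" "\<And>i. i > e \<Longrightarrow> l i = 0" "c \<noteq> 0"
    "lead_coeff \<Psi> = 1" "\<And>k. vars_below e (coeff \<Psi> k)"
    "\<And>x. ev b (\<lambda>i. if i = e then x e else x i + l i * x e) = c * poly (evp x \<Psi>) (x e)"
proof -
  obtain G where G: "\<And>v t. ev b (\<lambda>i. t * v i) = poly (evp v G) t"
    using mpol_expand[of b "\<lambda>i. 0" Var] by auto
  have "G \<noteq> 0"
  proof
    assume "G = 0"
    then have "ev b v = 0" for v using G[of 1 v] by simp
    then show False using assms(1) mpol_neq_0_iff by blast
  qed
  \<comment> \<open>The leading coefficient of \<open>G\<close> is the top homogeneous form of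
    \<open>b\<close>. Multiplying it by \<open>Var e\<close> also secures
    \<open>m e \<noteq> 0\<close>, so that \<open>l\<close> can be normalised to
    \<open>l e = 1\<close>; by homogeneity this changes the form only by a nonzero factor.\<close>
  then have "lead_coeff G * Var e \<noteq> 0" by (auto simp: mpol_neq_0_iff intro!: exI[of _ "\<lambda>i. 1"])
  then obtain m where m: "ev (lead_coeff G) m \<noteq> 0" "m e \<noteq> 0"
    unfolding mpol_neq_0_iff by auto
  define l where "l = (\<lambda>i. if i \<le> e then m i / m e else 0)"
  have lG: "ev (lead_coeff G) l \<noteq> 0"
  proof -
    have "poly (evp l G) t = poly (pcompose (evp m G) [:0, 1 / m e:]) t" for t
    proof -
      have "poly (evp l G) t = ev b (\<lambda>i. t * l i)" by (simp add: G)
      also have "\<dots> = ev b (\<lambda>i. (t / m e) * m i)" by (rule vars_belowD[OF assms(2)]) (auto simp: l_def)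
      finally show ?thesis unfolding G by (simp add: poly_pcompose)
    qed
    then have "evp l G = pcompose (evp m G) [:0, 1 / m e:]" by (simp add: poly_eq_poly_eq_iff[symmetric] fun_eq_iff)
    then have "coeff (evp l G) (degree G) = coeff (evp m G) (degree G) * (1 / m e) ^ degree G"
      by (simp add: coeff_pcompose_linear)
    then show ?thesis using m by simp
  qed
  define c where "c = ev (lead_coeff G) l"
  have "\<exists>E. \<forall>v t. ev b (\<lambda>i. (if i < e then v i else 0) + t * l i) = poly (evp v E) t"
  proof -
    have "(\<lambda>i. ev (if i < e then Var i else 0) v + t * ev (Cst (l i)) v) = (\<lambda>i. (if i < e then v i else 0) + t * l i)"
      for v :: "nat \<Rightarrow> complex" and t by auto
    then show ?thesis using mpol_expand[of b "\<lambda>i. if i < e then Var i else 0" "\<lambda>i. Cst (l i)"] by simp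
  qed
  then obtain E where E': "\<And>v t. ev b (\<lambda>i. (if i < e then v i else 0) + t * l i) = poly (evp v E) t"
    by blast
  have deg: "degree (evp v E) \<le> degree G" "coeff (evp v E) (degree G) = c" for v
    using lead_coeff_along_direction[of b G "\<lambda>i. if i < e then v i else 0" l "evp v E", OF G E'] by (auto simp: c_def)
  define \<Psi> where "\<Psi> = monic_of (degree G) (\<lambda>k. Cst (1 / c) * coeff E k)"
  show ?thesis
  proof (rule that)
    show "l e = 1" "c \<noteq> 0" "lead_coeff \<Psi> = 1" using m lG by (auto simp: l_def c_def \<Psi>_def lead_coeff_monic_of)
    show "l i = 0" if "i > e" for i using that by (simp add: l_def)
    show "vars_below e (coeff \<Psi> k)" for k unfolding vars_below_def
    proof (intro allI impI)
      fix v w :: "nat \<Rightarrow> complex" assume "\<forall>i<e. v i = w i"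
      then have "(\<lambda>i. if i < e then v i else 0) = (\<lambda>i. if i < e then w i else 0)" by auto
      then have "poly (evp v E) t = poly (evp w E) t" for t unfolding E'[symmetric] by metis
      then have "evp v E = evp w E" by (simp add: poly_eq_poly_eq_iff[symmetric] fun_eq_iff)
      then have "ev (coeff E k) v = ev (coeff E k) w" by (metis coeff_evp)
      then show "ev (coeff \<Psi> k) v = ev (coeff \<Psi> k) w" by (simp add: \<Psi>_def coeff_monic_of)
    qed
    fix x
    have "smult c (evp x \<Psi>) = evp x E"
    proof (rule poly_eqI)
      fix k
      show "coeff (smult c (evp x \<Psi>)) k = coeff (evp x E) k"
        using deg[of x] \<open>c \<noteq> 0\<close> coeff_eq_0[of "evp x E" k]
        by (cases k "degree G" rule: linorder_cases) (simp_all add: \<Psi>_def coeff_monic_of)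
    qed
    then have "c * poly (evp x \<Psi>) (x e) = poly (evp x E) (x e)" by (metis poly_smult)
    also have "\<dots> = ev b (\<lambda>i. (if i < e then x i else 0) + x e * l i)" by (simp add: E')
    also have "\<dots> = ev b (\<lambda>i. if i = e then x e else x i + l i * x e)"
      using m by (intro vars_belowD[OF assms(2)]) (auto simp: l_def)
    finally show "ev b (\<lambda>i. if i = e then x e else x i + l i * x e) = c * poly (evp x \<Psi>) (x e)" by simp
  qed
qed

section \<open>Zariski closures of constructible sets\<close>

lemma closed_tower_sols: "closed (tower_sols d N \<Psi>)"
proof -
  have "tower_sols d N \<Psi> = (\<Inter>i\<in>{d..<N}. {v. ev (poly (\<Psi> i) (Var i)) v = 0})"
    by (auto simp: tower_sols_def)
  moreover have "closed {v. ev p v = 0}" for p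
    by (intro closed_Collect_eq continuous_on_ev continuous_on_const)
  ultimately show ?thesis by (simp only:) (intro closed_INT ballI)
qed

text \<open>If \<open>b\<close> vanishes at \<open>x\<close>, move slightly towards
  \<open>y\<close>: on that line \<open>b\<close> is a nonzero polynomial, so the other points near
  \<open>x\<close> satisfy the estimate and continuity returns it to \<open>x\<close>.\<close>

lemma ev_on_segment:
  assumes "\<And>i. i < d \<Longrightarrow> x i = z i" "ev b y \<noteq> 0" "\<delta> > 0"
    and le: "\<And>u. (\<forall>i<d. norm (u i - z i) < \<delta>) \<Longrightarrow> ev b u \<noteq> 0 \<Longrightarrow> r \<le> norm (ev q u)"
  shows "r \<le> norm (ev q x)"
proof -
  define u where "u t = (\<lambda>i. x i + t * (y i - x i))" for t
  have "\<exists>P. \<forall>t. ev p (u t) = poly P t" for p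
    using mpol_expand[of p "\<lambda>i. Cst (x i)" "\<lambda>i. Cst (y i - x i)"] by (auto simp: u_def)
  then obtain P where P: "\<And>p t. ev p (u t) = poly (P p) t" by metis
  have "u 1 = y" "u 0 = x" by (auto simp: u_def)
  then have "P b \<noteq> 0" using P[of b 1] assms(2) by auto
  have near: "\<forall>\<^sub>F t in at 0. norm (t * (y i - x i)) < \<delta>" for i
  proof -
    have "((\<lambda>t. norm (t * (y i - x i))) \<longlongrightarrow> norm (0 * (y i - x i))) (at 0)"
      by (intro tendsto_intros)
    then show ?thesis using assms(3) order_tendstoD(2) by fastforce
  qed
  have "\<forall>\<^sub>F t in at 0. \<forall>i\<in>{..<d}. norm (t * (y i - x i)) < \<delta>"
    by (intro eventually_ball_finite) (use near in auto)
  then have "\<forall>\<^sub>F t in at 0. r \<le> norm (poly (P q) t)"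
    using eventually_nonroot[OF \<open>P b \<noteq> 0\<close>]
  proof eventually_elim
    case (elim t)
    then have "\<forall>i<d. norm (u t i - z i) < \<delta>" using assms(1) by (simp add: u_def)
    then show ?case using le[of "u t"] elim by (simp add: P)
  qed
  moreover have "((\<lambda>t. norm (poly (P q) t)) \<longlongrightarrow> norm (poly (P q) 0)) (at 0)"
    by (auto intro!: tendsto_intros poly_isCont[unfolded isCont_def])
  ultimately have "r \<le> norm (poly (P q) 0)"
    using tendsto_lowerbound trivial_limit_at by blast
  then show ?thesis using P[of q 0] \<open>u 0 = x\<close> by simp
qed

text \<open>Over a generic point the values of \<open>l\<close> on the fibre of \<open>A\<close> are the roots of one polynomial. After
  dividing by its leading coefficient, which normality allows, it yields a polynomial
  vanishing on \<open>A\<close>; it does not vanish at \<open>z\<close> because \<open>l\<close> is bounded away from \<open>0\<close> on the part of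
  \<open>A\<close> near the fibre of \<open>z\<close>.\<close>

lemma separate_generic_part:
  assumes "constructible A" "cylinder N A" "d \<le> N" "tower_eqs d N \<Psi>" "A \<subseteq> tower_sols d N \<Psi>"
    and "z \<notin> closure A" "\<forall>i\<ge>N. z i = 0"
  obtains b h where "b \<noteq> 0" "vars_below d b" "\<And>a. a \<in> A \<Longrightarrow> ev b a \<noteq> 0 \<Longrightarrow> ev h a = 0" "ev h z \<noteq> 0"
proof -
  let ?F = "{v \<in> tower_sols d N \<Psi>. (\<forall>i<d. v i = z i) \<and> (\<forall>i\<ge>N. v i = 0)}"
  obtain l where l: "ev l z = 0" "\<And>x. x \<in> ?F \<Longrightarrow> ev l x = 0 \<Longrightarrow> x = z" "vars_below N l"
    using separating_polynomial[OF tower_finite[OF assms(4,3), of z] _ assms(7)] by blast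
  have trA: "trunc N a \<in> A" if "a \<in> A" for a
    by (rule cylinderD[OF assms(2) that]) (simp add: trunc_def)
  have trl: "ev l (trunc N a) = ev l a" for a
    by (rule vars_belowD[OF l(3)]) (simp add: trunc_def)
  have tr_polydisc: "trunc N a \<in> polydisc N R" if "\<forall>i<N. norm (a i) \<le> R" for a R
    using that by (auto simp: polydisc_def trunc_def)

  obtain \<rho> \<delta> where \<rho>: "\<rho> > 0" "\<delta> > 0"
    "\<And>a. a \<in> A \<Longrightarrow> (\<forall>i<d. norm (a i - z i) < \<delta>) \<Longrightarrow> \<rho> \<le> norm (ev l a)"
  proof -
    define R where "R = 1 + (\<Sum>i<d. norm (z i))"
    obtain R' where R': "\<And>v. v \<in> tower_sols d N \<Psi> \<Longrightarrow> \<forall>i<d. norm (v i) \<le> R \<Longrightarrow> \<forall>i<N. norm (v i) \<le> R'"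
      using tower_bounded[OF assms(4,3)] by blast
    \<comment> \<open>A zero of \<open>\<phi>\<close> in \<open>K\<close> lies in the finite fibre
      \<open>?F\<close> and has \<open>l = 0\<close>, hence is \<open>z\<close>, which is outside
      \<open>closure A\<close>. By compactness \<open>\<phi>\<close> is then bounded away from 0 on
      \<open>K\<close>.\<close>
    define K where "K = polydisc N R' \<inter> (tower_sols d N \<Psi> \<inter> closure A)"
    have "compact K" unfolding K_def
      by (intro compact_Int_closed compact_polydisc closed_Int closed_tower_sols closed_closure)
    define \<phi> where "\<phi> v = norm (ev l v) + (\<Sum>i<d. norm (ev (Var i - Cst (z i)) v))" for v
    have cont: "continuous_on K \<phi>" unfolding \<phi>_def
      by (intro continuous_intros continuous_on_ev[unfolded fun_eq_iff])
    have pos: "\<phi> v > 0" if "v \<in> K" for v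
    proof (rule ccontr)
      assume "\<not> \<phi> v > 0"
      moreover have "(\<Sum>i<d. norm (ev (Var i - Cst (z i)) v)) \<ge> 0" by (intro sum_nonneg) simp
      ultimately have "norm (ev l v) = 0" "(\<Sum>i<d. norm (ev (Var i - Cst (z i)) v)) = 0"
        unfolding \<phi>_def using norm_ge_zero[of "ev l v"] by linarith+
      then have "ev l v = 0" "\<forall>i<d. v i = z i" by (auto simp: sum_nonneg_eq_0_iff)
      then have "v = z" using l(2)[of v] that by (auto simp: K_def polydisc_def)
      then show False using that assms(6) by (simp add: K_def)
    qed
    have "\<exists>r>0. \<forall>v\<in>K. r \<le> \<phi> v"
    proof (cases "K = {}")
      case False
      then obtain x where "x \<in> K" "\<And>v. v \<in> K \<Longrightarrow> \<phi> x \<le> \<phi> v"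
        using continuous_attains_inf[OF \<open>compact K\<close> _ cont] by blast
      then show ?thesis using pos by blast
    qed (auto intro: exI[of _ 1])
    then obtain r where r: "r > 0" "\<And>v. v \<in> K \<Longrightarrow> r \<le> \<phi> v" by blast
    \<comment> \<open>The bound 1 keeps the first coordinates within radius \<open>R\<close>; the
      other one makes the \<open>d\<close> coordinate differences total at most
      \<open>r / 2\<close>.\<close>
    define \<delta> where "\<delta> = min 1 (r / (2 * (real d + 1)))"
    show ?thesis
    proof (rule that[of "r / 2" \<delta>])
      show "r / 2 > 0" "\<delta> > 0" using r(1) by (auto simp: \<delta>_def)
      fix a assume a: "a \<in> A" "\<forall>i<d. norm (a i - z i) < \<delta>"
      have "norm (a i) \<le> R" if "i < d" for i
      proof -
        have "norm (a i) \<le> norm (a i - z i) + norm (z i)" by (metis diff_add_cancel norm_triangle_ineq)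
        also have "\<dots> \<le> 1 + norm (z i)" using a(2) that by (auto simp: \<delta>_def intro: less_imp_le)
        also have "norm (z i) \<le> (\<Sum>i<d. norm (z i))" using that by (intro member_le_sum) auto
        finally show ?thesis by (simp add: R_def)
      qed
      then have "\<forall>i<N. norm (a i) \<le> R'" using R' a(1) assms(5) by blast
      then have "trunc N a \<in> K"
        unfolding K_def using tr_polydisc trA[OF a(1)] assms(5) closure_subset[of A] by blast
      then have "r \<le> \<phi> (trunc N a)" by (rule r(2))
      also have "\<phi> (trunc N a) = norm (ev l a) + (\<Sum>i<d. norm (a i - z i))"
        unfolding \<phi>_def trl using assms(3) by (simp add: trunc_def)
      finally have 1: "r \<le> norm (ev l a) + (\<Sum>i<d. norm (a i - z i))" .
      have "(\<Sum>i<d. norm (a i - z i)) \<le> (\<Sum>i<d. r / (2 * (real d + 1)))"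
        using a(2) by (intro sum_mono) (auto simp: \<delta>_def intro: less_imp_le)
      also have "\<dots> \<le> r / 2" using r(1) by (simp add: field_simps)
      finally show "r / 2 \<le> norm (ev l a)" using 1 by simp
    qed
  qed

  \<comment> \<open>Coordinate \<open>N\<close>, on which \<open>A\<close> does not depend, stores
    the value of \<open>l\<close>. Projecting away the coordinates from \<open>d\<close> to
    \<open>N - 1\<close> turns the values of \<open>l\<close> on the fibres of \<open>A\<close> into
    the fibres of \<open>B\<close>.\<close>
  define A' where "A' = A \<inter> {w. ev (l - Var N) w = 0}"
  define B where "B = {v. \<exists>w\<in>A'. \<forall>j. j \<notin> {d..<N} \<longrightarrow> v j = w j}"
  have B: "v(N := t) \<in> B \<longleftrightarrow> (\<exists>a\<in>A. (\<forall>i<d. a i = v i) \<and> ev l a = t)" for v t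
  proof
    assume "v(N := t) \<in> B"
    then obtain w where w: "w \<in> A" "ev l w = w N" "\<And>j. j \<notin> {d..<N} \<Longrightarrow> (v(N := t)) j = w j"
      unfolding B_def A'_def by auto
    have "w N = t" using w(3)[of N] by simp
    moreover have "w i = v i" if "i < d" for i using w(3)[of i] that assms(3) by simp
    ultimately show "\<exists>a\<in>A. (\<forall>i<d. a i = v i) \<and> ev l a = t" using w by auto
  next
    assume "\<exists>a\<in>A. (\<forall>i<d. a i = v i) \<and> ev l a = t"
    then obtain a where a: "a \<in> A" "\<forall>i<d. a i = v i" "ev l a = t" by blast
    define w where "w = (\<lambda>j. if j < N then a j else if j = N then t else v j)"
    have "w \<in> A" by (rule cylinderD[OF assms(2) a(1)]) (simp add: w_def)
    moreover have "ev l w = t" using a(3) vars_belowD[OF l(3), of w a] by (simp add: w_def)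
    ultimately have "w \<in> A'" by (simp add: A'_def w_def)
    then show "v(N := t) \<in> B" unfolding B_def using a(2) by (auto simp: w_def intro!: bexI[of _ w])
  qed
  have "constructible B" unfolding B_def A'_def
    by (intro constructible_project_set constructible_Int constructible_zero assms(1)) simp
  moreover have "finite {t. v(N := t) \<in> B}" for v
  proof -
    let ?G = "{x \<in> tower_sols d N \<Psi>. (\<forall>i<d. x i = v i) \<and> (\<forall>i\<ge>N. x i = 0)}"
    have "{t. v(N := t) \<in> B} \<subseteq> ev l ` ?G"
    proof
      fix t assume "t \<in> {t. v(N := t) \<in> B}"
      then obtain a where a: "a \<in> A" "\<forall>i<d. a i = v i" "ev l a = t" using B by blast
      then have "trunc N a \<in> ?G" using trA[OF a(1)] assms(3,5) by (auto simp: trunc_def)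
      moreover have "t = ev l (trunc N a)" using trl a(3) by simp
      ultimately show "t \<in> ev l ` ?G" by blast
    qed
    then show ?thesis by (rule finite_subset) (intro finite_imageI tower_finite assms)
  qed
  ultimately obtain b0 \<theta> where b0: "b0 \<noteq> 0" and lc: "\<And>v. ev b0 v \<noteq> 0 \<Longrightarrow> ev (lead_coeff \<theta>) v \<noteq> 0"
    and roots: "\<And>v t. ev b0 v \<noteq> 0 \<Longrightarrow> v(N := t) \<in> B \<longleftrightarrow> poly (evp v \<theta>) t = 0"
    by (rule constructible_generic_roots[of B N]) blast
  let ?m = "degree \<theta>"
  have nz: "evp v \<theta> \<noteq> 0" "lead_coeff (evp v \<theta>) = ev (lead_coeff \<theta>) v" if "ev b0 v \<noteq> 0" for v
  proof -
    show "lead_coeff (evp v \<theta>) = ev (lead_coeff \<theta>) v" using degree_evp[OF lc[OF that]] by simp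
    then show "evp v \<theta> \<noteq> 0" using lc[OF that] by (metis leading_coeff_0_iff)
  qed

  \<comment> \<open>The roots are values of \<open>l\<close> on bounded fibres, so over a bounded
    set each coefficient is at most a constant times the leading one, and the quotient is a
    polynomial.\<close>
  have "lead_coeff \<theta> dvd coeff \<theta> j" for j
  proof (rule mpol_dvd_of_bounded_quotient[OF b0 lc, of d])
    fix R :: real
    obtain R' where R': "\<And>v. v \<in> tower_sols d N \<Psi> \<Longrightarrow> \<forall>i<d. norm (v i) \<le> R \<Longrightarrow> \<forall>i<N. norm (v i) \<le> R'"
      using tower_bounded[OF assms(4,3)] by blast
    obtain C where C: "\<And>v. v \<in> polydisc N R' \<Longrightarrow> norm (ev l v) \<le> C" using ev_bounded_polydisc by blast
    have "norm (ev (coeff \<theta> j) v) \<le> (1 + \<bar>C\<bar>) ^ ?m * norm (ev (lead_coeff \<theta>) v)"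
      if v: "\<forall>i<d. norm (v i) \<le> R" "ev b0 v \<noteq> 0" for v
    proof -
      have "norm t \<le> \<bar>C\<bar>" if t: "poly (evp v \<theta>) t = 0" for t
      proof -
        obtain a where a: "a \<in> A" "\<forall>i<d. a i = v i" "ev l a = t"
          using roots[OF v(2), of t] t B[of v t] by blast
        then have "trunc N a \<in> polydisc N R'" using R' v(1) assms(5) by (intro tr_polydisc) auto
        then show ?thesis using C[of "trunc N a"] trl[of a] a(3) by simp
      qed
      from norm_coeff_le_of_roots[OF nz(1)[OF v(2)] this, of j]
      show ?thesis unfolding nz(2)[OF v(2)] using degree_evp[OF lc[OF v(2)]] by simp
    qed
    then show "\<exists>C. \<forall>v. (\<forall>i<d. norm (v i) \<le> R) \<longrightarrow> ev b0 v \<noteq> 0 \<longrightarrow>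
        norm (ev (coeff \<theta> j) v) \<le> C * norm (ev (lead_coeff \<theta>) v)" by blast
  qed
  then obtain q where q: "\<And>j. coeff \<theta> j = lead_coeff \<theta> * q j" unfolding dvd_def by metis

  obtain v0 where v0: "ev b0 v0 \<noteq> 0" using b0 mpol_neq_0_iff by blast
  \<comment> \<open>Both \<open>b0\<close> and the \<open>q j\<close> may involve later coordinates;
    these are frozen at \<open>v0\<close>, where \<open>b0\<close> does not vanish. The fibres in
    question depend on the first \<open>d\<close> coordinates only.\<close>
  define s where "s = (\<lambda>i. if i < d then Var i else Cst (v0 i))"
  define star where "star v = (\<lambda>i. ev (s i) v)" for v
  have star: "star v i = (if i < d then v i else v0 i)" for v i by (simp add: star_def s_def)
  \<comment> \<open>This is \<open>\<theta>\<close> divided by its leading coefficient and evaluated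
    at \<open>l\<close>, hence zero on \<open>A\<close> over generic points.\<close>
  define h where "h = (\<Sum>j<?m. subst s (q j) * l ^ j) + l ^ ?m"
  have ev_h: "ev h v = (\<Sum>j<?m. ev (q j) (star v) * ev l v ^ j) + ev l v ^ ?m" for v
    by (simp add: h_def star_def)
  show ?thesis
  proof (rule that[of "subst s b0" h])
    show "vars_below d (subst s b0)" unfolding vars_below_def
    proof (intro allI impI)
      fix v w :: "nat \<Rightarrow> complex" assume "\<forall>i<d. v i = w i"
      then have "star v = star w" by (auto simp: star)
      then show "ev (subst s b0) v = ev (subst s b0) w" by (simp add: star_def)
    qed
    have "star v0 = v0" by (auto simp: star)
    then have "ev (subst s b0) v0 \<noteq> 0" using v0 by (simp add: star_def)
    then show "subst s b0 \<noteq> 0" using mpol_neq_0_iff by blast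
    show "ev h a = 0" if a: "a \<in> A" "ev (subst s b0) a \<noteq> 0" for a
    proof -
      have nza: "ev b0 (star a) \<noteq> 0" using a(2) by (simp add: star_def)
      have "poly (evp (star a) \<theta>) (ev l a) = 0"
        using roots[OF nza, of "ev l a"] B[of "star a" "ev l a"] a(1) by (auto simp: star)
      moreover have "poly (evp (star a) \<theta>) (ev l a) = ev (lead_coeff \<theta>) (star a) * ev h a"
      proof -
        have "poly (evp (star a) \<theta>) (ev l a) = (\<Sum>j\<le>?m. ev (coeff \<theta> j) (star a) * ev l a ^ j)"
          unfolding poly_altdef degree_evp[OF lc[OF nza]] by simp
        also have "\<dots> = (\<Sum>j<?m. ev (coeff \<theta> j) (star a) * ev l a ^ j) + ev (lead_coeff \<theta>) (star a) * ev l a ^ ?m"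
          by (simp add: lessThan_Suc_atMost[symmetric])
        also have "(\<Sum>j<?m. ev (coeff \<theta> j) (star a) * ev l a ^ j) =
            ev (lead_coeff \<theta>) (star a) * (\<Sum>j<?m. ev (q j) (star a) * ev l a ^ j)"
          unfolding sum_distrib_left by (intro sum.cong refl, subst q) (simp add: mult.assoc)
        finally show ?thesis by (simp add: ev_h distrib_left)
      qed
      ultimately show ?thesis using lc[OF nza] by simp
    qed
    show "ev h z \<noteq> 0"
    proof (cases ?m)
      case 0
      then show ?thesis by (simp add: ev_h)
    next
      case (Suc k)
      \<comment> \<open>Over generic points near the first \<open>d\<close> coordinates of
        \<open>z\<close> all roots have norm at least \<open>\<rho>\<close>, and \<open>q 0\<close>
        is their product up to sign. As \<open>star z\<close> itself may fail to be generic, the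
        bound reaches it along a segment.\<close>
      have "\<rho> ^ ?m \<le> norm (ev (q 0) (star z))"
      proof (rule ev_on_segment[OF _ v0 \<rho>(2)])
        show "star z i = z i" if "i < d" for i using that by (simp add: star)
        fix u assume u: "\<forall>i<d. norm (u i - z i) < \<delta>" "ev b0 u \<noteq> 0"
        have "\<rho> \<le> norm t" if t: "poly (evp u \<theta>) t = 0" for t
        proof -
          obtain a where "a \<in> A" "\<forall>i<d. a i = u i" "ev l a = t" using roots[OF u(2), of t] t B[of u t] by blast
          then show ?thesis using \<rho>(3)[of a] u(1) by simp
        qed
        then have "\<rho> ^ degree (evp u \<theta>) * norm (lead_coeff (evp u \<theta>)) \<le> norm (poly (evp u \<theta>) 0)"
          using \<rho>(1) nz(1)[OF u(2)] by (intro norm_poly_0_ge_of_roots) auto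
        also have "poly (evp u \<theta>) 0 = ev (lead_coeff \<theta>) u * ev (q 0) u"
          unfolding poly_0_coeff_0 coeff_evp by (subst q) simp
        finally show "\<rho> ^ ?m \<le> norm (ev (q 0) u)"
          unfolding nz(2)[OF u(2)] degree_evp[OF lc[OF u(2)]] using lc[OF u(2)] by (simp add: norm_mult mult.commute)
      qed
      then have "ev (q 0) (star z) \<noteq> 0" using \<rho>(1) by (metis norm_zero not_le zero_less_power)
      then show ?thesis unfolding ev_h l(1) Suc by (simp add: sum.lessThan_Suc_shift)
    qed
  qed
qed

lemma map_poly_subst:
  "coeff (map_poly (subst s) P) k = subst s (coeff P k)"
  "evp v (map_poly (subst s) P) = evp (\<lambda>i. ev (s i) v) P"
  "lead_coeff P = 1 \<Longrightarrow> lead_coeff (map_poly (subst s) P) = 1"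
proof -
  have 0: "subst s 0 = 0" and 1: "subst s 1 = 1" by (auto intro: mpol_eqI)
  show *: "coeff (map_poly (subst s) P) k = subst s (coeff P k)" for k by (simp add: coeff_map_poly 0)
  show "evp v (map_poly (subst s) P) = evp (\<lambda>i. ev (s i) v) P" by (rule poly_eqI) (simp add: *)
  assume lc: "lead_coeff P = 1"
  have "degree (map_poly (subst s) P) = degree P"
    by (rule antisym[OF degree_le le_degree]) (simp_all add: * coeff_eq_0 0 1 lc)
  then show "lead_coeff (map_poly (subst s) P) = 1" using lc by (simp add: * 1)
qed

text \<open>Induction on the dimension \<open>d\<close>: \<open>separate_generic_part\<close>
  handles the part of \<open>A\<close> where \<open>b \<noteq> 0\<close>, and the part with
  \<open>b = 0\<close> is finite over one coordinate fewer after a shear that makes \<open>b\<close>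
  monic. The product of the two polynomials separates \<open>z\<close> from all of
  \<open>A\<close>.\<close>

lemma constructible_separation_aux:
  assumes "constructible A" "cylinder N A" "d \<le> N" "tower_eqs d N \<Psi>" "A \<subseteq> tower_sols d N \<Psi>"
    and "z \<notin> closure A" "\<forall>i\<ge>N. z i = 0"
  shows "\<exists>h. (\<forall>a\<in>A. ev h a = 0) \<and> ev h z \<noteq> 0"
  using assms
proof (induction d arbitrary: A \<Psi> z)
  case 0
  obtain b h where bh: "b \<noteq> 0" "vars_below 0 b" "\<And>a. a \<in> A \<Longrightarrow> ev b a \<noteq> 0 \<Longrightarrow> ev h a = 0" "ev h z \<noteq> 0"
    using separate_generic_part[OF 0] by blast
  have "ev b a \<noteq> 0" for a using bh(1,2) mpol_neq_0_iff vars_belowD[of 0 b] by (metis not_less_zero)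
  then show ?case using bh(3,4) by blast
next
  case (Suc e)
  obtain b h where bh: "b \<noteq> 0" "vars_below (Suc e) b"
    "\<And>a. a \<in> A \<Longrightarrow> ev b a \<noteq> 0 \<Longrightarrow> ev h a = 0" "ev h z \<noteq> 0"
    using separate_generic_part[OF Suc.prems] by blast
  obtain l c \<Psi>' where l: "l e = 1" "\<And>i. i > e \<Longrightarrow> l i = 0" and c: "c \<noteq> 0"
    and \<Psi>': "lead_coeff \<Psi>' = 1" "\<And>k. vars_below e (coeff \<Psi>' k)"
    "\<And>x. ev b (\<lambda>i. if i = e then x e else x i + l i * x e) = c * poly (evp x \<Psi>') (x e)"
    by (rule exists_monic_direction[OF bh(1,2)]) blast
  define T where "T = (\<lambda>i. if i = e then Var e else Var i + Cst (l i) * Var e)"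
  define S where "S = (\<lambda>i. if i = e then Var e else Var i - Cst (l i) * Var e)"
  define \<tau> where "\<tau> v = (\<lambda>i. ev (T i) v)" for v
  define \<sigma> where "\<sigma> v = (\<lambda>i. ev (S i) v)" for v
  have \<tau>: "\<tau> v i = (if i = e then v e else v i + l i * v e)" for v i by (simp add: \<tau>_def T_def)
  have \<sigma>: "\<sigma> v i = (if i = e then v e else v i - l i * v e)" for v i by (simp add: \<sigma>_def S_def)
  have \<tau>\<sigma>: "\<tau> (\<sigma> v) = v" for v by (auto simp: \<tau> \<sigma>)
  have b\<tau>: "ev b (\<tau> x) = c * poly (evp x \<Psi>') (x e)" for x
    using \<Psi>'(3)[of x] by (simp add: \<tau>[abs_def])
  define A1 where "A1 = {x. \<tau> x \<in> A \<inter> {v. ev b v = 0}}"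
  \<comment> \<open>The equation \<open>b = 0\<close> in sheared coordinates becomes the equation
    for coordinate \<open>e\<close>. The later equations stay triangular because the shear changes
    only coordinates below \<open>e\<close>.\<close>
  define \<Psi>1 where "\<Psi>1 i = (if i = e then \<Psi>' else map_poly (subst T) (\<Psi> i))" for i
  have eN: "e < N" using Suc.prems(3) by simp
  have "\<exists>h. (\<forall>a\<in>A1. ev h a = 0) \<and> ev h (\<sigma> z) \<noteq> 0"
  proof (rule Suc.IH[of A1 \<Psi>1])
    show "constructible A1" unfolding A1_def \<tau>_def
      by (intro constructible_subst constructible_Int constructible_zero Suc.prems(1))
    show "e \<le> N" using eN by simp
    show "cylinder N A1" unfolding cylinder_def
    proof (intro allI impI)
      fix v w :: "nat \<Rightarrow> complex" assume vw: "\<forall>i<N. v i = w i" "v \<in> A1"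
      have eq: "\<tau> v i = \<tau> w i" if "i < N" for i using vw(1) that eN by (simp add: \<tau>)
      then have "\<tau> w \<in> A" using vw(2) cylinderD[OF Suc.prems(2), of "\<tau> v" "\<tau> w"] by (simp add: A1_def)
      moreover have "ev b (\<tau> w) = ev b (\<tau> v)" using eq Suc.prems(3) by (intro vars_belowD[OF bh(2)]) auto
      ultimately show "w \<in> A1" using vw(2) by (simp add: A1_def)
    qed
    show "tower_eqs e N \<Psi>1" unfolding tower_eqs_def
    proof (intro allI impI)
      fix i assume i: "e \<le> i \<and> i < N"
      show "lead_coeff (\<Psi>1 i) = 1 \<and> (\<forall>k. vars_below i (coeff (\<Psi>1 i) k))"
      proof (cases "i = e")
        case False
        then have \<Psi>i: "lead_coeff (\<Psi> i) = 1" "\<And>k. vars_below i (coeff (\<Psi> i) k)"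
          using Suc.prems(4) i unfolding tower_eqs_def by auto
        have "vars_below i (coeff (\<Psi>1 i) k)" for k unfolding vars_below_def
        proof (intro allI impI)
          fix v w :: "nat \<Rightarrow> complex" assume "\<forall>j<i. v j = w j"
          then have "ev (coeff (\<Psi> i) k) (\<tau> v) = ev (coeff (\<Psi> i) k) (\<tau> w)"
            using False i by (intro vars_belowD[OF \<Psi>i(2)]) (auto simp: \<tau>)
          then show "ev (coeff (\<Psi>1 i) k) v = ev (coeff (\<Psi>1 i) k) w"
            using False by (simp add: \<Psi>1_def map_poly_subst \<tau>_def)
        qed
        then show ?thesis using False \<Psi>i(1) by (simp only: \<Psi>1_def if_False map_poly_subst(3)) simp
      qed (simp add: \<Psi>1_def \<Psi>')
    qed
    show "A1 \<subseteq> tower_sols e N \<Psi>1"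
    proof
      fix x assume x: "x \<in> A1"
      have "poly (evp x (\<Psi>1 i)) (x i) = 0" if i: "e \<le> i" "i < N" for i
      proof (cases "i = e")
        case True
        then show ?thesis using x b\<tau>[of x] c by (simp add: A1_def \<Psi>1_def)
      next
        case False
        then have "\<tau> x i = x i" using i l(2)[of i] by (simp add: \<tau>)
        moreover have "poly (evp (\<tau> x) (\<Psi> i)) (\<tau> x i) = 0"
          using x Suc.prems(5) i False unfolding A1_def tower_sols_def by auto
        ultimately show ?thesis using False by (simp add: \<Psi>1_def map_poly_subst \<tau>_def)
      qed
      then show "x \<in> tower_sols e N \<Psi>1" by (simp add: tower_sols_def)
    qed
    show "\<forall>i\<ge>N. \<sigma> z i = 0" using Suc.prems(7) eN l(2) by (simp add: \<sigma>)
    have "continuous_on UNIV \<tau>" unfolding \<tau>_def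
      by (intro continuous_on_coordinatewise_then_product continuous_on_ev)
    then have "open (\<tau> -` (- closure A))" by (intro open_vimage) auto
    then have "closed (- (\<tau> -` (- closure A)))" by (rule closed_Compl)
    moreover have "A1 \<subseteq> - (\<tau> -` (- closure A))" using closure_subset[of A] by (auto simp: A1_def)
    ultimately have "closure A1 \<subseteq> - (\<tau> -` (- closure A))" by (intro closure_minimal)
    then show "\<sigma> z \<notin> closure A1" using Suc.prems(6) by (auto simp: \<tau>\<sigma>)
  qed
  then obtain h' where h': "\<And>x. x \<in> A1 \<Longrightarrow> ev h' x = 0" "ev h' (\<sigma> z) \<noteq> 0" by blast
  have "ev (h * subst S h') a = 0" if a: "a \<in> A" for a
  proof (cases "ev b a = 0")
    case True
    then have "\<sigma> a \<in> A1" using a by (simp add: A1_def \<tau>\<sigma>)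
    then show ?thesis using h'(1) by (simp add: \<sigma>_def)
  qed (use bh(3) a in simp)
  moreover have "ev (h * subst S h') z \<noteq> 0" using bh(4) h'(2) by (simp add: \<sigma>_def)
  ultimately show ?case by blast
qed

theorem constructible_separation:
  assumes "constructible A" "cylinder N A" "z \<notin> closure A" "\<forall>i\<ge>N. z i = 0"
  obtains h where "\<And>a. a \<in> A \<Longrightarrow> ev h a = 0" "ev h z \<noteq> 0"
  using constructible_separation_aux[of A N N "\<lambda>i. 0" z] assms
  by (auto simp: tower_eqs_def tower_sols_def)

section \<open>Hilbert's basis theorem\<close>

lemma ideal_over_finite_subset:
  assumes "subring_set S" "x \<in> ideal_over S E"
  shows "\<exists>F. finite F \<and> F \<subseteq> E \<and> x \<in> ideal_over S F"
  using assms(2)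
proof induction
  case zero then show ?case by (auto intro: ideal_over.zero)
next
  case (step x e c)
  then obtain F where F: "finite F" "F \<subseteq> E" "x \<in> ideal_over S F" by blast
  have "x \<in> ideal_over S (insert e F)" using F(3) ideal_over_mono[OF assms(1), of F "insert e F"] by blast
  then have "x + c * e \<in> ideal_over S (insert e F)" using step by (intro ideal_over.step) auto
  then show ?case using F step by (intro exI[of _ "insert e F"]) auto
qed

lemma ideal_over_image_sum:
  assumes "subring_set S" "finite I" "x \<in> ideal_over S (a ` I)"
  shows "\<exists>r. (\<forall>i. r i \<in> S) \<and> x = (\<Sum>i\<in>I. r i * a i)"
  using assms(3)
proof induction
  case zero then show ?case using subring_setD(2)[OF assms(1)] by (intro exI[of _ "\<lambda>i. 0"]) simp
next
  case (step x e c)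
  then obtain r i where r: "\<And>i. r i \<in> S" "x = (\<Sum>i\<in>I. r i * a i)" "i \<in> I" "e = a i" by blast
  have "x + c * e = (\<Sum>j\<in>I. (r(i := r i + c)) j * a j)"
  proof -
    have "(\<Sum>j\<in>I. (r(i := r i + c)) j * a j) = (\<Sum>j\<in>I. r j * a j + (if j = i then c * a i else 0))"
      by (intro sum.cong) (auto simp: algebra_simps)
    then show ?thesis using r(2-4) assms(2) by (simp add: sum.distrib)
  qed
  moreover have "\<forall>j. (r(i := r i + c)) j \<in> S" using r(1) step.hyps(3) subring_setD(6)[OF assms(1)] by simp
  ultimately show ?case by blast
qed

text \<open>The finite generating set is taken inside \<open>E\<close> itself, which lets a system
  of equations be replaced by a finite subsystem.\<close>

definition noetherian_set :: "'a :: comm_ring_1 set \<Rightarrow> bool" where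
  "noetherian_set S \<longleftrightarrow> (\<forall>E\<subseteq>S. \<exists>F. finite F \<and> F \<subseteq> E \<and> E \<subseteq> ideal_over S F)"

lemma noetherian_setE:
  assumes "noetherian_set S" "E \<subseteq> S"
  obtains F where "finite F" "F \<subseteq> E" "E \<subseteq> ideal_over S F"
proof -
  have "\<exists>F. finite F \<and> F \<subseteq> E \<and> E \<subseteq> ideal_over S F"
    using assms by (simp add: noetherian_set_def)
  then show ?thesis using that by (elim exE conjE)
qed

definition poly_over :: "'a :: comm_ring_1 set \<Rightarrow> 'a poly set" where
  "poly_over S = {p. \<forall>i. coeff p i \<in> S}"

lemma subring_set_poly_over:
  assumes "subring_set S"
  shows "subring_set (poly_over S)"
  unfolding subring_set_def
proof (intro conjI ballI)
  fix p q assume pq: "p \<in> poly_over S" "q \<in> poly_over S"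
  then show "p - q \<in> poly_over S" using subring_setD(3)[OF assms] by (simp add: poly_over_def)
  have "coeff (p * q) i \<in> S" for i unfolding coeff_mult
    using pq subring_setD(4)[OF assms] by (auto simp: poly_over_def intro!: subring_set_sum[OF assms])
  then show "p * q \<in> poly_over S" by (simp add: poly_over_def)
qed (use subring_setD(1,2)[OF assms] in \<open>auto simp: poly_over_def coeff_1\<close>)

text \<open>If the ideal \<open>I\<close> of \<open>E\<close> were not finitely generated, one could
  choose successively elements of least degree outside the ideal of the earlier ones. Some leading
  coefficient is a combination of earlier ones, and cancelling it contradicts minimality.\<close>

theorem hilbert_basis:
  fixes S :: "'a :: comm_ring_1 set"
  assumes S: "subring_set S" and noeth: "noetherian_set S"
  shows "noetherian_set (poly_over S)"
  unfolding noetherian_set_def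
proof (intro allI impI)
  fix E assume E: "E \<subseteq> poly_over S"
  let ?P = "poly_over S"
  note P = subring_set_poly_over[OF S]
  define I where "I = ideal_over ?P E"
  have IP: "I \<subseteq> ?P" using ideal_over_in_subring[OF P E] by (auto simp: I_def)
  have "\<exists>F. finite F \<and> F \<subseteq> I \<and> I \<subseteq> ideal_over ?P F"
  proof (rule ccontr)
    assume no: "\<nexists>F. finite F \<and> F \<subseteq> I \<and> I \<subseteq> ideal_over ?P F"
    define good where "good F p \<longleftrightarrow> p \<in> I \<and> p \<notin> ideal_over ?P F \<and>
        (\<forall>q. q \<in> I \<and> q \<notin> ideal_over ?P F \<longrightarrow> degree p \<le> degree q)" for F p
    have ex: "\<exists>p. good F p" if F: "finite F" "F \<subseteq> I" for F
    proof -
      obtain p where "p \<in> I \<and> p \<notin> ideal_over ?P F" using no F by blast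
      from ex_has_least_nat[of "\<lambda>p. p \<in> I \<and> p \<notin> ideal_over ?P F" p degree, OF this]
      show ?thesis by (auto simp: good_def)
    qed
    \<comment> \<open>Each choice depends on all earlier ones, so the recursion builds the list of
      them; \<open>f n\<close> is the entry added at stage \<open>n\<close>.\<close>
    define L where "L = rec_nat [] (\<lambda>_ l. l @ [SOME p. good (set l) p])"
    define f where "f n = (SOME p. good (set (L n)) p)" for n
    have L_Suc: "L (Suc n) = L n @ [f n]" for n by (simp add: L_def f_def)
    have L_0: "L 0 = []" by (simp add: L_def)
    have L_set: "set (L n) = f ` {..<n}" for n
      by (induction n) (auto simp: L_Suc L_0 lessThan_Suc)
    have f_eq: "f n = (SOME p. good (f ` {..<n}) p)" for n
      by (subst f_def) (simp only: L_set)
    have good: "good (f ` {..<n}) (f n)" for n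
    proof (induction n rule: less_induct)
      case (less n)
      then have "f ` {..<n} \<subseteq> I" by (auto simp: good_def)
      then have "\<exists>p. good (f ` {..<n}) p" by (intro ex) auto
      then show ?case by (subst (2) f_eq) (rule someI_ex)
    qed
    define a where "a n = lead_coeff (f n)" for n
    have fI: "f n \<in> I" "f n \<notin> ideal_over ?P (f ` {..<n})" for n using good by (auto simp: good_def)
    have aS: "a n \<in> S" for n using fI(1) IP by (auto simp: a_def poly_over_def)
    have "range a \<subseteq> S" using aS by blast
    then obtain F where F: "finite F" "F \<subseteq> range a" "range a \<subseteq> ideal_over S F"
      using noetherian_setE[OF noeth] by blast
    obtain J where J: "finite J" "F = a ` J" using finite_subset_image[OF F(1,2)] by blast
    obtain n where n: "J \<subseteq> {..<n}" using finite_nat_iff_bounded J(1) by blast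
    have "a n \<in> ideal_over S (a ` {..<n})"
      using F(3) J(2) n ideal_over_mono[OF S, of "a ` J" "a ` {..<n}"] by blast
    then obtain r where r: "\<And>i. r i \<in> S" "a n = (\<Sum>i<n. r i * a i)"
      using ideal_over_image_sum[OF S] by blast
    have deg: "degree (f i) \<le> degree (f n)" if "i < n" for i
    proof -
      have "f n \<notin> ideal_over ?P (f ` {..<i})"
        using fI(2)[of n] ideal_over_mono[OF P image_mono[of "{..<i}" "{..<n}" f]] that by auto
      then show ?thesis using good[of i] fI(1)[of n] unfolding good_def by blast
    qed
    \<comment> \<open>A combination of the earlier elements, raised to the degree of
      \<open>f n\<close>, that has the same leading term as \<open>f n\<close>.\<close>
    define s where "s = (\<Sum>i<n. monom (r i) (degree (f n) - degree (f i)) * f i)"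
    have mP: "monom (r i) k \<in> ?P" for i k using r(1) subring_setD(2)[OF S] by (simp add: poly_over_def)
    have s: "s \<in> ideal_over ?P (f ` {..<n})"
    proof -
      have "(\<Sum>i\<in>A. monom (r i) (degree (f n) - degree (f i)) * f i) \<in> ideal_over ?P (f ` A)" if "finite A" for A
        using that
      proof induction
        case (insert x A)
        have "ideal_over ?P (f ` A) \<subseteq> ideal_over ?P (f ` insert x A)" by (intro ideal_over_mono[OF P]) auto
        then have IH: "(\<Sum>i\<in>A. monom (r i) (degree (f n) - degree (f i)) * f i) \<in> ideal_over ?P (f ` insert x A)"
          using insert.IH by blast
        have "f x \<in> ideal_over ?P (f ` insert x A)" by (intro ideal_over_base[OF P]) simp
        from ideal_over_add[OF ideal_over_mult[OF P mP this] IH] show ?case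
          by (simp only: sum.insert[OF insert.hyps])
      qed (simp add: ideal_over.zero)
      then show ?thesis by (simp add: s_def)
    qed
    have sI: "s \<in> I"
    proof -
      have "f ` {..<n} \<subseteq> ideal_over ?P E" using fI(1) by (auto simp: I_def)
      then show ?thesis using s ideal_over_subset[OF P] unfolding I_def by blast
    qed
    define g where "g = f n - s"
    have gI: "g \<in> I" using ideal_over_diff[OF P] fI(1) sI by (simp add: g_def I_def)
    have gn: "g \<notin> ideal_over ?P (f ` {..<n})"
      using ideal_over_add[OF _ s, of g] fI(2)[of n] by (auto simp: g_def)
    then have "g \<noteq> 0" using ideal_over.zero by metis
    have "coeff s k = (if k = degree (f n) then a n else 0)" if "k \<ge> degree (f n)" for k
    proof -
      have "coeff (monom (r i) (degree (f n) - degree (f i)) * f i) k = (if k = degree (f n) then r i * a i else 0)"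
        if i: "i < n" for i
        using deg[OF i] \<open>k \<ge> degree (f n)\<close> by (auto simp: coeff_monom_mult a_def coeff_eq_0)
      then show ?thesis by (simp add: s_def coeff_sum r(2))
    qed
    then have "coeff g k = 0" if "k \<ge> degree (f n)" for k
      using that by (auto simp: g_def a_def coeff_eq_0)
    then have "degree g < degree (f n)" using \<open>g \<noteq> 0\<close> by (metis leading_coeff_0_iff not_le)
    moreover have "degree (f n) \<le> degree g" using good[of n] gI gn unfolding good_def by blast
    ultimately show False by simp
  qed
  then obtain F where F: "finite F" "F \<subseteq> I" "I \<subseteq> ideal_over ?P F" by blast
  \<comment> \<open>The generators found so far lie in \<open>I\<close>; each is a combination of
    finitely many elements of \<open>E\<close>, and those together generate.\<close>
  have "\<forall>x\<in>F. \<exists>G. finite G \<and> G \<subseteq> E \<and> x \<in> ideal_over ?P G"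
    using F(2) ideal_over_finite_subset[OF P] by (auto simp: I_def)
  then obtain G where G: "\<And>x. x \<in> F \<Longrightarrow> finite (G x) \<and> G x \<subseteq> E \<and> x \<in> ideal_over ?P (G x)" by metis
  have "F \<subseteq> ideal_over ?P (\<Union>(G ` F))"
    using G ideal_over_mono[OF P] by (meson UN_upper subset_iff)
  then have "I \<subseteq> ideal_over ?P (\<Union>(G ` F))" using F(3) ideal_over_subset[OF P] by blast
  moreover have "E \<subseteq> I" using ideal_over_base[OF P] by (auto simp: I_def)
  ultimately show "\<exists>F. finite F \<and> F \<subseteq> E \<and> E \<subseteq> ideal_over ?P F"
    using G F(1) by (intro exI[of _ "\<Union>(G ` F)"]) blast
qed

lemma subring_set_vars_below: "subring_set {p. vars_below n p}"
proof -
  have "vars_below n (x - y) \<and> vars_below n (x * y)" if "vars_below n x" "vars_below n y" for x y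
  proof -
    have "ev x v = ev x w \<and> ev y v = ev y w" if "\<forall>i<n. v i = w i" for v w
      using that \<open>vars_below n x\<close> \<open>vars_below n y\<close> unfolding vars_below_def by blast
    then show ?thesis unfolding vars_below_def by (metis minus_mpol.rep_eq times_mpol.rep_eq)
  qed
  then show ?thesis by (simp add: subring_set_def) (simp add: vars_below_def)
qed

lemma vars_below_Suc_expand:
  assumes "vars_below (Suc n) p"
  shows "\<exists>P\<in>poly_over {p. vars_below n p}. p = poly P (Var n)"
proof -
  obtain P where P: "\<And>v t. ev p (v(n := t)) = poly (evp v P) t" using mpol_expand_coord by metis
  have "vars_below n (coeff P k)" for k unfolding vars_below_def
  proof (intro allI impI)
    fix v w :: "nat \<Rightarrow> complex" assume "\<forall>i<n. v i = w i"
    then have "ev p (v(n := t)) = ev p (w(n := t))" for t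
      by (intro vars_belowD[OF assms]) (auto simp: less_Suc_eq)
    then have "evp v P = evp w P" by (simp add: poly_eq_poly_eq_iff[symmetric] fun_eq_iff P)
    then show "ev (coeff P k) v = ev (coeff P k) w" by (metis coeff_evp)
  qed
  moreover have "p = poly P (Var n)"
  proof (rule mpol_eqI)
    fix v show "ev p v = ev (poly P (Var n)) v" using P[of v "v n"] by simp
  qed
  ultimately show ?thesis by (auto simp: poly_over_def)
qed

text \<open>The full ring has infinitely many variables, so the basis theorem is applied to
  polynomials in the first \<open>n\<close> of them, starting from the constants, which form a
  field.\<close>

lemma noetherian_vars_below: "noetherian_set {p. vars_below n p}"
proof (induction n)
  case 0
  show ?case unfolding noetherian_set_def
  proof (intro allI impI)
    fix E assume E: "E \<subseteq> {p. vars_below 0 p}"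
    show "\<exists>F. finite F \<and> F \<subseteq> E \<and> E \<subseteq> ideal_over {p. vars_below 0 p} F"
    proof (cases "E \<subseteq> {0}")
      case True
      then show ?thesis by (intro exI[of _ "{}"]) (auto intro: ideal_over.zero)
    next
      case False
      then obtain e where e: "e \<in> E" "e \<noteq> 0" by blast
      obtain v where v: "ev e v \<noteq> 0" using e(2) mpol_neq_0_iff by blast
      have "p \<in> ideal_over {p. vars_below 0 p} {e}" if "p \<in> E" for p
      proof -
        have "vars_below 0 p" "vars_below 0 e" using E e(1) that by auto
        then have "ev p w = ev p v" "ev e w = ev e v" for w
          by (auto intro: vars_belowD)
        then have "p = 0 + Cst (ev p v / ev e v) * e"
          using v by (intro mpol_eqI) (metis (no_types) Cst.rep_eq add_0 nonzero_eq_divide_eq times_mpol.rep_eq)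
        moreover have "vars_below 0 (Cst (ev p v / ev e v))" by (simp add: vars_below_def)
        ultimately show ?thesis
          using ideal_over.step[OF ideal_over.zero, of e "{e}" "Cst (ev p v / ev e v)" "{p. vars_below 0 p}"] by simp
      qed
      then show ?thesis using e(1) by (intro exI[of _ "{e}"]) auto
    qed
  qed
next
  case (Suc n)
  let ?S = "{p. vars_below n p}" and ?S' = "{p. vars_below (Suc n) p}"
  have emb: "poly P (Var n) \<in> ?S'" if "P \<in> poly_over ?S" for P
  proof -
    have "ev (poly P (Var n)) v = ev (poly P (Var n)) w" if "\<forall>i<Suc n. v i = w i" for v w
    proof -
      have "evp v P = evp w P"
        using that \<open>P \<in> poly_over ?S\<close> by (intro evp_vars_below[of n]) (auto simp: poly_over_def)
      then show ?thesis using that by simp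
    qed
    then show ?thesis unfolding vars_below_def by blast
  qed
  show ?case unfolding noetherian_set_def
  proof (intro allI impI)
    fix E assume E: "E \<subseteq> ?S'"
    define E' where "E' = {P \<in> poly_over ?S. poly P (Var n) \<in> E}"
    have "E' \<subseteq> poly_over ?S" by (auto simp: E'_def)
    then obtain F where F: "finite F" "F \<subseteq> E'" "E' \<subseteq> ideal_over (poly_over ?S) F"
      by (rule noetherian_setE[OF hilbert_basis[OF subring_set_vars_below Suc]])
    let ?F = "(\<lambda>P. poly P (Var n)) ` F"
    have *: "poly P (Var n) \<in> ideal_over ?S' ?F" if "P \<in> ideal_over (poly_over ?S) F" for P
      using that
    proof induction
      case (step x e c)
      have "poly e (Var n) \<in> ?F" using step.hyps by blast
      from ideal_over.step[OF step.IH this emb[OF step.hyps(3)]] show ?case by simp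
    qed (simp add: ideal_over.zero)
    have "E \<subseteq> ideal_over ?S' ?F"
    proof
      fix p assume p: "p \<in> E"
      then have "vars_below (Suc n) p" using E by blast
      from vars_below_Suc_expand[OF this] obtain P where P: "P \<in> poly_over ?S" "p = poly P (Var n)" by blast
      then have "P \<in> E'" using p by (simp add: E'_def)
      then show "p \<in> ideal_over ?S' ?F" using *[of P] F(3) P(2) by blast
    qed
    then show "\<exists>F. finite F \<and> F \<subseteq> E \<and> E \<subseteq> ideal_over ?S' F"
      using F by (intro exI[of _ ?F]) (auto simp: E'_def)
  qed
qed

lemma finite_equations:
  assumes "\<And>p. p \<in> P \<Longrightarrow> vars_below n p"
  obtains F where "finite F" "F \<subseteq> P" "{v. \<forall>p\<in>P. ev p v = 0} = {v. \<forall>p\<in>F. ev p v = 0}"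
proof -
  have "P \<subseteq> {p. vars_below n p}" using assms by blast
  then obtain F where F: "finite F" "F \<subseteq> P" "P \<subseteq> ideal_over {p. vars_below n p} F"
    by (rule noetherian_setE[OF noetherian_vars_below])
  have "ev p v = 0" if "p \<in> ideal_over {p. vars_below n p} F" "\<forall>q\<in>F. ev q v = 0" for p v
    using that by induction auto
  then show ?thesis using F by (intro that[of F]) auto
qed

section \<open>The Nullstellensatz\<close>

interpretation mpol_vs: vector_space "\<lambda>c p. Cst c * p"
  by unfold_locales (auto intro!: mpol_eqI simp: algebra_simps)

text \<open>A list of variable indices, repetitions included, encodes a monomial. Lists of naturals
  are countable, so the ring has countable dimension over the scalars.\<close>

definition monomial :: "nat list \<Rightarrow> mpol" where
  "monomial xs = prod_list (map Var xs)"

lemma monomials_span: "p \<in> mpol_vs.span (range monomial)"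
proof (induction p rule: mpol_induct)
  case (Cst c)
  have "monomial [] \<in> range monomial" by (rule rangeI)
  then show ?case using mpol_vs.span_scale[OF mpol_vs.span_base, of "monomial []" "range monomial" c]
    by (simp add: monomial_def)
next
  case (Var i)
  have "monomial [i] \<in> range monomial" by (rule rangeI)
  then show ?case using mpol_vs.span_base[of "monomial [i]" "range monomial"] by (simp add: monomial_def)
next
  case (add p q) then show ?case by (rule mpol_vs.span_add)
next
  case (mult p q)
  have mono: "monomial xs * r \<in> mpol_vs.span (range monomial)" if "r \<in> mpol_vs.span (range monomial)" for xs r
    using that
  proof (induction r rule: mpol_vs.span_induct_alt)
    case (step c x y)
    then obtain ys where "x = monomial ys" by blast
    then have "monomial xs * (Cst c * x + y) = Cst c * monomial (xs @ ys) + monomial xs * y"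
      by (simp add: monomial_def algebra_simps)
    then show ?case using step mpol_vs.span_add mpol_vs.span_scale mpol_vs.span_base by (metis rangeI)
  qed (simp add: mpol_vs.span_zero)
  show ?case using mult(1)
  proof (induction p rule: mpol_vs.span_induct_alt)
    case (step c x y)
    then obtain xs where "x = monomial xs" by blast
    then have "(Cst c * x + y) * q = Cst c * (monomial xs * q) + y * q"
      by (simp add: algebra_simps)
    then show ?case using step mono[OF mult(2), of xs] mpol_vs.span_add mpol_vs.span_scale by metis
  qed (simp add: mpol_vs.span_zero)
qed

lemma mpol_in_countable_union_of_finite_spans:
  "\<exists>k. p \<in> mpol_vs.span ((\<lambda>n. monomial (from_nat n)) ` {..<k})"
proof -
  obtain S r where S: "finite S" "S \<subseteq> range monomial" "p = (\<Sum>a\<in>S. Cst (r a) * a)"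
    using monomials_span[of p] unfolding mpol_vs.span_explicit by blast
  obtain T where T: "finite T" "S = monomial ` T" using finite_subset_image[OF S(1,2)] by blast
  obtain k where k: "to_nat ` T \<subseteq> {..<k}" using finite_nat_iff_bounded T(1) by blast
  have "S \<subseteq> (\<lambda>n. monomial (from_nat n)) ` {..<k}"
  proof
    fix a assume "a \<in> S"
    then obtain xs where "xs \<in> T" "a = monomial xs" using T(2) by blast
    then show "a \<in> (\<lambda>n. monomial (from_nat n)) ` {..<k}"
      using k by (intro image_eqI[of _ _ "to_nat xs"]) auto
  qed
  then have "p \<in> mpol_vs.span ((\<lambda>n. monomial (from_nat n)) ` {..<k})"
    unfolding S(3) by (intro mpol_vs.span_sum mpol_vs.span_scale mpol_vs.span_base) blast
  then show ?thesis ..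
qed

lemma ex_mpol_univariate: "\<exists>p. \<forall>v. ev p v = poly Q (v i)"
proof (induction Q)
  case 0 show ?case by (intro exI[of _ 0]) simp
next
  case (pCons a Q)
  then obtain p where "\<forall>v. ev p v = poly Q (v i)" by blast
  then show ?case by (intro exI[of _ "Cst a + Var i * p"]) simp
qed

lemma exists_maximal_ideal:
  assumes "1 \<notin> gen_ideal E"
  obtains M where "ideal_in UNIV M" "E \<subseteq> M" "1 \<notin> M" "\<And>x. x \<notin> M \<Longrightarrow> \<exists>c. 1 - c * x \<in> M"
proof -
  define A where "A = {J. ideal_in UNIV J \<and> E \<subseteq> J \<and> 1 \<notin> J}"
  have "gen_ideal E \<in> A" using assms ideal_in_ideal_over[OF subring_set_UNIV] gen_ideal_base by (auto simp: A_def)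
  then have "A \<noteq> {}" by blast
  moreover have "\<Union>C \<in> A" if C: "C \<noteq> {}" "subset.chain A C" for C
  proof -
    have CA: "C \<subseteq> A" and lin: "\<And>x y. x \<in> C \<Longrightarrow> y \<in> C \<Longrightarrow> x \<subseteq> y \<or> y \<subseteq> x"
      using C(2) by (auto simp: subset.chain_def)
    have "ideal_in UNIV (\<Union>C)" unfolding ideal_in_def
    proof (intro conjI ballI allI)
      show "0 \<in> \<Union>C" using C(1) CA by (auto simp: A_def ideal_in_def)
      show "c * x \<in> \<Union>C" if "x \<in> \<Union>C" for c x using that CA unfolding A_def ideal_in_def by blast
      fix x y assume "x \<in> \<Union>C" "y \<in> \<Union>C"
      then obtain J K where JK: "J \<in> C" "K \<in> C" "x \<in> J" "y \<in> K" by blast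
      have "\<exists>L\<in>C. x \<in> L \<and> y \<in> L" using lin[OF JK(1,2)] JK by blast
      then show "x + y \<in> \<Union>C" using CA unfolding A_def ideal_in_def by blast
    qed simp
    then show ?thesis using C(1) CA by (auto simp: A_def)
  qed
  ultimately obtain M where M: "M \<in> A" "\<And>J. J \<in> A \<Longrightarrow> M \<subseteq> J \<Longrightarrow> J = M"
    using subset_Zorn_nonempty[of A] by metis
  have id: "ideal_in UNIV M" "E \<subseteq> M" "1 \<notin> M" using M(1) by (auto simp: A_def)
  show ?thesis
  proof (rule that[OF id])
    fix x assume x: "x \<notin> M"
    obtain J where J: "ideal_in UNIV J" "M \<subseteq> J" "x \<in> J" "\<And>a. a \<in> J \<Longrightarrow> \<exists>m\<in>M. \<exists>r\<in>UNIV. a = m + r * x"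
      by (rule ideal_in_extend[OF subring_set_UNIV id(1) UNIV_I]) blast
    then have "1 \<in> J" using M(2)[of J] id(2) x by (auto simp: A_def)
    then obtain m c where "1 = m + c * x" "m \<in> M" using J(4) by blast
    then have "1 - c * x \<in> M" by (metis add_diff_cancel_right')
    then show "\<exists>c. 1 - c * x \<in> M" ..
  qed
qed

text \<open>The residue field has countable dimension over the uncountable field of scalars, so by partial
  fractions every coordinate is a scalar modulo a maximal ideal.\<close>

theorem nullstellensatz:
  assumes "1 \<notin> gen_ideal E"
  obtains v where "\<And>p. p \<in> E \<Longrightarrow> ev p v = 0"
proof -
  obtain M where M: "ideal_in UNIV M" "E \<subseteq> M" "1 \<notin> M" and inv: "\<And>x. x \<notin> M \<Longrightarrow> \<exists>c. 1 - c * x \<in> M"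
    using exists_maximal_ideal[OF assms] by blast
  have M0: "0 \<in> M" and Madd: "x \<in> M \<Longrightarrow> y \<in> M \<Longrightarrow> x + y \<in> M" and Mmult: "x \<in> M \<Longrightarrow> c * x \<in> M" for x y c
    using M(1) by (auto simp: ideal_in_def)
  have Mdiff: "x - y \<in> M" if "x \<in> M" "y \<in> M" for x y using Madd[OF that(1) Mmult[OF that(2), of "-1"]] by simp
  have Mconst: "c = 0" if "Cst c \<in> M" for c
  proof (rule ccontr)
    assume "c \<noteq> 0"
    then have "Cst (1 / c) * Cst c = 1" by (intro mpol_eqI) simp
    then show False using Mmult[OF that, of "Cst (1 / c)"] M(3) by simp
  qed
  have prime: "y \<in> M" if "x * y \<in> M" "x \<notin> M" for x y
  proof -
    obtain c where c: "1 - c * x \<in> M" using inv \<open>x \<notin> M\<close> by blast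
    have "y * (1 - c * x) + c * (x * y) \<in> M" by (rule Madd[OF Mmult[OF c] Mmult[OF that(1)]])
    moreover have "y * (1 - c * x) + c * (x * y) = y" by (simp add: algebra_simps)
    ultimately show ?thesis by simp
  qed
  have coord: "\<exists>c. Var i - Cst c \<in> M" for i
  proof (rule ccontr)
    assume no: "\<nexists>c. Var i - Cst c \<in> M"
    \<comment> \<open>If no \<open>Var i - Cst c\<close> lies in the prime ideal \<open>M\<close>,
      neither does a product of such factors; so \<open>Var i\<close> is transcendental modulo
      \<open>M\<close>.\<close>
    have univ: "p \<notin> M" if "Q \<noteq> 0" "\<And>v. ev p v = poly Q (v i)" for p Q
      using that
    proof (induction Q arbitrary: p rule: complex_poly_factor_induct)
      case (const c)
      then have "p = Cst c" by (intro mpol_eqI) simp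
      then show ?case using Mconst const by blast
    next
      case (factor r q)
      obtain p' where p': "\<And>v. ev p' v = poly q (v i)" using ex_mpol_univariate by blast
      have "p = (Var i - Cst r) * p'" by (intro mpol_eqI) (simp add: factor p' algebra_simps)
      then show ?case using prime[of "Var i - Cst r" p'] no factor(2)[OF p'] by blast
    qed
    have "\<exists>h. 1 - h * (Var i - Cst c) \<in> M" for c using inv no by blast
    then have "\<forall>c. \<exists>h. 1 - h * (Var i - Cst c) \<in> M" by blast
    from choice[OF this] obtain h where h: "\<And>c. 1 - h c * (Var i - Cst c) \<in> M" by blast
    have "\<forall>c. \<exists>k. h c \<in> mpol_vs.span ((\<lambda>n. monomial (from_nat n)) ` {..<k})"
      using mpol_in_countable_union_of_finite_spans by blast
    from choice[OF this] obtain k where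
      k: "\<And>c. h c \<in> mpol_vs.span ((\<lambda>n. monomial (from_nat n)) ` {..<k c})" by blast
    \<comment> \<open>The uncountably many inverses \<open>h c\<close> of
      \<open>Var i - Cst c\<close> are spread over countably many finite-dimensional spaces, so one
      space contains infinitely many of them and they are linearly dependent.\<close>
    have "\<exists>m. infinite {c. k c = m}"
    proof (rule ccontr)
      assume "\<nexists>m. infinite {c. k c = m}"
      then have "countable (\<Union>m. {c. k c = m})" by (intro countable_UN) (auto intro: countable_finite)
      moreover have "(\<Union>m. {c. k c = m}) = UNIV" by auto
      ultimately show False using uncountable_UNIV_complex by simp
    qed
    then obtain m where m: "infinite {c. k c = m}" by blast
    have inj: "inj h"
    proof (rule injI, rule ccontr)
      fix c d assume cd: "h c = h d" "c \<noteq> d"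
      have "(1 - h d * (Var i - Cst d)) - (1 - h c * (Var i - Cst c)) = Cst (d - c) * h c"
        by (intro mpol_eqI) (simp add: cd algebra_simps)
      then have "Cst (d - c) * h c \<in> M" using Mdiff[OF h[of d] h[of c]] by simp
      moreover have "Cst (d - c) \<notin> M" using Mconst[of "d - c"] cd by auto
      ultimately have "h c \<in> M" using prime by blast
      then have "1 - h c * (Var i - Cst c) + (Var i - Cst c) * h c \<in> M" by (rule Madd[OF h Mmult])
      moreover have "1 - h c * (Var i - Cst c) + (Var i - Cst c) * h c = 1" by (simp add: algebra_simps)
      ultimately show False using M(3) by simp
    qed
    have "h ` {c. k c = m} \<subseteq> mpol_vs.span ((\<lambda>n. monomial (from_nat n)) ` {..<m})" using k by auto
    moreover have "infinite (h ` {c. k c = m})" using m inj by (meson finite_imageD inj_on_subset subset_UNIV)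
    ultimately have "mpol_vs.dependent (h ` {c. k c = m})"
      using mpol_vs.independent_span_bound[of "(\<lambda>n. monomial (from_nat n)) ` {..<m}" "h ` {c. k c = m}"] by auto
    then obtain S u p0 where S: "finite S" "S \<subseteq> h ` {c. k c = m}" "(\<Sum>p\<in>S. Cst (u p) * p) = 0" "p0 \<in> S" "u p0 \<noteq> 0"
      unfolding mpol_vs.dependent_explicit by blast
    obtain T where T: "finite T" "S = h ` T" using finite_subset_image[OF S(1,2)] by blast
    have sum0: "(\<Sum>c\<in>T. Cst (u (h c)) * h c) = 0"
      using S(3) unfolding T(2) by (subst (asm) sum.reindex) (use inj in \<open>auto intro: inj_on_subset\<close>)
    obtain c0 where c0: "c0 \<in> T" "u (h c0) \<noteq> 0" using S(4,5) T(2) by blast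
    \<comment> \<open>Clearing denominators in a linear relation between the
      \<open>1 / (x - c)\<close> yields \<open>Q\<close>, and evaluation at \<open>c0\<close> leaves
      a single nonzero term. The same expression \<open>q\<close> in the ring lies in
      \<open>M\<close> because the relation holds for the \<open>h c\<close>.\<close>
    define Q where "Q = (\<Sum>c\<in>T. smult (u (h c)) (\<Prod>d\<in>T - {c}. [:- d, 1:]))"
    define q where "q = (\<Sum>c\<in>T. Cst (u (h c)) * (\<Prod>d\<in>T - {c}. Var i - Cst d))"
    have "poly Q c0 = (\<Sum>c\<in>{c0}. u (h c) * (\<Prod>d\<in>T - {c}. c0 - d))"
      unfolding Q_def poly_sum
    proof (rule sum.mono_neutral_cong_right)
      show "\<forall>c\<in>T - {c0}. poly (smult (u (h c)) (\<Prod>d\<in>T - {c}. [:- d, 1:])) c0 = 0"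
        using c0(1) T(1) by (auto simp: poly_prod intro!: prod_zero bexI[of _ c0])
    qed (use T(1) c0 in \<open>auto simp: poly_prod\<close>)
    then have "poly Q c0 \<noteq> 0" using c0 T(1) by simp
    then have "Q \<noteq> 0" by auto
    moreover have "ev q v = poly Q (v i)" for v by (simp add: q_def Q_def poly_sum poly_prod)
    ultimately have "q \<notin> M" by (rule univ)
    moreover have "q \<in> M"
    proof -
      let ?P = "\<Prod>d\<in>T. Var i - Cst d"
      have "(\<Sum>c\<in>T. (Cst (u (h c)) * (\<Prod>d\<in>T - {c}. Var i - Cst d)) * (1 - h c * (Var i - Cst c)))
          = q - (\<Sum>c\<in>T. Cst (u (h c)) * h c) * ?P"
        unfolding q_def sum_distrib_right sum_subtractf[symmetric]
      proof (intro sum.cong refl)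
        fix c assume "c \<in> T"
        then have P: "?P = (Var i - Cst c) * (\<Prod>d\<in>T - {c}. Var i - Cst d)" using T(1) by (simp add: prod.remove)
        show "(Cst (u (h c)) * (\<Prod>d\<in>T - {c}. Var i - Cst d)) * (1 - h c * (Var i - Cst c)) =
            Cst (u (h c)) * (\<Prod>d\<in>T - {c}. Var i - Cst d) - Cst (u (h c)) * h c * ?P"
          unfolding P by (simp add: algebra_simps)
      qed
      also have "\<dots> = q" by (simp add: sum0)
      finally have eq: "(\<Sum>c\<in>T. (Cst (u (h c)) * (\<Prod>d\<in>T - {c}. Var i - Cst d)) * (1 - h c * (Var i - Cst c))) = q" .
      have "(\<Sum>c\<in>X. (Cst (u (h c)) * (\<Prod>d\<in>T - {c}. Var i - Cst d)) * (1 - h c * (Var i - Cst c))) \<in> M" for X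
        by (induction X rule: infinite_finite_induct) (auto intro: M0 Madd Mmult h)
      then show ?thesis unfolding eq[symmetric] .
    qed
    ultimately show False by blast
  qed
  then obtain c where c: "\<And>i. Var i - Cst (c i) \<in> M" by metis
  \<comment> \<open>Modulo \<open>M\<close> every polynomial is congruent to its value at
    \<open>c\<close>, so members of \<open>M\<close> vanish at \<open>c\<close>.\<close>
  have val: "p - Cst (ev p c) \<in> M" for p
  proof (induction p rule: mpol_induct)
    case (Cst a)
    then show ?case by (simp add: M0)
  next
    case (Var i) then show ?case using c by simp
  next
    case (add p q)
    have "p + q - Cst (ev (p + q) c) = (p - Cst (ev p c)) + (q - Cst (ev q c))" by (intro mpol_eqI) simp
    then show ?case using Madd[OF add] by metis
  next
    case (mult p q)
    have "p * q - Cst (ev (p * q) c) = q * (p - Cst (ev p c)) + Cst (ev p c) * (q - Cst (ev q c))"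
      by (intro mpol_eqI) (simp add: algebra_simps)
    then show ?case using Madd[OF Mmult[OF mult(1)] Mmult[OF mult(2)]] by metis
  qed
  show ?thesis
  proof (rule that)
    fix p assume "p \<in> E"
    then have "p - (p - Cst (ev p c)) \<in> M" using M(2) by (intro Mdiff val) blast
    then show "ev p c = 0" using Mconst by simp
  qed
qed

section \<open>Finite residue fields of finitely generated rings\<close>

text \<open>A finite set of representatives stands in for finiteness of the quotient ring, which is
  never constructed.\<close>

definition finite_index :: "'a :: comm_ring_1 set \<Rightarrow> 'a set \<Rightarrow> bool" where
  "finite_index R M \<longleftrightarrow> (\<exists>T. finite T \<and> T \<subseteq> R \<and> (\<forall>x\<in>R. \<exists>t\<in>T. x - t \<in> M))"

definition finite_residue_prime :: "'a :: comm_ring_1 set \<Rightarrow> 'a set \<Rightarrow> bool" where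
  "finite_residue_prime R M \<longleftrightarrow> ideal_in R M \<and> 1 \<notin> M \<and>
    (\<forall>x\<in>R. \<forall>y\<in>R. x * y \<in> M \<longrightarrow> x \<in> M \<or> y \<in> M) \<and> finite_index R M"

lemma finite_residue_primeD:
  assumes "finite_residue_prime R M"
  shows "ideal_in R M" "1 \<notin> M" "x \<in> R \<Longrightarrow> y \<in> R \<Longrightarrow> x * y \<in> M \<Longrightarrow> x \<in> M \<or> y \<in> M" "finite_index R M"
  using assms by (auto simp: finite_residue_prime_def)

lemma subring_set_power: "subring_set R \<Longrightarrow> x \<in> R \<Longrightarrow> x ^ n \<in> R"
  by (induction n) (auto simp: subring_setD)

lemma finite_residue_prime_power:
  assumes "subring_set R" "finite_residue_prime R M" "x \<in> R" "x \<notin> M"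
  shows "x ^ n \<notin> M"
proof (induction n)
  case 0 then show ?case using finite_residue_primeD(2)[OF assms(2)] by simp
next
  case (Suc n)
  then show ?case using finite_residue_primeD(3)[OF assms(2,3) subring_set_power[OF assms(1,3)]] assms(4)
    by auto
qed

text \<open>In a finite quotient the powers of \<open>x\<close> repeat, and primality cancels the
  common power, leaving a positive power of \<open>x\<close> congruent to 1.\<close>

lemma finite_residue_inverse:
  assumes R: "subring_set R" and M: "finite_residue_prime R M" and x: "x \<in> R" "x \<notin> M"
  obtains y where "y \<in> R" "y * x - 1 \<in> M"
proof -
  note id = finite_residue_primeD(1)[OF M]
  obtain T where T: "finite T" "T \<subseteq> R" "\<And>x. x \<in> R \<Longrightarrow> \<exists>t\<in>T. x - t \<in> M"
    using finite_residue_primeD(4)[OF M] unfolding finite_index_def by blast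
  have "\<forall>n. \<exists>t\<in>T. x ^ n - t \<in> M" using T(3) subring_set_power[OF R x(1)] by blast
  then obtain t where t: "\<And>n. t n \<in> T" "\<And>n. x ^ n - t n \<in> M" by metis
  have "\<not> inj t" using T(1) t(1) finite_subset[of "range t" T] finite_imageD[of t UNIV] by auto
  then obtain i j where ij: "i < j" "t i = t j" unfolding inj_def by (metis linorder_neqE_nat)
  have "x ^ j - x ^ i = (x ^ j - t j) - (x ^ i - t i)" using ij by simp
  also have "\<dots> \<in> M" by (rule ideal_in_diff[OF R id t(2) t(2)])
  also have "x ^ j - x ^ i = x ^ i * (x ^ (j - i) - 1)" using ij by (simp add: algebra_simps flip: power_add)
  finally have *: "x ^ i * (x ^ (j - i) - 1) \<in> M" .
  have "x ^ (j - i) - 1 \<in> R" using subring_set_power[OF R x(1)] subring_setD[OF R] by blast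
  then have "x ^ (j - i) - 1 \<in> M"
    using finite_residue_primeD(3)[OF M subring_set_power[OF R x(1)] _ *] finite_residue_prime_power[OF R M x] by blast
  moreover have "x ^ (j - i) = x ^ (j - i - 1) * x" using ij by (metis Suc_diff_1 power_Suc2 zero_less_diff)
  ultimately show ?thesis using that subring_set_power[OF R x(1)] by metis
qed

text \<open>An ideal maximal among those containing \<open>I\<close> and avoiding the powers of
  \<open>u\<close> is prime. Maximality can be reached by counting, since an ideal containing
  \<open>I\<close> is determined by which of the finitely many representatives it contains.\<close>

lemma prime_avoiding_powers:
  assumes R: "subring_set R" and I: "ideal_in R I" "finite_index R I" and u: "u \<in> R" "\<And>n. u ^ n \<notin> I"
  obtains M where "finite_residue_prime R M" "u \<notin> M"
proof -
  obtain T where T: "finite T" "T \<subseteq> R" "\<And>x. x \<in> R \<Longrightarrow> \<exists>t\<in>T. x - t \<in> I"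
    using I(2) unfolding finite_index_def by blast
  define A where "A J \<longleftrightarrow> ideal_in R J \<and> I \<subseteq> J \<and> (\<forall>n. u ^ n \<notin> J)" for J
  have "A I" using I(1) u(2) by (simp add: A_def)
  moreover have "\<forall>J. A J \<longrightarrow> card (T \<inter> J) < Suc (card T)" using T(1) by (simp add: card_mono le_imp_less_Suc)
  ultimately obtain M where M: "A M" "\<And>J. A J \<Longrightarrow> card (T \<inter> J) \<le> card (T \<inter> M)"
    using ex_has_greatest_nat[of A I "\<lambda>J. card (T \<inter> J)" "Suc (card T)"] by blast
  have id: "ideal_in R M" and IM: "I \<subseteq> M" and uM: "\<And>n. u ^ n \<notin> M" using M(1) by (auto simp: A_def)
  have "\<exists>n m r. m \<in> M \<and> r \<in> R \<and> u ^ n = m + r * x" if x: "x \<in> R" "x \<notin> M" for x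
  proof (rule ccontr)
    assume no: "\<not> ?thesis"
    obtain J where J: "ideal_in R J" and MJ: "M \<subseteq> J" and xJ: "x \<in> J"
      and elems: "\<And>a. a \<in> J \<Longrightarrow> \<exists>m\<in>M. \<exists>r\<in>R. a = m + r * x"
      by (rule ideal_in_extend[OF R id x(1)]) blast
    moreover have "u ^ n \<notin> J" for n using no elems by blast
    ultimately have "A J" using MJ IM by (auto simp: A_def)
    obtain t where t: "t \<in> T" "x - t \<in> I" using T(3) x(1) by blast
    have "t = x - (x - t)" by simp
    then have "t \<in> J" using ideal_in_diff[OF R J xJ, of "x - t"] t(2) IM MJ by auto
    moreover have "t \<notin> M"
    proof
      assume "t \<in> M"
      then have "t + (x - t) \<in> M" using ideal_inD(3)[OF id] t(2) IM by blast
      then show False using x(2) by simp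
    qed
    ultimately have "T \<inter> M \<subset> T \<inter> J" using MJ t(1) by blast
    then have "card (T \<inter> M) < card (T \<inter> J)" using T(1) by (intro psubset_card_mono) auto
    then show False using M(2)[OF \<open>A J\<close>] by simp
  qed
  note key = this
  have "x \<in> M \<or> y \<in> M" if xy: "x \<in> R" "y \<in> R" "x * y \<in> M" for x y
  proof (rule ccontr)
    assume "\<not> ?thesis"
    then obtain n m r n' m' r' where 1: "m \<in> M" "r \<in> R" "u ^ n = m + r * x" "m' \<in> M" "r' \<in> R" "u ^ n' = m' + r' * y"
      using key[OF xy(1)] key[OF xy(2)] by blast
    have "u ^ (n + n') = (m' + r' * y) * m + (r * x) * m' + (r * r') * (x * y)"
      unfolding power_add 1(3,6) by (simp add: algebra_simps)
    also have "\<dots> \<in> M"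
    proof (intro ideal_inD(3)[OF id])
      show "(m' + r' * y) * m \<in> M" "(r * x) * m' \<in> M" "(r * r') * (x * y) \<in> M"
        by (rule ideal_inD(4)[OF id]; use 1 xy subring_setD[OF R] ideal_inD(1)[OF id] in simp)+
    qed
    finally show False using uM by blast
  qed
  moreover have "\<forall>x\<in>R. \<exists>t\<in>T. x - t \<in> M" using T(3) IM by (meson subsetD)
  then have "finite_index R M" using T(1,2) by (auto simp: finite_index_def)
  ultimately have "finite_residue_prime R M" using id uM[of 0] by (auto simp: finite_residue_prime_def)
  then show ?thesis using uM[of 1] that by simp
qed

section \<open>Adjoining one element to a subring\<close>

lemma poly_over_pseudo_div:
  fixes f g :: "'a :: idom poly"
  assumes R: "subring_set R" and g: "g \<in> poly_over R" "g \<noteq> 0" and "f \<in> poly_over R"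
  shows "\<exists>k q r. q \<in> poly_over R \<and> r \<in> poly_over R \<and> smult (lead_coeff g ^ k) f = g * q + r \<and>
    (r = 0 \<or> degree r < degree g)"
  using assms(4)
proof (induction "degree f" arbitrary: f rule: less_induct)
  case less
  note P = subring_set_poly_over[OF R]
  have monomP: "monom a n \<in> poly_over R" if "a \<in> R" for a n
    using that subring_setD(2)[OF R] by (simp add: poly_over_def)
  show ?case
  proof (cases "f = 0 \<or> degree f < degree g")
    case True
    then show ?thesis using less.prems subring_setD(2)[OF P] by (intro exI[of _ 0] exI[of _ f]) auto
  next
    case False
    define f' where "f' = smult (lead_coeff g) f - g * monom (lead_coeff f) (degree f - degree g)"
    have lcR: "lead_coeff g \<in> R" "lead_coeff f \<in> R" using g less.prems by (auto simp: poly_over_def)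
    have "smult (lead_coeff g) f = monom (lead_coeff g) 0 * f" by (simp add: monom_0)
    then have f'P: "f' \<in> poly_over R" unfolding f'_def
      using subring_setD(3,4)[OF P] monomP lcR less.prems g(1) by metis
    have "coeff f' i = 0" if "i \<ge> degree f" for i
      using that False by (cases "i = degree f") (auto simp: f'_def coeff_monom_mult mult.commute[of g] coeff_eq_0)
    then have deg: "f' = 0 \<or> degree f' < degree f" by (metis leading_coeff_0_iff not_le)
    obtain k q r where kqr: "q \<in> poly_over R" "r \<in> poly_over R" "smult (lead_coeff g ^ k) f' = g * q + r"
      "r = 0 \<or> degree r < degree g"
    proof (cases "f' = 0")
      case True
      then show ?thesis using that[of 0 0 0] subring_setD(2)[OF P] by simp
    next
      case False
      then show ?thesis using less.hyps[of f'] deg f'P that by blast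
    qed
    have "smult (lead_coeff g ^ Suc k) f = smult (lead_coeff g ^ k) f' + g * smult (lead_coeff g ^ k) (monom (lead_coeff f) (degree f - degree g))"
      by (simp add: f'_def smult_diff_right mult.commute)
    also have "\<dots> = g * (q + smult (lead_coeff g ^ k) (monom (lead_coeff f) (degree f - degree g))) + r"
      unfolding kqr(3) by (simp add: algebra_simps)
    finally have "smult (lead_coeff g ^ Suc k) f = \<dots>" .
    moreover have "q + smult (lead_coeff g ^ k) (monom (lead_coeff f) (degree f - degree g)) \<in> poly_over R"
      using kqr(1) monomP lcR subring_set_power[OF R] subring_setD(4,6)[OF R] subring_setD(6)[OF P]
      by (simp add: smult_monom)
    ultimately show ?thesis using kqr(2,4) by blast
  qed
qed

definition adjoin :: "'a :: comm_ring_1 set \<Rightarrow> 'a \<Rightarrow> 'a set" where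
  "adjoin R c = (\<lambda>p. poly p c) ` poly_over R"

lemma subring_set_adjoin:
  assumes "subring_set R"
  shows "subring_set (adjoin R c)"
  unfolding subring_set_def adjoin_def
proof (intro conjI ballI)
  note P = subring_setD[OF subring_set_poly_over[OF assms]]
  show "1 \<in> (\<lambda>p. poly p c) ` poly_over R" using P(1) by (intro image_eqI[of _ _ 1]) auto
  fix x y assume "x \<in> (\<lambda>p. poly p c) ` poly_over R" "y \<in> (\<lambda>p. poly p c) ` poly_over R"
  then obtain p q where pq: "p \<in> poly_over R" "x = poly p c" "q \<in> poly_over R" "y = poly q c" by blast
  then have "x - y = poly (p - q) c" "x * y = poly (p * q) c" by simp_all
  then show "x - y \<in> (\<lambda>p. poly p c) ` poly_over R" "x * y \<in> (\<lambda>p. poly p c) ` poly_over R"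
    using P(3,4)[OF pq(1,3)] by blast+
qed

lemma adjoin_superset:
  assumes "subring_set R"
  shows "R \<subseteq> adjoin R c" "c \<in> adjoin R c"
proof -
  have "[:a:] \<in> poly_over R" if "a \<in> R" for a
    using that subring_setD(2)[OF assms] by (auto simp: poly_over_def coeff_pCons split: nat.split)
  then show "R \<subseteq> adjoin R c" by (force simp: adjoin_def)
  have "[:0, 1:] \<in> poly_over R"
    using subring_setD(1,2)[OF assms] by (auto simp: poly_over_def coeff_pCons split: nat.split)
  then show "c \<in> adjoin R c" unfolding adjoin_def by (intro image_eqI[of _ _ "[:0, 1:]"]) auto
qed

lemma poly_over_ideal_mult:
  assumes "ideal_in R M" "p \<in> poly_over R" "r \<in> poly_over M"
  shows "p * r \<in> poly_over M"
  using assms(2,3) unfolding poly_over_def mem_Collect_eq coeff_mult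
  by (intro allI ideal_in_sum[OF assms(1)] ideal_inD(4)[OF assms(1)]) auto

lemma ideal_in_poly_over: "ideal_in R M \<Longrightarrow> ideal_in (poly_over R) (poly_over M)"
  using poly_over_ideal_mult[of R M] by (auto simp: ideal_in_def poly_over_def)

text \<open>Modulo \<open>M\<close> the coefficients form a domain in which \<open>\<theta>\<close>
  keeps its positive degree, so a multiple of it cannot be a nonzero constant.\<close>

lemma not_unit_modulo:
  fixes \<theta> :: "'a :: comm_ring_1 poly"
  assumes R: "subring_set R" and M: "finite_residue_prime R M" and \<theta>: "\<theta> \<in> poly_over R" "lead_coeff \<theta> \<notin> M"
    "degree \<theta> \<noteq> 0" and q: "q \<in> poly_over R" and e: "e \<in> R" "e \<notin> M"
  shows "\<theta> * q - [:e:] \<notin> poly_over M"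
proof
  assume *: "\<theta> * q - [:e:] \<in> poly_over M"
  note id = finite_residue_primeD(1)[OF M]
  show False
  proof (cases "q \<in> poly_over M")
    case True
    then have "coeff (\<theta> * q) 0 \<in> M" using poly_over_ideal_mult[OF id \<theta>(1)] by (simp add: poly_over_def)
    moreover have "coeff (\<theta> * q - [:e:]) 0 \<in> M" using * unfolding poly_over_def by blast
    ultimately have "coeff (\<theta> * q) 0 - coeff (\<theta> * q - [:e:]) 0 \<in> M" by (rule ideal_in_diff[OF R id])
    then show False using e(2) by simp
  next
    case False
    define j where "j = Max {i. coeff q i \<notin> M}"
    have fin: "finite {i. coeff q i \<notin> M}"
      by (rule finite_subset[of _ "{..degree q}"]) (use ideal_inD(2)[OF id] in \<open>auto intro: le_degree\<close>)
    have "{i. coeff q i \<notin> M} \<noteq> {}" using False by (auto simp: poly_over_def)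
    then have j: "coeff q j \<notin> M" using Max_in[OF fin] by (auto simp: j_def)
    have above: "coeff q i \<in> M" if "i > j" for i using Max_ge[OF fin, of i] that by (force simp: j_def)
    let ?n = "degree \<theta> + j"
    have "coeff (\<theta> * q - [:e:]) ?n \<in> M" using * unfolding poly_over_def by blast
    then have top: "coeff (\<theta> * q) ?n \<in> M" using \<theta>(3) by (simp add: coeff_pCons split: nat.splits)
    have eq: "coeff (\<theta> * q) ?n = coeff \<theta> (degree \<theta>) * coeff q (?n - degree \<theta>)
        + (\<Sum>i\<in>{..?n} - {degree \<theta>}. coeff \<theta> i * coeff q (?n - i))"
      unfolding coeff_mult by (rule sum.remove) auto
    have "(\<Sum>i\<in>{..?n} - {degree \<theta>}. coeff \<theta> i * coeff q (?n - i)) \<in> M"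
    proof (rule ideal_in_sum[OF id])
      fix i assume i: "i \<in> {..?n} - {degree \<theta>}"
      show "coeff \<theta> i * coeff q (?n - i) \<in> M"
      proof (cases "i < degree \<theta>")
        case True
        then have "coeff q (?n - i) \<in> M" by (intro above) simp
        then show ?thesis using \<theta>(1) by (intro ideal_inD(4)[OF id]) (auto simp: poly_over_def)
      next
        case False
        then show ?thesis using i ideal_inD(2)[OF id] by (simp add: coeff_eq_0)
      qed
    qed
    from ideal_in_diff[OF R id top this] have "lead_coeff \<theta> * coeff q j \<in> M"
      unfolding eq by simp
    moreover have "lead_coeff \<theta> \<in> R" "coeff q j \<in> R" using \<theta>(1) q by (auto simp: poly_over_def)
    ultimately show False using finite_residue_primeD(3)[OF M] \<theta>(2) j by blast
  qed
qed

text \<open>\<open>I\<close> is the image in \<open>R[c]\<close> of the ideal generated by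
  \<open>\<theta>\<close> and \<open>M\<close>. Division by \<open>\<theta>\<close>, whose leading
  coefficient is invertible modulo \<open>M\<close>, leaves remainders of smaller degree, and modulo
  \<open>M\<close> there are finitely many of these.\<close>

lemma adjoin_finite_index:
  fixes c :: "'a :: comm_ring_1"
  assumes R: "subring_set R" and M: "finite_residue_prime R M" and \<theta>: "\<theta> \<in> poly_over R" "lead_coeff \<theta> \<notin> M"
  defines "I \<equiv> {poly (\<theta> * q + r) c |q r. q \<in> poly_over R \<and> r \<in> poly_over M}"
  shows "ideal_in (adjoin R c) I" "finite_index (adjoin R c) I"
proof -
  note id = finite_residue_primeD(1)[OF M]
  note idP = ideal_in_poly_over[OF id]
  note P = subring_setD[OF subring_set_poly_over[OF R]]
  have MR: "p \<in> poly_over M \<Longrightarrow> p \<in> poly_over R" for p by (rule ideal_inD(1)[OF idP])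
  show "ideal_in (adjoin R c) I" unfolding ideal_in_def
  proof (intro conjI ballI subsetI)
    have "0 = poly (\<theta> * 0 + 0) c" by simp
    then show "0 \<in> I" unfolding I_def using P(2) ideal_inD(2)[OF idP] by blast
  next
    fix x assume "x \<in> I"
    then obtain q r where x: "q \<in> poly_over R" "r \<in> poly_over M" "x = poly (\<theta> * q + r) c" by (auto simp: I_def)
    show "x \<in> adjoin R c" unfolding x(3) adjoin_def by (intro imageI P(6) P(4) \<theta>(1) x(1) MR x(2))
    fix y assume "y \<in> I"
    then obtain q' r' where y: "q' \<in> poly_over R" "r' \<in> poly_over M" "y = poly (\<theta> * q' + r') c" by (auto simp: I_def)
    have "x + y = poly (\<theta> * (q + q') + (r + r')) c" by (simp add: x y algebra_simps)
    then show "x + y \<in> I" unfolding I_def using P(6)[OF x(1) y(1)] ideal_inD(3)[OF idP x(2) y(2)] by blast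
  next
    fix a x assume "a \<in> adjoin R c" "x \<in> I"
    then obtain p q r where x: "q \<in> poly_over R" "r \<in> poly_over M" "x = poly (\<theta> * q + r) c"
      and a: "p \<in> poly_over R" "a = poly p c" by (auto simp: I_def adjoin_def)
    have "a * x = poly (\<theta> * (p * q) + p * r) c" by (simp add: x a algebra_simps)
    then show "a * x \<in> I" unfolding I_def using P(4)[OF a(1) x(1)] ideal_inD(4)[OF idP a(1) x(2)] by blast
  qed
  obtain T where T: "finite T" "T \<subseteq> R" "\<And>x. x \<in> R \<Longrightarrow> \<exists>t\<in>T. x - t \<in> M"
    using finite_residue_primeD(4)[OF M] unfolding finite_index_def by blast
  have "lead_coeff \<theta> \<in> R" using \<theta>(1) by (simp add: poly_over_def)
  then obtain b where b: "b \<in> R" "b * lead_coeff \<theta> - 1 \<in> M" using finite_residue_inverse[OF R M _ \<theta>(2)] by blast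
  let ?D = "degree \<theta>"
  define X where "X = (\<lambda>f. \<Sum>i<?D. monom (f i) i) ` PiE {..<?D} (\<lambda>_. T)"
  have finX: "finite X" unfolding X_def using T(1) by (intro finite_imageI finite_PiE) auto
  have monomP: "monom a n \<in> poly_over R" if "a \<in> R" for a n
    using that subring_setD(2)[OF R] by (simp add: poly_over_def)
  have monomM: "monom a n \<in> poly_over M" if "a \<in> M" for a n
    using that ideal_inD(2)[OF id] by (simp add: poly_over_def)
  have XR: "X \<subseteq> poly_over R"
    using T(2) by (auto simp: X_def intro!: subring_set_sum[OF subring_set_poly_over[OF R]] monomP)
  have reduce: "\<exists>s\<in>X. \<exists>q\<in>poly_over R. p - \<theta> * q - s \<in> poly_over M" if "p \<in> poly_over R" for p
    using that
  proof (induction "degree p" arbitrary: p rule: less_induct)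
    case less
    show ?case
    proof (cases "\<forall>i\<ge>?D. coeff p i = 0")
      case True
      have "\<forall>i. \<exists>t\<in>T. coeff p i - t \<in> M" using T(3) less.prems by (auto simp: poly_over_def)
      then obtain t where t: "\<And>i. t i \<in> T" "\<And>i. coeff p i - t i \<in> M" by metis
      define f where "f = restrict t {..<?D}"
      have "(\<Sum>i<?D. monom (f i) i) \<in> X" unfolding X_def f_def using t(1) by (intro imageI restrict_PiE_iff[THEN iffD2]) auto
      moreover have "p - \<theta> * 0 - (\<Sum>i<?D. monom (f i) i) \<in> poly_over M"
        using t(2) True ideal_inD(2)[OF id] by (auto simp: poly_over_def coeff_sum f_def)
      ultimately show ?thesis using P(2) by blast
    next
      case False
      then have p0: "p \<noteq> 0" by auto
      have le: "?D \<le> degree p" using False le_degree[of p] by (auto intro: order_trans)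
      let ?a = "lead_coeff p" and ?n = "degree p"
      have aR: "?a \<in> R" using less.prems by (simp add: poly_over_def)
      \<comment> \<open>The factor \<open>b\<close> inverts the leading coefficient only modulo
        \<open>M\<close>, so the top term cancels up to the error \<open>e\<close> in
        \<open>M\<close>.\<close>
      define q0 where "q0 = monom (b * ?a) (?n - ?D)"
      define e where "e = coeff (p - \<theta> * q0) ?n"
      have cq0: "coeff (\<theta> * q0) i = (if i < ?n - ?D then 0 else b * ?a * coeff \<theta> (i - (?n - ?D)))" for i
        by (subst mult.commute) (simp add: q0_def coeff_monom_mult)
      have e_eq: "e = - ?a * (b * lead_coeff \<theta> - 1)"
        using le by (simp add: e_def cq0 algebra_simps)
      then have eM: "e \<in> M" using b(2) aR subring_setD(5)[OF R] by (simp only:) (intro ideal_inD(4)[OF id])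
      define p' where "p' = p - \<theta> * q0 - monom e ?n"
      have q0P: "q0 \<in> poly_over R" unfolding q0_def by (intro monomP subring_setD(4)[OF R] b aR)
      have p'P: "p' \<in> poly_over R" unfolding p'_def
        by (intro P(3) P(4) less.prems \<theta>(1) q0P MR[OF monomM[OF eM]])
      have small: "coeff p' i = 0" if "i \<ge> ?n" for i
      proof (cases "i = ?n")
        case True then show ?thesis by (simp add: p'_def e_def)
      next
        case False
        then show ?thesis using that le by (simp add: p'_def cq0 coeff_eq_0)
      qed
      have "\<exists>s\<in>X. \<exists>q\<in>poly_over R. p' - \<theta> * q - s \<in> poly_over M"
      \<comment> \<open>Here the degree cannot decrease, so the induction hypothesis is out of
        reach; but \<open>\<theta>\<close> is constant and the remainder is 0.\<close>
      proof (cases "p' = 0 \<and> ?n = 0")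
        case True
        then have "?D = 0" using le by simp
        then have "0 \<in> X" by (simp add: X_def)
        moreover have "p' - \<theta> * 0 - 0 \<in> poly_over M" using True ideal_inD(2)[OF idP] by simp
        ultimately show ?thesis using P(2) by blast
      next
        case False
        then have "degree p' < ?n" using small by (metis degree_0 gr_zeroI leading_coeff_0_iff not_le)
        then show ?thesis using less.hyps p'P by blast
      qed
      then obtain s q where sq: "s \<in> X" "q \<in> poly_over R" "p' - \<theta> * q - s \<in> poly_over M" by blast
      have "p - \<theta> * (q0 + q) - s = (p' - \<theta> * q - s) + monom e ?n" by (simp add: p'_def algebra_simps)
      also have "\<dots> \<in> poly_over M" by (rule ideal_inD(3)[OF idP sq(3) monomM[OF eM]])
      finally show ?thesis using sq(1) P(6)[OF q0P sq(2)] by blast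
    qed
  qed
  show "finite_index (adjoin R c) I" unfolding finite_index_def
  proof (intro exI conjI ballI)
    show "finite ((\<lambda>s. poly s c) ` X)" using finX by simp
    show "(\<lambda>s. poly s c) ` X \<subseteq> adjoin R c" using XR by (auto simp: adjoin_def)
    fix x assume "x \<in> adjoin R c"
    then obtain p where p: "p \<in> poly_over R" "x = poly p c" by (auto simp: adjoin_def)
    obtain s q where sq: "s \<in> X" "q \<in> poly_over R" "p - \<theta> * q - s \<in> poly_over M" using reduce[OF p(1)] by blast
    have "x - poly s c = poly (\<theta> * q + (p - \<theta> * q - s)) c" by (simp add: p(2))
    then have "x - poly s c \<in> I" unfolding I_def using sq(2,3) by blast
    then show "\<exists>t\<in>(\<lambda>s. poly s c) ` X. x - t \<in> I" using sq(1) by blast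
  qed
qed

text \<open>A prime avoiding a prescribed nonzero element is demanded so that the property passes to
  \<open>adjoin R c\<close>: there a leading coefficient, and in the algebraic case also a multiple
  of \<open>u\<close>, must stay nonzero modulo \<open>M\<close>.\<close>

definition residually_finite :: "'a :: comm_ring_1 set \<Rightarrow> bool" where
  "residually_finite R \<longleftrightarrow> (\<forall>u\<in>R. u \<noteq> 0 \<longrightarrow> (\<exists>M. finite_residue_prime R M \<and> u \<notin> M))"

text \<open>Over the fraction field \<open>U\<close> is coprime to the minimal polynomial
  \<open>m\<close>. A \<open>p\<close> of least degree among polynomials whose value at
  \<open>c\<close> is a multiple of \<open>poly U c\<close> divides both up to scalars. Its cofactor
  in \<open>m\<close> vanishes at \<open>c\<close>, so minimality of \<open>m\<close> makes
  \<open>p\<close> constant.\<close>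

lemma algebraic_multiple_in_base:
  fixes c :: "'a :: idom"
  assumes R: "subring_set R" and m: "m \<in> poly_over R" "m \<noteq> 0" "poly m c = 0"
    "\<And>p. p \<in> poly_over R \<Longrightarrow> p \<noteq> 0 \<Longrightarrow> poly p c = 0 \<Longrightarrow> degree m \<le> degree p"
    and U: "U \<in> poly_over R" "poly U c \<noteq> 0"
  obtains w y where "w \<in> R" "w \<noteq> 0" "y \<in> adjoin R c" "w = poly U c * y"
proof -
  note P = subring_setD[OF subring_set_poly_over[OF R]]
  note A = subring_setD[OF subring_set_adjoin[OF R, of c]]
  let ?u = "poly U c"
  define J where "J = {p \<in> poly_over R. \<exists>y\<in>adjoin R c. poly p c = ?u * y}"
  have inA: "p \<in> poly_over R \<Longrightarrow> poly p c \<in> adjoin R c" for p by (auto simp: adjoin_def)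
  have "poly m c = ?u * 0" using m(3) by simp
  then have "m \<in> J" using m(1) A(2) unfolding J_def by blast
  then obtain p where p: "p \<in> J" "p \<noteq> 0" "\<And>r. r \<in> J \<Longrightarrow> r \<noteq> 0 \<Longrightarrow> degree p \<le> degree r"
    using exists_min_degree[of m J] m(2) by metis
  obtain y where y: "y \<in> adjoin R c" "poly p c = ?u * y" and pR: "p \<in> poly_over R" using p(1) by (auto simp: J_def)
  have lc: "lead_coeff p \<in> adjoin R c" using pR adjoin_superset(1)[OF R] by (auto simp: poly_over_def)
  have mod: "\<exists>k q. q \<in> poly_over R \<and> smult (lead_coeff p ^ k) f = p * q"
    if f: "f \<in> J" for f
  proof -
    obtain z where z: "z \<in> adjoin R c" "poly f c = ?u * z" and fR: "f \<in> poly_over R" using f by (auto simp: J_def)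
    obtain k q r where kqr: "q \<in> poly_over R" "r \<in> poly_over R" "smult (lead_coeff p ^ k) f = p * q + r"
      "r = 0 \<or> degree r < degree p" using poly_over_pseudo_div[OF R pR p(2) fR] by blast
    have "poly r c = lead_coeff p ^ k * poly f c - poly p c * poly q c"
      using arg_cong[OF kqr(3), of "\<lambda>f. poly f c"] by (simp add: algebra_simps)
    also have "\<dots> = ?u * (lead_coeff p ^ k * z - y * poly q c)" by (simp add: z(2) y(2) algebra_simps)
    finally have "r \<in> J" unfolding J_def
      using kqr(2) A(3)[OF A(4)[OF subring_set_power[OF subring_set_adjoin[OF R] lc] z(1)] A(4)[OF y(1) inA[OF kqr(1)]]]
      by blast
    then have "r = 0" using kqr(4) p(3) by fastforce
    then show ?thesis using kqr(1,3) by auto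
  qed
  have UJ: "U \<in> J" using U(1) A(1) unfolding J_def by force
  have pc: "poly p c \<noteq> 0"
  proof
    assume "poly p c = 0"
    obtain k q where kq: "smult (lead_coeff p ^ k) U = p * q" using mod[OF UJ] by blast
    have "lead_coeff p ^ k * ?u = poly p c * poly q c"
      using arg_cong[OF kq, of "\<lambda>f. poly f c"] by simp
    then show False using \<open>poly p c = 0\<close> U(2) p(2) by simp
  qed
  obtain k q where kq: "q \<in> poly_over R" "smult (lead_coeff p ^ k) m = p * q" using mod[OF \<open>m \<in> J\<close>] by blast
  have "poly p c * poly q c = 0"
    using arg_cong[OF kq(2), of "\<lambda>f. poly f c"] m(3) by simp
  then have "poly q c = 0" using pc by simp
  have "q \<noteq> 0" using kq(2) m(2) p(2) by auto
  have "degree m = degree (smult (lead_coeff p ^ k) m)" using p(2) by simp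
  also have "\<dots> = degree p + degree q" unfolding kq(2) using p(2) \<open>q \<noteq> 0\<close> by (simp add: degree_mult_eq)
  finally have "degree p = 0" using m(4)[OF kq(1) \<open>q \<noteq> 0\<close> \<open>poly q c = 0\<close>] by simp
  then obtain w where w: "p = [:w:]" by (metis degree_eq_zeroE)
  show ?thesis
  proof (rule that[OF _ _ y(1)])
    have "coeff p 0 \<in> R" using pR unfolding poly_over_def by blast
    then show "w \<in> R" by (simp add: w)
    show "w \<noteq> 0" "w = ?u * y" using p(2) y(2) by (auto simp: w)
  qed
qed

text \<open>If \<open>c\<close> is algebraic over \<open>R\<close>, a nonzero multiple
  \<open>w\<close> of \<open>u\<close> lies in \<open>R\<close>, and a prime avoiding it is
  extended; if \<open>c\<close> is transcendental, a finite quotient is formed in which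
  \<open>c\<close> inverts \<open>u\<close>. Either way no power of \<open>u\<close> lies in
  \<open>I\<close>.\<close>

lemma residually_finite_adjoin:
  fixes c :: "'a :: idom"
  assumes R: "subring_set R" and rf: "residually_finite R"
  shows "residually_finite (adjoin R c)"
  unfolding residually_finite_def
proof (intro ballI impI)
  fix u assume u: "u \<in> adjoin R c" "u \<noteq> 0"
  then obtain U where U: "U \<in> poly_over R" "u = poly U c" by (auto simp: adjoin_def)
  note RP = subring_set_poly_over[OF R]
  note P = subring_setD[OF RP]
  note RA = subring_set_adjoin[OF R, of c]
  have constP: "[:a:] \<in> poly_over R" if "a \<in> R" for a
    using that subring_setD(2)[OF R] by (auto simp: poly_over_def coeff_pCons split: nat.split)
  have "\<exists>I. ideal_in (adjoin R c) I \<and> finite_index (adjoin R c) I \<and> (\<forall>n. u ^ n \<notin> I)"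
  proof (cases "\<exists>p\<in>poly_over R. p \<noteq> 0 \<and> poly p c = 0")
    case True
    then obtain p0 where "p0 \<in> {p \<in> poly_over R. poly p c = 0}" "p0 \<noteq> 0" by blast
    then obtain m where m: "m \<in> {p \<in> poly_over R. poly p c = 0}" "m \<noteq> 0"
      "\<And>r. r \<in> {p \<in> poly_over R. poly p c = 0} \<Longrightarrow> r \<noteq> 0 \<Longrightarrow> degree m \<le> degree r"
      by (rule exists_min_degree) blast
    then have m': "m \<in> poly_over R" "poly m c = 0" by auto
    have m_min: "degree m \<le> degree p" if "p \<in> poly_over R" "p \<noteq> 0" "poly p c = 0" for p
      using m(3)[of p] that by simp
    have "\<exists>w y. w \<in> R \<and> w \<noteq> 0 \<and> y \<in> adjoin R c \<and> w = u * y"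
    proof (rule algebraic_multiple_in_base[of R m c U])
      show "poly U c \<noteq> 0" using u(2) U(2) by simp
    qed (use R m'(1,2) m(2) m_min U(1) in \<open>auto simp: U(2)\<close>)
    then obtain w y where w: "w \<in> R" "w \<noteq> 0" "y \<in> adjoin R c" "w = u * y" by blast
    have lcR: "lead_coeff m \<in> R" using m'(1) by (simp add: poly_over_def)
    \<comment> \<open>Avoiding this product keeps the degree of \<open>m\<close> modulo
      \<open>M\<close> and, \<open>M\<close> being prime, keeps all powers of \<open>w\<close>
      outside \<open>M\<close>.\<close>
    have "lead_coeff m * w \<in> R" "lead_coeff m * w \<noteq> 0" using lcR w m(2) subring_setD(4)[OF R] by auto
    then obtain M where M: "finite_residue_prime R M" "lead_coeff m * w \<notin> M"
      using rf unfolding residually_finite_def by blast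
    note id = finite_residue_primeD(1)[OF M(1)]
    have lcM: "lead_coeff m \<notin> M" and wM: "w \<notin> M"
      using M(2) ideal_inD(4)[OF id w(1), of "lead_coeff m"] ideal_inD(4)[OF id lcR, of w] by (auto simp: mult.commute)
    have deg: "degree m \<noteq> 0"
    proof
      assume "degree m = 0"
      then obtain a where "m = [:a:]" by (metis degree_eq_zeroE)
      then show False using m(2) m'(2) by simp
    qed
    define I where "I = {poly (m * q + r) c |q r. q \<in> poly_over R \<and> r \<in> poly_over M}"
    note I = adjoin_finite_index[OF R M(1) m'(1) lcM, of c, folded I_def]
    have "u ^ n \<notin> I" for n
    proof
      assume un: "u ^ n \<in> I"
      have "w ^ n = y ^ n * u ^ n" by (simp add: w(4) power_mult_distrib mult.commute)
      then have "w ^ n \<in> I" using ideal_inD(4)[OF I(1) subring_set_power[OF RA w(3)] un] by metis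
      then obtain q r where qr: "q \<in> poly_over R" "r \<in> poly_over M" "w ^ n = poly (m * q + r) c" by (auto simp: I_def)
      have rR: "r \<in> poly_over R" using qr(2) ideal_inD(1)[OF id] by (auto simp: poly_over_def)
      have wn: "w ^ n \<in> R" by (rule subring_set_power[OF R w(1)])
      \<comment> \<open>This vanishes at \<open>c\<close>, so by minimality \<open>m\<close> divides
        it up to a power of the leading coefficient. Modulo \<open>M\<close> a multiple of
        \<open>m\<close> would then be a nonzero constant.\<close>
      let ?f = "[:w ^ n:] - r"
      have fR: "?f \<in> poly_over R" by (rule P(3)[OF constP[OF wn] rR])
      obtain k q' s where ks: "q' \<in> poly_over R" "s \<in> poly_over R" "smult (lead_coeff m ^ k) ?f = m * q' + s"
        "s = 0 \<or> degree s < degree m" using poly_over_pseudo_div[OF R m'(1) m(2) fR] by blast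
      have "poly s c = 0" using arg_cong[OF ks(3), of "\<lambda>f. poly f c"] m'(2) qr(3) by simp
      then have "s = 0" using ks(2,4) m_min[of s] not_le by blast
      then have "m * q' - [:lead_coeff m ^ k * w ^ n:] = smult (lead_coeff m ^ k) ?f - [:lead_coeff m ^ k * w ^ n:]"
        using ks(3) by simp
      also have "\<dots> = [:- (lead_coeff m ^ k):] * r" by (simp add: smult_diff_right)
      also have "\<dots> \<in> poly_over M"
        using subring_setD(5)[OF R subring_set_power[OF R lcR]] by (intro poly_over_ideal_mult[OF id] constP qr(2))
      finally have "m * q' - [:lead_coeff m ^ k * w ^ n:] \<in> poly_over M" .
      moreover have "lead_coeff m ^ k * w ^ n \<notin> M"
        using finite_residue_primeD(3)[OF M(1) subring_set_power[OF R lcR] wn]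
          finite_residue_prime_power[OF R M(1) lcR lcM] finite_residue_prime_power[OF R M(1) w(1) wM] by blast
      ultimately show False
        using not_unit_modulo[OF R M(1) m'(1) lcM deg ks(1)] subring_setD(4)[OF R subring_set_power[OF R lcR] wn] by blast
    qed
    then show ?thesis using I by blast
  next
    case False
    have U0: "U \<noteq> 0" using U u by auto
    have lcR: "lead_coeff U \<in> R" using U(1) by (simp add: poly_over_def)
    then obtain M where M: "finite_residue_prime R M" "lead_coeff U \<notin> M"
      using rf U0 unfolding residually_finite_def by (metis leading_coeff_0_iff)
    note id = finite_residue_primeD(1)[OF M(1)]
    \<comment> \<open>This is \<open>x * U - 1\<close>, so \<open>c * u\<close> becomes 1 modulo
      \<open>I\<close>. As \<open>c\<close> satisfies no relation, \<open>1 \<in> I\<close> would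
      already come from an identity of polynomials.\<close>
    define \<theta> where "\<theta> = pCons (-1) U"
    have \<theta>: "\<theta> \<in> poly_over R" "lead_coeff \<theta> \<notin> M" "degree \<theta> \<noteq> 0"
      using U(1) U0 M(2) subring_setD(1,5)[OF R] by (auto simp: \<theta>_def poly_over_def coeff_pCons split: nat.split)
    define I where "I = {poly (\<theta> * q + r) c |q r. q \<in> poly_over R \<and> r \<in> poly_over M}"
    note I = adjoin_finite_index[OF R M(1) \<theta>(1,2), of c, folded I_def]
    have "1 \<notin> I"
    proof
      assume "1 \<in> I"
      then obtain q r where qr: "q \<in> poly_over R" "r \<in> poly_over M" "1 = poly (\<theta> * q + r) c" by (auto simp: I_def)
      have rR: "r \<in> poly_over R" using qr(2) ideal_inD(1)[OF id] by (auto simp: poly_over_def)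
      have "\<theta> * q + r - 1 \<in> poly_over R" by (intro P(3) P(6) P(4) P(1) \<theta>(1) qr(1) rR)
      moreover have "poly (\<theta> * q + r - 1) c = 0" using qr(3) by simp
      ultimately have "\<theta> * q + r - 1 = 0" using False by blast
      then have "\<theta> * q - [:1:] = [:-1:] * r" by (simp add: one_pCons algebra_simps)
      also have "\<dots> \<in> poly_over M" using subring_setD(1,5)[OF R] by (intro poly_over_ideal_mult[OF id] constP qr(2)) auto
      finally show False
        using not_unit_modulo[OF R M(1) \<theta> qr(1) subring_setD(1)[OF R] finite_residue_primeD(2)[OF M(1)]] by blast
    qed
    have cA: "c \<in> adjoin R c" by (rule adjoin_superset(2)[OF R])
    have "poly (\<theta> * 1 + 0) c \<in> I" unfolding I_def using P(1) ideal_inD(2)[OF ideal_in_poly_over[OF id]] by blast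
    then have cu: "c * u - 1 \<in> I" by (simp add: \<theta>_def U(2))
    have cun: "(c * u) ^ n - 1 \<in> I" for n
    proof (induction n)
      case 0 then show ?case using ideal_inD(2)[OF I(1)] by simp
    next
      case (Suc n)
      have "c * u \<in> adjoin R c" by (rule subring_setD(4)[OF RA cA u(1)])
      from ideal_inD(3)[OF I(1) ideal_inD(4)[OF I(1) this Suc] cu] show ?case by (simp add: algebra_simps)
    qed
    have "u ^ n \<notin> I" for n
    proof
      assume "u ^ n \<in> I"
      then have "c ^ n * u ^ n \<in> I" by (rule ideal_inD(4)[OF I(1) subring_set_power[OF RA cA]])
      then have "c ^ n * u ^ n - ((c * u) ^ n - 1) \<in> I" by (rule ideal_in_diff[OF RA I(1) _ cun])
      then show False using \<open>1 \<notin> I\<close> by (simp add: power_mult_distrib)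
    qed
    then show ?thesis using I by blast
  qed
  then show "\<exists>M. finite_residue_prime (adjoin R c) M \<and> u \<notin> M"
    using prime_avoiding_powers[OF RA _ _ u(1)] by blast
qed

lemma subring_set_Ints: "subring_set \<int>"
  by (auto simp: subring_set_def)

lemma residually_finite_Ints: "residually_finite (\<int> :: complex set)"
  unfolding residually_finite_def
proof (intro ballI impI)
  fix u :: complex assume u: "u \<in> \<int>" "u \<noteq> 0"
  then obtain k :: int where k: "u = of_int k" by (auto elim: Ints_cases)
  then have "k \<noteq> 0" using u by auto
  obtain p :: nat where p: "prime p" "p > nat \<bar>k\<bar>" using bigger_prime by blast
  have pk: "\<not> int p dvd k"
  proof
    assume "int p dvd k"
    then have "int p \<le> \<bar>k\<bar>" using dvd_imp_le_int[of k "int p"] \<open>k \<noteq> 0\<close> by simp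
    then show False using p(2) by linarith
  qed
  define M where "M = (of_int ` {n. int p dvd n} :: complex set)"
  have inM: "of_int n \<in> M \<longleftrightarrow> int p dvd n" for n by (auto simp: M_def)
  have "ideal_in \<int> M" unfolding ideal_in_def
  proof (intro conjI ballI)
    show "M \<subseteq> \<int>" "0 \<in> M" by (auto simp: M_def intro: image_eqI[of _ _ 0])
    show "x + y \<in> M" if xy: "x \<in> M" "y \<in> M" for x y
    proof -
      obtain i j where "x = of_int i" "y = of_int j" "int p dvd i" "int p dvd j" using xy by (auto simp: M_def)
      then show ?thesis using inM[of "i + j"] by simp
    qed
    show "x * y \<in> M" if xy: "x \<in> \<int>" "y \<in> M" for x y
    proof -
      obtain i j where "x = of_int i" "y = of_int j" "int p dvd j" using xy by (auto simp: M_def elim: Ints_cases)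
      then show ?thesis using inM[of "i * j"] by simp
    qed
  qed
  moreover have "1 \<notin> M" using inM[of 1] prime_gt_1_nat[OF p(1)] by auto
  moreover have "x \<in> M \<or> y \<in> M" if xy: "x \<in> \<int>" "y \<in> \<int>" "x * y \<in> M" for x y
  proof -
    obtain i j where ij: "x = of_int i" "y = of_int j" using xy(1,2) by (auto elim!: Ints_cases)
    then have "int p dvd i * j" using xy(3) inM[of "i * j"] by simp
    then show ?thesis using p(1) ij inM prime_dvd_mult_iff[of "int p"] by simp
  qed
  moreover have "finite_index \<int> M" unfolding finite_index_def
  proof (intro exI conjI ballI)
    show "finite ((of_int :: int \<Rightarrow> complex) ` {0..int p})" by simp
    fix x :: complex assume "x \<in> \<int>"
    then obtain i where i: "x = of_int i" by (auto elim: Ints_cases)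
    have "i mod int p \<in> {0..int p}" using prime_gt_0_nat[OF p(1)]
      by (simp add: order_less_imp_le)
    moreover have "x - of_int (i mod int p) \<in> M"
      using inM[of "i - i mod int p"] i by (simp add: dvd_minus_mod)
    ultimately show "\<exists>t\<in>of_int ` {0..int p}. x - t \<in> M" by blast
  qed auto
  ultimately show "\<exists>M. finite_residue_prime \<int> M \<and> u \<notin> M"
    using pk inM k by (auto simp: finite_residue_prime_def)
qed

theorem finite_residue_prime_exists:
  fixes S :: "complex set"
  assumes "finite S"
  obtains R M where "subring_set R" "S \<subseteq> R" "finite_residue_prime R M"
proof -
  have "\<exists>R. subring_set R \<and> S \<subseteq> R \<and> residually_finite R"
    using assms
  proof induction
    case empty
    then show ?case using subring_set_Ints residually_finite_Ints by blast
  next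
    case (insert c S)
    then obtain R where R: "subring_set R" "S \<subseteq> R" "residually_finite R" by blast
    have "insert c S \<subseteq> adjoin R c" using R(2) adjoin_superset[OF R(1), of c] by blast
    then show ?case using subring_set_adjoin[OF R(1)] residually_finite_adjoin[OF R(1,3)] by blast
  qed
  then obtain R where R: "subring_set R" "S \<subseteq> R" "residually_finite R" by blast
  obtain M where "finite_residue_prime R M"
    using R(3) subring_setD(1)[OF R(1)] zero_neq_one unfolding residually_finite_def by metis
  then show ?thesis using R(1,2) that by blast
qed

section \<open>Stable images\<close>

text \<open>Once the sizes of the \<open>D k\<close> are constant, from \<open>K\<close> on,
  \<open>f\<close> maps \<open>D k\<close> bijectively onto \<open>D (Suc k)\<close>. Further
  preimages of the orbit could only come from levels below \<open>K\<close>; the images of those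
  levels form a finite set, which the injective orbit \<open>z\<close> eventually leaves.\<close>

lemma orbit_of_unstable_images:
  assumes "f ` X \<subseteq> X" "finite (X - f ` X)" "\<And>k. (f ^^ k) ` X \<noteq> (f ^^ Suc k) ` X"
  obtains y m where "\<And>n. y n \<in> X" "\<And>n. y (Suc n) = f (y n)"
    "\<And>n x. x \<in> X \<Longrightarrow> f x = y (Suc n) \<Longrightarrow> x = y n" "y 0 \<notin> (f ^^ m) ` X"
proof -
  define A where "A k = (f ^^ k) ` X" for k
  have A0: "A 0 = X" and A_Suc: "A (Suc k) = f ` A k" for k by (auto simp: A_def)
  have Suc_sub: "A (Suc k) \<subseteq> A k" for k
  proof (induction k)
    case 0 then show ?case using assms(1) by (simp add: A0 A_Suc)
  next
    case (Suc k) then show ?case by (metis A_Suc image_mono)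
  qed
  have mono: "A j \<subseteq> A i" if "i \<le> j" for i j
    using that by (induction rule: dec_induct) (use Suc_sub in blast)+
  define D where "D k = A k - A (Suc k)" for k
  have D_Suc: "D (Suc k) \<subseteq> f ` D k" for k unfolding D_def A_Suc[of "Suc k"] A_Suc[of k] by blast
  have fin: "finite (D k)" for k
  proof (induction k)
    case 0 then show ?case using assms(2) by (simp add: D_def A0 A_Suc)
  next
    case (Suc k) then show ?case using D_Suc[of k] by (meson finite_imageI finite_subset)
  qed
  have nonempty: "D k \<noteq> {}" for k using Suc_sub[of k] assms(3)[of k] unfolding D_def A_def by blast
  have card_Suc: "card (D (Suc k)) \<le> card (f ` D k)" "card (f ` D k) \<le> card (D k)" for k
    by (rule card_mono[OF finite_imageI[OF fin] D_Suc], rule card_image_le[OF fin])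
  have disj: "i = j" if "x \<in> D i" "x \<in> D j" for i j x
  proof -
    have "\<not> i < j" if "x \<in> D i" "x \<in> D j" for i j using mono[of "Suc i" j] that by (auto simp: D_def)
    then show ?thesis using that by (meson linorder_neqE_nat)
  qed
  have level: "\<exists>j<n. x \<in> D j" if "x \<in> X" "x \<notin> A n" for n x
    using that
  proof (induction n)
    case (Suc n)
    then show ?case by (cases "x \<in> A n") (auto simp: D_def less_Suc_eq)
  qed (simp add: A0)
  obtain K where K: "\<And>k. card (D K) \<le> card (D k)"
    using ex_has_least_nat[of "\<lambda>_. True" 0 "\<lambda>k. card (D k)"] by auto
  have decr: "card (D k) \<le> card (D K)" if "K \<le> k" for k
    using that by (induction rule: dec_induct) (use card_Suc le_trans in blast)+
  have eq: "card (f ` D k) = card (D k)" "card (D (Suc k)) = card (f ` D k)" if "K \<le> k" for k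
    using K[of "Suc k"] K[of k] decr[of k] decr[of "Suc k"] card_Suc[of k] that by linarith+
  have inj: "inj_on f (D k)" if "K \<le> k" for k using eq(1)[OF that] fin by (simp add: eq_card_imp_inj_on)
  have onto: "f ` D k = D (Suc k)" if "K \<le> k" for k
    using card_subset_eq[OF finite_imageI[OF fin] D_Suc eq(2)[OF that]] by simp
  obtain z0 where z0: "z0 \<in> D K" using nonempty by blast
  define z where "z n = (f ^^ n) z0" for n
  have zD: "z n \<in> D (K + n)" for n
  proof (induction n)
    case 0 then show ?case using z0 by (simp add: z_def)
  next
    case (Suc n) then show ?case using onto[of "K + n"] by (auto simp: z_def)
  qed
  have "inj z" by (rule injI) (use zD disj add_left_cancel in metis)
  define G where "G = f ` (\<Union>j<K. D j)"
  have "finite G" unfolding G_def using fin by auto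
  then have "finite (z -` G)" using \<open>inj z\<close> by (rule finite_vimageI)
  then obtain n0 where n0: "\<And>n. n \<ge> n0 \<Longrightarrow> z n \<notin> G"
    using finite_nat_iff_bounded[of "z -` G"] by (metis lessThan_iff not_le subsetD vimageI)
  show ?thesis
  proof (rule that[of "\<lambda>n. z (n0 + n)" "Suc (K + n0)"])
    show "z (n0 + n) \<in> X" for n using zD[of "n0 + n"] mono[of 0 "K + (n0 + n)"] by (auto simp: D_def A0)
    show "z (n0 + Suc n) = f (z (n0 + n))" for n by (simp add: z_def)
    show "z (n0 + 0) \<notin> (f ^^ Suc (K + n0)) ` X" using zD[of n0] by (simp add: D_def A_def)
    fix n x assume x: "x \<in> X" "f x = z (n0 + Suc n)"
    let ?k = "K + (n0 + n)"
    have fx: "f x \<in> D (Suc ?k)" using zD[of "n0 + Suc n"] x(2) by simp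
    have "x \<notin> A (Suc ?k)" using fx unfolding D_def A_Suc[of "Suc ?k"] by blast
    then obtain j where j: "j < Suc ?k" "x \<in> D j" using level[OF x(1)] by blast
    have "K \<le> j"
    proof (rule ccontr)
      assume "\<not> K \<le> j"
      then have "f x \<in> G" unfolding G_def using j(2) by (intro imageI UN_I[of j]) auto
      then show False using n0[of "n0 + Suc n"] x(2) by simp
    qed
    then have "f x \<in> D (Suc j)" using onto j(2) by blast
    then have "j = ?k" using disj[OF fx, of "Suc j"] by simp
    then have "x \<in> D ?k" using j(2) by simp
    moreover have "f x = f (z (n0 + n))" using x(2) by (simp add: z_def)
    ultimately show "x = z (n0 + n)" using inj[of ?k] zD[of "n0 + n"] by (auto simp: inj_on_def)
  qed
qed

text \<open>Points of the affine space \<open>complex ^ 'n\<close> are encoded as blocks of \<open>CARD('n)\<close> consecutive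
  coordinates of a sequence; \<open>block k\<close> reads the \<open>k\<close>-th block.\<close>

definition coord_index :: "'n :: finite \<Rightarrow> nat" where
  "coord_index = (SOME e. bij_betw e UNIV {..<CARD('n)})"

lemma coord_index: "bij_betw (coord_index :: 'n :: finite \<Rightarrow> nat) UNIV {..<CARD('n)}"
proof -
  have "\<exists>e :: 'n \<Rightarrow> nat. bij_betw e UNIV {0..<CARD('n)}" by (rule ex_bij_betw_finite_nat) simp
  then have "\<exists>e :: 'n \<Rightarrow> nat. bij_betw e UNIV {..<CARD('n)}" by (simp add: lessThan_atLeast0)
  then show ?thesis unfolding coord_index_def by (rule someI_ex)
qed

lemma coord_index_less: "coord_index (i :: 'n :: finite) < CARD('n)"
  using coord_index[where 'n = 'n] by (auto simp: bij_betw_def)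

lemma coord_index_inv: "j < CARD('n) \<Longrightarrow> \<exists>i :: 'n :: finite. coord_index i = j"
  using coord_index[where 'n = 'n] by (auto simp: bij_betw_def) (metis imageE lessThan_iff)

lemma coord_index_inj: "coord_index i = coord_index j \<longleftrightarrow> (i :: 'n :: finite) = j"
  using coord_index[where 'n = 'n] by (auto simp: bij_betw_def inj_on_def)

definition block :: "nat \<Rightarrow> (nat \<Rightarrow> complex) \<Rightarrow> complex ^ 'n :: finite" where
  "block k v = (\<chi> i. v (k * CARD('n) + coord_index i))"

definition unblock :: "complex ^ 'n :: finite \<Rightarrow> nat \<Rightarrow> complex" where
  "unblock x j = (if j < CARD('n) then x $ (SOME i. coord_index i = j) else 0)"

lemma unblock_coord_index [simp]: "unblock x (coord_index i) = x $ (i :: 'n :: finite)"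
proof -
  have "(SOME i'. coord_index i' = coord_index i) = i"
    by (rule some_equality) (simp_all add: coord_index_inj)
  then show ?thesis by (simp add: unblock_def coord_index_less)
qed

lemma unblock_beyond [simp]: "j \<ge> CARD('n) \<Longrightarrow> unblock (x :: complex ^ 'n :: finite) j = 0"
  by (simp add: unblock_def)

lemma block_unblock [simp]: "block 0 (unblock x) = x"
  by (simp add: block_def vec_eq_iff)

lemma block_eqI:
  fixes x :: "complex ^ 'n :: finite"
  assumes "\<And>j. j < CARD('n) \<Longrightarrow> v (k * CARD('n) + j) = unblock x j"
  shows "block k v = x"
  unfolding block_def vec_eq_iff by (simp add: assms[OF coord_index_less])

lemma continuous_on_block: "continuous_on UNIV (block k)"
  unfolding block_def
  by (rule continuous_on_vec_lambda) (rule continuous_on_product_then_coordinatewise[OF continuous_on_id])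

lemma mpol_of_poly_fun:
  fixes p :: "complex ^ 'n :: finite \<Rightarrow> complex"
  assumes "poly_fun p"
  shows "\<exists>q. vars_below CARD('n) q \<and> (\<forall>v. ev q v = p (block 0 v))"
  using assms
proof induction
  case (const c) show ?case by (intro exI[of _ "Cst c"]) (simp add: vars_below_def)
next
  case (coord i)
  show ?case using coord_index_less[of i]
    by (intro exI[of _ "Var (coord_index i)"]) (simp add: vars_below_def block_def)
next
  case (add p q)
  then obtain p' q' where "vars_below CARD('n) p'" "\<forall>v. ev p' v = p (block 0 v)"
    "vars_below CARD('n) q'" "\<forall>v. ev q' v = q (block 0 v)" by blast
  then show ?case using subring_setD(6)[OF subring_set_vars_below, of p' "CARD('n)" q']
    by (intro exI[of _ "p' + q'"]) simp
next
  case (mult p q)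
  then obtain p' q' where "vars_below CARD('n) p'" "\<forall>v. ev p' v = p (block 0 v)"
    "vars_below CARD('n) q'" "\<forall>v. ev q' v = q (block 0 v)" by blast
  then show ?case using subring_setD(4)[OF subring_set_vars_below, of p' "CARD('n)" q']
    by (intro exI[of _ "p' * q'"]) simp
qed

definition shift :: "nat \<Rightarrow> mpol \<Rightarrow> mpol" where
  "shift k = subst (\<lambda>j. Var (k + j))"

lemma ev_shift: "ev (shift k p) v = ev p (\<lambda>j. v (k + j))"
  by (simp add: shift_def)

lemma block_shift: "block 0 (\<lambda>j. v (k * CARD('n) + j)) = (block k v :: complex ^ 'n :: finite)"
  by (simp add: block_def)

lemma algebraic_set_equations:
  fixes X :: "(complex ^ 'n :: finite) set"
  assumes "algebraic_set X"
  shows "\<exists>E. finite E \<and> (\<forall>v. block 0 v \<in> X \<longleftrightarrow> (\<forall>p\<in>E. ev p v = 0))"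
proof -
  obtain P where P: "\<And>p. p \<in> P \<Longrightarrow> poly_fun p" "X = {x. \<forall>p\<in>P. p x = 0}"
    using assms unfolding algebraic_set_def by blast
  have "\<forall>p\<in>P. \<exists>q. vars_below CARD('n) q \<and> (\<forall>v. ev q v = p (block 0 v))" using mpol_of_poly_fun P(1) by blast
  then obtain Q where Q: "\<And>p. p \<in> P \<Longrightarrow> vars_below CARD('n) (Q p)" "\<And>p v. p \<in> P \<Longrightarrow> ev (Q p) v = p (block 0 v)"
    by metis
  obtain E where E: "finite E" "E \<subseteq> Q ` P" "{v. \<forall>p\<in>Q ` P. ev p v = 0} = {v. \<forall>p\<in>E. ev p v = 0}"
    using finite_equations[of "Q ` P" "CARD('n)"] Q(1) by blast
  have "block 0 v \<in> X \<longleftrightarrow> (\<forall>p\<in>E. ev p v = 0)" for v :: "nat \<Rightarrow> complex"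
  proof -
    have "block 0 v \<in> X \<longleftrightarrow> v \<in> {v. \<forall>p\<in>Q ` P. ev p v = 0}" by (auto simp: P(2) Q(2))
    then show ?thesis unfolding E(3) by simp
  qed
  then show ?thesis using E(1) by blast
qed

lemma poly_map_components:
  fixes F :: "complex ^ 'n :: finite \<Rightarrow> complex ^ 'n"
  assumes "poly_map F"
  shows "\<exists>Fm. \<forall>i v. ev (Fm i) v = unblock (F (block 0 v)) i"
proof -
  have "\<exists>q. \<forall>v. ev q v = unblock (F (block 0 v)) j" for j
  proof (cases "j < CARD('n)")
    case True
    then obtain i :: 'n where i: "j = coord_index i" using coord_index_inv by metis
    have "poly_fun (\<lambda>x. F x $ i)" using assms by (simp add: poly_map_def)
    then obtain q where "\<forall>v. ev q v = F (block 0 v) $ i" using mpol_of_poly_fun by blast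
    then show ?thesis by (auto simp: i)
  next
    case False
    then show ?thesis by (intro exI[of _ 0]) simp
  qed
  then have "\<forall>j. \<exists>q. \<forall>v. ev q v = unblock (F (block 0 v)) j" by blast
  from choice[OF this] show ?thesis .
qed

lemma block_eq_iff:
  "(x :: complex ^ 'n :: finite) = block k v \<longleftrightarrow> (\<forall>i<CARD('n). unblock x i = v (k * CARD('n) + i))"
proof
  assume "x = block k v"
  then show "\<forall>i<CARD('n). unblock x i = v (k * CARD('n) + i)"
    using coord_index_inv[where 'n = 'n] by (auto simp: block_def) (metis unblock_coord_index vec_lambda_beta)
next
  assume "\<forall>i<CARD('n). unblock x i = v (k * CARD('n) + i)"
  then show "x = block k v" by (intro block_eqI[symmetric]) simp
qed

lemma constructible_block_in:
  fixes X :: "(complex ^ 'n :: finite) set"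
  assumes "algebraic_set X"
  shows "constructible {v. block k v \<in> X}"
proof -
  obtain E where E: "finite E" "\<forall>v. block 0 v \<in> X \<longleftrightarrow> (\<forall>p\<in>E. ev p v = 0)"
    using algebraic_set_equations[OF assms] by (elim exE conjE) (rule that)
  have "block k v \<in> X \<longleftrightarrow> (\<forall>p\<in>E. ev (shift (k * CARD('n)) p) v = 0)" for v :: "nat \<Rightarrow> complex"
    using E(2)[rule_format, of "\<lambda>j. v (k * CARD('n) + j)"] by (simp add: ev_shift block_shift)
  then have "{v. block k v \<in> X} = (\<Inter>p\<in>E. {v. ev (shift (k * CARD('n)) p) v = 0})" by auto
  then show ?thesis using E(1) by (simp only:) (intro constructible_INT constructible_zero)
qed

lemma constructible_block_map:
  fixes F :: "complex ^ 'n :: finite \<Rightarrow> complex ^ 'n"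
  assumes "poly_map F"
  shows "constructible {v. F (block k v) = block 0 v}"
proof -
  obtain Fm where Fm: "\<And>i v. ev (Fm i) v = unblock (F (block 0 v)) i"
    using poly_map_components[OF assms] by blast
  have "{v. F (block k v) = block 0 v} = (\<Inter>i\<in>{..<CARD('n)}. {v. ev (shift (k * CARD('n)) (Fm i) - Var i) v = 0})"
    by (auto simp: ev_shift Fm block_shift block_eq_iff)
  then show ?thesis by (simp only:) (intro constructible_INT constructible_zero finite_lessThan)
qed

lemma constructible_block_eq:
  "constructible {v. (block j v :: complex ^ 'n :: finite) = block k v}"
proof -
  have "(block j v :: complex ^ 'n) = block k v \<longleftrightarrow> (\<forall>i<CARD('n). ev (Var (j * CARD('n) + i) - Var (k * CARD('n) + i)) v = 0)" for v
    using coord_index_inv[where 'n = 'n] coord_index_less[where 'n = 'n]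
    by (auto simp: block_def vec_eq_iff)
  then have "{v. (block j v :: complex ^ 'n) = block k v} =
      (\<Inter>i\<in>{..<CARD('n)}. {v. ev (Var (j * CARD('n) + i) - Var (k * CARD('n) + i)) v = 0})" by auto
  then show ?thesis by (simp only:) (intro constructible_INT constructible_zero finite_lessThan)
qed

text \<open>The two preimages are stored in blocks 1 and 2, and the coordinates of these blocks are
  projected away.\<close>

lemma constructible_double_image:
  fixes X :: "(complex ^ 'n :: finite) set"
  assumes "algebraic_set X" "poly_map F"
  shows "constructible {v. \<exists>x\<in>X. \<exists>x'\<in>X. x \<noteq> x' \<and> F x = block 0 v \<and> F x' = block 0 v}" (is "constructible ?C")
proof -
  let ?N = "CARD('n)"
  define W where "W = {v. block 1 v \<in> X} \<inter> {v. block 2 v \<in> X} \<inter> {v. F (block 1 v) = block 0 v} \<inter>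
    {v. F (block 2 v) = block 0 v} \<inter> - {v. (block 1 v :: complex ^ 'n) = block 2 v}"
  have "constructible W" unfolding W_def
    by (intro constructible_Int constructible_Compl constructible_block_in constructible_block_map constructible_block_eq assms)
  then have "constructible {v. \<exists>w\<in>W. \<forall>j. j \<notin> {?N..<3 * ?N} \<longrightarrow> v j = w j}"
    by (rule constructible_project_set[OF finite_atLeastLessThan])
  also have "{v. \<exists>w\<in>W. \<forall>j. j \<notin> {?N..<3 * ?N} \<longrightarrow> v j = w j} = ?C"
  proof (intro equalityI subsetI)
    fix v assume "v \<in> {v. \<exists>w\<in>W. \<forall>j. j \<notin> {?N..<3 * ?N} \<longrightarrow> v j = w j}"
    then obtain w where w: "w \<in> W" "\<And>j. j \<notin> {?N..<3 * ?N} \<Longrightarrow> v j = w j" by blast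
    have "v (coord_index i) = w (coord_index i)" for i :: 'n
      by (rule w(2)) (use coord_index_less[of i] in auto)
    then have "block 0 w = (block 0 v :: complex ^ 'n)" by (simp add: block_def vec_eq_iff)
    then show "v \<in> ?C" using w(1) unfolding W_def mem_Collect_eq
      by (intro bexI[of _ "block 1 w"] bexI[of _ "block 2 w"]) auto
  next
    fix v assume "v \<in> ?C"
    then obtain x x' where x: "x \<in> X" "x' \<in> X" "x \<noteq> x'" "F x = block 0 v" "F x' = block 0 v" by blast
    define w where "w = (\<lambda>j. if j < ?N then v j else if j < 2 * ?N then unblock x (j - ?N)
      else if j < 3 * ?N then unblock x' (j - 2 * ?N) else v j)"
    have "block 0 w = (block 0 v :: complex ^ 'n)"
      using coord_index_less[where 'n = 'n] by (simp add: block_def vec_eq_iff w_def)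
    moreover have "block 1 w = x" by (rule block_eqI) (simp add: w_def)
    moreover have "block 2 w = x'" by (rule block_eqI) (simp add: w_def)
    ultimately have "w \<in> W" using x by (simp add: W_def)
    then show "v \<in> {v. \<exists>w\<in>W. \<forall>j. j \<notin> {?N..<3 * ?N} \<longrightarrow> v j = w j}"
      by (intro CollectI bexI[of _ w]) (auto simp: w_def)
  qed
  finally show ?thesis .
qed

text \<open>Openness makes the locus of points with two preimages open, so its complement, being
  constructible and closed, is closed in the Zariski topology.\<close>

lemma separate_double_point:
  fixes X Y :: "(complex ^ 'n :: finite) set"
  assumes X: "algebraic_set X" and F: "poly_map F"
    and op: "\<And>U. openin (top_of_set X) U \<Longrightarrow> openin (top_of_set X) (F ` U)"
    and Y: "Y \<subseteq> X" "\<And>x x'. x \<in> X \<Longrightarrow> x' \<in> X \<Longrightarrow> F x \<in> Y \<Longrightarrow> F x = F x' \<Longrightarrow> x = x'"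
    and x: "x \<in> X" "x' \<in> X" "x \<noteq> x'" "F x = F x'"
  obtains q where "\<And>y. y \<in> Y \<Longrightarrow> ev q (unblock y) = 0" "ev q (unblock (F x)) \<noteq> 0"
proof -
  let ?C = "{v. \<exists>x\<in>X. \<exists>x'\<in>X. x \<noteq> x' \<and> F x = block 0 v \<and> F x' = block 0 v}"
  define A where "A = {v. block 0 v \<in> X} \<inter> - ?C"
  have "constructible A" unfolding A_def
    by (intro constructible_Int constructible_Compl constructible_block_in constructible_double_image X F)
  moreover have "cylinder CARD('n) A" unfolding cylinder_def
  proof (intro allI impI)
    fix v w :: "nat \<Rightarrow> complex" assume "\<forall>i<CARD('n). v i = w i"
    then have "(block 0 v :: complex ^ 'n) = block 0 w" using coord_index_less[where 'n = 'n]
      by (simp add: block_def)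
    then show "v \<in> A \<Longrightarrow> w \<in> A" by (simp add: A_def)
  qed
  moreover have "unblock (F x) \<notin> closure A"
  proof -
    obtain U U' where U: "open U" "open U'" "x \<in> U" "x' \<in> U'" "U \<inter> U' = {}" using hausdorff[OF x(3)] by blast
    have "openin (top_of_set X) (F ` (X \<inter> U))" "openin (top_of_set X) (F ` (X \<inter> U'))"
      using U(1,2) by (auto intro!: op openin_open_Int)
    then obtain V V' where V: "open V" "F ` (X \<inter> U) = X \<inter> V" "open V'" "F ` (X \<inter> U') = X \<inter> V'"
      unfolding openin_open by metis
    \<comment> \<open>Every point of \<open>X\<close> in \<open>V \<inter> V'\<close> has one
      preimage in \<open>U\<close> and another in \<open>U'\<close>, and these differ.\<close>
    define S where "S = block 0 -` (V \<inter> V')"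
    have "open S" unfolding S_def by (intro open_vimage continuous_on_block open_Int V)
    moreover have "F x \<in> X \<inter> V" "F x' \<in> X \<inter> V'" using V(2,4) x U(3,4) by blast+
    then have "unblock (F x) \<in> S" using x(4) by (simp add: S_def)
    moreover have "A \<inter> S = {}"
    proof (rule ccontr)
      assume "A \<inter> S \<noteq> {}"
      then obtain v where v: "v \<in> A" "v \<in> S" by blast
      then have "block 0 v \<in> X \<inter> V" "block 0 v \<in> X \<inter> V'" by (auto simp: A_def S_def)
      then obtain a a' where a: "a \<in> X \<inter> U" "F a = block 0 v" "a' \<in> X \<inter> U'" "F a' = block 0 v"
        unfolding V(2,4)[symmetric] by auto
      then have "a \<noteq> a'" using U(5) by blast
      then show False using a v(1) by (auto simp: A_def)
    qed
    ultimately show ?thesis using open_Int_closure_eq_empty[of S A] by blast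
  qed
  ultimately obtain h where h: "\<And>a. a \<in> A \<Longrightarrow> ev h a = 0" "ev h (unblock (F x)) \<noteq> 0"
    using constructible_separation[of A "CARD('n)" "unblock (F x)"] by force
  have "unblock y \<in> A" if "y \<in> Y" for y
    using that Y by (auto simp: A_def)
  then show ?thesis using h that by blast
qed

text \<open>Polynomial functions come without a list of coefficients, so having them in the ring
  generated by \<open>S\<close> is expressed by two consequences: values stay in \<open>R\<close>,
  and congruences modulo ideals are preserved.\<close>

definition coeffs_in :: "complex set \<Rightarrow> mpol \<Rightarrow> bool" where
  "coeffs_in S p \<longleftrightarrow>
    (\<forall>R v. subring_set R \<longrightarrow> S \<subseteq> R \<longrightarrow> (\<forall>i. v i \<in> R) \<longrightarrow> ev p v \<in> R) \<and>
    (\<forall>R M v w. subring_set R \<longrightarrow> S \<subseteq> R \<longrightarrow> ideal_in R M \<longrightarrow> (\<forall>i. v i \<in> R) \<longrightarrow> (\<forall>i. w i \<in> R) \<longrightarrow>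
      (\<forall>i. v i - w i \<in> M) \<longrightarrow> ev p v - ev p w \<in> M)"

lemma coeffs_inI:
  assumes "\<And>R v. subring_set R \<Longrightarrow> S \<subseteq> R \<Longrightarrow> (\<And>i. v i \<in> R) \<Longrightarrow> ev p v \<in> R"
    and "\<And>R M v w. subring_set R \<Longrightarrow> S \<subseteq> R \<Longrightarrow> ideal_in R M \<Longrightarrow> (\<And>i. v i \<in> R) \<Longrightarrow> (\<And>i. w i \<in> R) \<Longrightarrow>
      (\<And>i. v i - w i \<in> M) \<Longrightarrow> ev p v - ev p w \<in> M"
  shows "coeffs_in S p"
  unfolding coeffs_in_def using assms by simp

lemma coeffs_in_ev: "coeffs_in S p \<Longrightarrow> subring_set R \<Longrightarrow> S \<subseteq> R \<Longrightarrow> (\<And>i. v i \<in> R) \<Longrightarrow> ev p v \<in> R"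
  unfolding coeffs_in_def by simp

lemma coeffs_in_cong:
  "coeffs_in S p \<Longrightarrow> subring_set R \<Longrightarrow> S \<subseteq> R \<Longrightarrow> ideal_in R M \<Longrightarrow> (\<And>i. v i \<in> R) \<Longrightarrow> (\<And>i. w i \<in> R) \<Longrightarrow>
    (\<And>i. v i - w i \<in> M) \<Longrightarrow> ev p v - ev p w \<in> M"
  unfolding coeffs_in_def by simp

lemma coeffs_in_add:
  assumes "coeffs_in S p" "coeffs_in T q"
  shows "coeffs_in (S \<union> T) (p + q)"
proof (rule coeffs_inI)
  fix R and v :: "nat \<Rightarrow> complex" assume R: "subring_set R" "S \<union> T \<subseteq> R" "\<And>i. v i \<in> R"
  have "ev p v \<in> R" "ev q v \<in> R"
    by (rule coeffs_in_ev[OF assms(1) R(1)] coeffs_in_ev[OF assms(2) R(1)]; use R in simp)+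
  then show "ev (p + q) v \<in> R" using subring_setD(6)[OF R(1)] by simp
next
  fix R M and v w :: "nat \<Rightarrow> complex" assume R: "subring_set R" "S \<union> T \<subseteq> R" "ideal_in R M" "\<And>i. v i \<in> R" "\<And>i. w i \<in> R" "\<And>i. v i - w i \<in> M"
  have "ev p v - ev p w \<in> M" "ev q v - ev q w \<in> M"
    by (rule coeffs_in_cong[OF assms(1) R(1)] coeffs_in_cong[OF assms(2) R(1)]; use R in simp)+
  from ideal_inD(3)[OF R(3) this] show "ev (p + q) v - ev (p + q) w \<in> M" by (simp add: algebra_simps)
qed

lemma coeffs_in_mult:
  assumes "coeffs_in S p" "coeffs_in T q"
  shows "coeffs_in (S \<union> T) (p * q)"
proof (rule coeffs_inI)
  fix R and v :: "nat \<Rightarrow> complex" assume R: "subring_set R" "S \<union> T \<subseteq> R" "\<And>i. v i \<in> R"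
  have "ev p v \<in> R" "ev q v \<in> R"
    by (rule coeffs_in_ev[OF assms(1) R(1)] coeffs_in_ev[OF assms(2) R(1)]; use R in simp)+
  then show "ev (p * q) v \<in> R" using subring_setD(4)[OF R(1)] by simp
next
  fix R M and v w :: "nat \<Rightarrow> complex" assume R: "subring_set R" "S \<union> T \<subseteq> R" "ideal_in R M" "\<And>i. v i \<in> R" "\<And>i. w i \<in> R" "\<And>i. v i - w i \<in> M"
  have 1: "ev p v - ev p w \<in> M" "ev q v - ev q w \<in> M"
    by (rule coeffs_in_cong[OF assms(1) R(1)] coeffs_in_cong[OF assms(2) R(1)]; use R in simp)+
  have 2: "ev p w \<in> R" "ev q v \<in> R"
    by (rule coeffs_in_ev[OF assms(1) R(1)] coeffs_in_ev[OF assms(2) R(1)]; use R in simp)+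
  from ideal_inD(3)[OF R(3) ideal_inD(4)[OF R(3) 2(2) 1(1)] ideal_inD(4)[OF R(3) 2(1) 1(2)]]
  show "ev (p * q) v - ev (p * q) w \<in> M" by (simp add: algebra_simps)
qed

lemma ex_coeffs_in: "\<exists>S. finite S \<and> coeffs_in S p"
proof (induction p rule: mpol_induct)
  case (Cst c)
  have "coeffs_in {c} (Cst c)" by (rule coeffs_inI) (auto simp: ideal_in_def)
  then show ?case by blast
next
  case (Var i)
  have "coeffs_in {} (Var i)" by (rule coeffs_inI) auto
  then show ?case by blast
next
  case (add p q) then show ?case using coeffs_in_add finite_Un by metis
next
  case (mult p q) then show ?case using coeffs_in_mult finite_Un by metis
qed

text \<open>Membership of \<open>h\<close> is a finite combination, and \<open>S\<close> collects
  the coefficients of the multipliers. The generators may be infinitely many and have coefficients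
  outside \<open>R\<close>; only their values at \<open>v\<close> matter.\<close>

lemma certificate_over_subring:
  assumes "h \<in> gen_ideal E"
  shows "\<exists>S. finite S \<and> (\<forall>R M v. subring_set R \<longrightarrow> S \<subseteq> R \<longrightarrow> ideal_in R M \<longrightarrow> (\<forall>i. v i \<in> R) \<longrightarrow>
     (\<forall>e\<in>E. ev e v \<in> M) \<longrightarrow> ev h v \<in> M)"
  using assms
proof induction
  case zero
  show ?case by (rule exI[of _ "{}"]) (auto simp: ideal_in_def)
next
  case (step x e c)
  let ?Q = "\<lambda>S x. \<forall>R M v. subring_set R \<longrightarrow> S \<subseteq> R \<longrightarrow> ideal_in R M \<longrightarrow> (\<forall>i. v i \<in> R) \<longrightarrow>
     (\<forall>e\<in>E. ev e v \<in> M) \<longrightarrow> ev x v \<in> M"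
  from step.IH obtain S where S: "finite S" "?Q S x" by (elim exE conjE) (rule that)
  obtain T where T: "finite T" "coeffs_in T c" using ex_coeffs_in by blast
  have "?Q (S \<union> T) (x + c * e)"
  proof (intro allI impI)
    fix R M and v :: "nat \<Rightarrow> complex"
    assume R: "subring_set R" "S \<union> T \<subseteq> R" "ideal_in R M" "\<forall>i. v i \<in> R" "\<forall>e\<in>E. ev e v \<in> M"
    have "ev x v \<in> M" using S(2) R by simp
    moreover have "ev c v \<in> R" by (rule coeffs_in_ev[OF T(2) R(1)]) (use R in auto)
    moreover have "ev e v \<in> M" using R(5) step.hyps by blast
    ultimately show "ev (x + c * e) v \<in> M" using ideal_inD(3,4)[OF R(3)] by simp
  qed
  then show ?case using S(1) T(1) by (intro exI[of _ "S \<union> T"] conjI) auto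
qed

lemma poly_map_iterate_components:
  fixes F :: "complex ^ 'n :: finite \<Rightarrow> complex ^ 'n"
  assumes "poly_map F"
  shows "\<exists>G. \<forall>i v. ev (G i) v = unblock ((F ^^ m) (block 0 v)) i"
proof (induction m)
  case 0
  have "ev (if i < CARD('n) then Var i else 0) v = unblock (block 0 v :: complex ^ 'n) i" for i v
    using block_eq_iff[of "block 0 v :: complex ^ 'n" 0 v] by simp
  then show ?case by (intro exI[of _ "\<lambda>i. if i < CARD('n) then Var i else 0"]) simp
next
  case (Suc m)
  then obtain G where G: "\<And>i v. ev (G i) v = unblock ((F ^^ m) (block 0 v)) i" by blast
  obtain Fm where Fm: "\<And>i v. ev (Fm i) v = unblock (F (block 0 v)) i"
    using poly_map_components[OF assms] by blast
  show ?case by (intro exI[of _ "\<lambda>i. subst G (Fm i)"]) (simp add: Fm G)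
qed

lemma unstable_orbit_impossible:
  fixes X :: "(complex ^ 'n :: finite) set" and y :: "nat \<Rightarrow> complex ^ 'n"
  assumes X: "algebraic_set X" and F: "poly_map F"
    and op: "\<And>U. openin (top_of_set X) U \<Longrightarrow> openin (top_of_set X) (F ` U)"
    and y: "\<And>n. y n \<in> X" "\<And>n. y (Suc n) = F (y n)"
      "\<And>n x. x \<in> X \<Longrightarrow> F x = y (Suc n) \<Longrightarrow> x = y n" "y 0 \<notin> (F ^^ m) ` X"
  shows False
proof -
  let ?N = "CARD('n)"
  define a where "a n = unblock (y n)" for n
  have block_a: "block 0 (a n) = y n" for n by (simp add: a_def)
  obtain Fm where Fm: "\<And>i v. ev (Fm i) v = unblock (F (block 0 v)) i"
    using poly_map_components[OF F] by blast
  obtain G where G: "\<And>i v. ev (G i) v = unblock ((F ^^ m) (block 0 v)) i"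
    using poly_map_iterate_components[OF F] by blast
  obtain E where E: "\<forall>v. block 0 v \<in> X \<longleftrightarrow> (\<forall>p\<in>E. ev p v = 0)"
    using algebraic_set_equations[OF X] by (elim exE conjE) (rule that)
  have EX: "ev p v = 0" if "p \<in> E" "block 0 v \<in> X" for p v using E that by blast
  have Fma: "ev (Fm i) (a n) = a (Suc n) i" for i n by (simp add: Fm a_def y(2))

  \<comment> \<open>The common zero set of these polynomials is the Zariski closure of the points
    \<open>y (Suc n)\<close>.\<close>
  define Q where "Q = {q. \<forall>n. ev q (a (Suc n)) = 0}"
  \<comment> \<open>The auxiliary variables of block 2 can solve \<open>inv_eq = 0\<close> exactly
    when the points in blocks 0 and 1 differ.\<close>
  define inv_eq where "inv_eq = (\<Sum>i<?N. Var (2 * ?N + i) * (Var i - Var (?N + i))) - 1"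
  \<comment> \<open>A solution is a pair of distinct points of \<open>X\<close> with a common image
    in that closure; \<open>separate_double_point\<close> excludes it.\<close>
  define E1 where "E1 = E \<union> shift ?N ` E \<union> (\<lambda>i. Fm i - shift ?N (Fm i)) ` {..<?N} \<union> subst Fm ` Q \<union> {inv_eq}"
  have "1 \<in> gen_ideal E1"
  proof (rule ccontr)
    assume "1 \<notin> gen_ideal E1"
    then obtain v where v: "\<And>p. p \<in> E1 \<Longrightarrow> ev p v = 0" using nullstellensatz by blast
    define x x' :: "complex ^ 'n" where "x = block 0 v" and "x' = block 1 v"
    have x'_eq: "block 0 (\<lambda>j. v (?N + j)) = x'" using block_shift[of v 1] by (simp add: x'_def)
    have "\<forall>p\<in>E. ev p v = 0" using v by (simp add: E1_def)
    then have "x \<in> X" using E by (simp add: x_def)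
    have "\<forall>p\<in>E. ev p (\<lambda>j. v (?N + j)) = 0" using v by (simp add: E1_def ev_shift[symmetric])
    then have "x' \<in> X" using E x'_eq by metis
    have "unblock (F x) i = unblock (F x') i" if "i < ?N" for i
    proof -
      have "Fm i - shift ?N (Fm i) \<in> E1" using that unfolding E1_def by blast
      from v[OF this] show ?thesis by (simp add: ev_shift Fm x'_eq x_def)
    qed
    then have "F x = F x'" using coord_index_less[where 'n = 'n] by (metis unblock_coord_index vec_eq_iff)
    have "x = x'"
    proof (rule ccontr)
      assume "x \<noteq> x'"
      let ?Y = "range (\<lambda>n. y (Suc n))"
      have Y: "?Y \<subseteq> X" using y(1) by blast
      have Y': "u = u'" if "u \<in> X" "u' \<in> X" "F u \<in> ?Y" "F u = F u'" for u u' using that y(3) by (metis imageE)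
      obtain q where q: "\<And>w. w \<in> ?Y \<Longrightarrow> ev q (unblock w) = 0" "ev q (unblock (F x)) \<noteq> 0"
        using separate_double_point[OF X F op Y Y' \<open>x \<in> X\<close> \<open>x' \<in> X\<close> \<open>x \<noteq> x'\<close> \<open>F x = F x'\<close>] by blast
      have "q \<in> Q" using q(1) by (simp add: Q_def a_def)
      then have "subst Fm q \<in> E1" unfolding E1_def by blast
      then have "ev (subst Fm q) v = 0" by (rule v)
      then show False using q(2) by (simp add: Fm x_def)
    qed
    then have "v i = v (?N + i)" if "i < ?N" for i
      using that block_eq_iff[of x 0 v] block_eq_iff[of x' 1 v] by (simp add: x_def x'_def)
    then have "ev inv_eq v = - 1" by (simp add: inv_eq_def)
    then show False using v[of inv_eq] by (simp add: E1_def)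
  qed
  from certificate_over_subring[OF this] obtain S1 where S1: "finite S1"
    "\<forall>R M v. subring_set R \<longrightarrow> S1 \<subseteq> R \<longrightarrow> ideal_in R M \<longrightarrow> (\<forall>i. v i \<in> R) \<longrightarrow> (\<forall>e\<in>E1. ev e v \<in> M) \<longrightarrow> ev 1 v \<in> M"
    by (elim exE conjE) (rule that)

  \<comment> \<open>A solution would be a point of \<open>X\<close> that \<open>F ^^ m\<close> sends
    to \<open>y 0\<close>.\<close>
  define E2 where "E2 = E \<union> (\<lambda>i. G i - Cst (a 0 i)) ` {..<?N}"
  have "1 \<in> gen_ideal E2"
  proof (rule ccontr)
    assume "1 \<notin> gen_ideal E2"
    then obtain v where v: "\<And>p. p \<in> E2 \<Longrightarrow> ev p v = 0" using nullstellensatz by blast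
    have "\<forall>p\<in>E. ev p v = 0" using v by (simp add: E2_def)
    then have "block 0 v \<in> X" using E by simp
    moreover have "y 0 = (F ^^ m) (block 0 v)"
    proof -
      have "unblock ((F ^^ m) (block 0 v)) i = unblock (y 0) i" if "i < ?N" for i
      proof -
        have "G i - Cst (a 0 i) \<in> E2" using that unfolding E2_def by blast
        from v[OF this] show ?thesis by (simp add: G a_def)
      qed
      then show ?thesis using coord_index_less[where 'n = 'n] by (metis unblock_coord_index vec_eq_iff)
    qed
    ultimately show False using y(4) by blast
  qed
  from certificate_over_subring[OF this] obtain S2 where S2: "finite S2"
    "\<forall>R M v. subring_set R \<longrightarrow> S2 \<subseteq> R \<longrightarrow> ideal_in R M \<longrightarrow> (\<forall>i. v i \<in> R) \<longrightarrow> (\<forall>e\<in>E2. ev e v \<in> M) \<longrightarrow> ev 1 v \<in> M"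
    by (elim exE conjE) (rule that)

  have "\<forall>i. \<exists>S. finite S \<and> coeffs_in S (Fm i)" using ex_coeffs_in by blast
  from choice[OF this] obtain S3 where S3: "\<And>i. finite (S3 i)" "\<And>i. coeffs_in (S3 i) (Fm i)" by blast
  \<comment> \<open>\<open>R\<close> contains what both certificates require, the coefficients of
    \<open>F\<close> and the coordinates of \<open>y 0\<close>; the rest of the orbit then lies over
    \<open>R\<close> as well.\<close>
  obtain R M where R: "subring_set R" "S1 \<union> S2 \<union> (\<Union>i<?N. S3 i) \<union> a 0 ` {..<?N} \<subseteq> R" and M: "finite_residue_prime R M"
    by (rule finite_residue_prime_exists[of "S1 \<union> S2 \<union> (\<Union>i<?N. S3 i) \<union> a 0 ` {..<?N}"])
      (use S1(1) S2(1) S3(1) in auto)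
  note id = finite_residue_primeD(1)[OF M]
  note M0 = ideal_inD(2)[OF id]
  have far: "a n i = 0" if "\<not> i < ?N" for n i using that by (simp add: a_def)
  have aR: "a n i \<in> R" for n i
  proof (induction n arbitrary: i)
    case 0
    show ?case using R(2) far[of i 0] subring_setD(2)[OF R(1)] by (cases "i < ?N") auto
  next
    case (Suc n)
    show ?case
    proof (cases "i < ?N")
      case True
      then have "ev (Fm i) (a n) \<in> R" using R Suc by (intro coeffs_in_ev[OF S3(2) R(1)]) auto
      then show ?thesis by (simp add: Fma)
    next
      case False then show ?thesis using far subring_setD(2)[OF R(1)] by simp
    qed
  qed
  define cong where "cong i j \<longleftrightarrow> (\<forall>c. a i c - a j c \<in> M)" for i j

  \<comment> \<open>Preimages along the orbit stay unique modulo \<open>M\<close>: if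
    \<open>y i\<close> and \<open>y j\<close> were incongruent with congruent images, some
    coordinate difference would be invertible modulo \<open>M\<close> and they would solve
    \<open>E1\<close> modulo \<open>M\<close>.\<close>
  have cong_pred: "cong i j" if "cong (Suc i) (Suc j)" for i j
  proof (rule ccontr)
    assume "\<not> cong i j"
    then obtain c where c: "a i c - a j c \<notin> M" by (auto simp: cong_def)
    then have cN: "c < ?N" using far M0 by force
    have "a i c - a j c \<in> R" using aR subring_setD(3)[OF R(1)] by blast
    then obtain b where b: "b \<in> R" "b * (a i c - a j c) - 1 \<in> M"
      using finite_residue_inverse[OF R(1) M _ c] by blast
    \<comment> \<open>As \<open>y i\<close> and \<open>y j\<close> are genuine points, the equations
      from \<open>X\<close> and from \<open>Q\<close> hold exactly; equality of the images and
      \<open>inv_eq\<close> hold modulo \<open>M\<close>.\<close>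
    define v where "v t = (if t < ?N then a i t else if t < 2 * ?N then a j (t - ?N)
      else if t = 2 * ?N + c then b else 0)" for t
    have b0: "block 0 v = y i" by (rule block_eqI) (simp add: v_def a_def)
    have b1: "block 0 (\<lambda>t. v (?N + t)) = y j" by (rule block_eqI) (simp add: v_def a_def)
    have "ev e v \<in> M" if e: "e \<in> E1" for e
    proof -
      consider "e \<in> E" | p where "p \<in> E" "e = shift ?N p" | k where "k < ?N" "e = Fm k - shift ?N (Fm k)"
        | q where "q \<in> Q" "e = subst Fm q" | "e = inv_eq"
        using e unfolding E1_def by blast
      then show ?thesis
      proof cases
        case 1
        then show ?thesis using EX[of e v] b0 y(1) M0 by simp
      next
        case 2
        then show ?thesis using EX[of p "\<lambda>t. v (?N + t)"] b1 y(1) M0 by (simp add: ev_shift)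
      next
        case 3
        have "ev e v = a (Suc i) k - a (Suc j) k"
          unfolding 3 by (simp add: ev_shift Fm b0 b1 a_def y(2))
        then show ?thesis using \<open>cong (Suc i) (Suc j)\<close> by (simp add: cong_def)
      next
        case 4
        have "ev e v = ev q (a (Suc i))" unfolding 4 by (simp add: Fm b0 a_def y(2))
        then show ?thesis using 4(1) M0 by (simp add: Q_def)
      next
        case 5
        have "(\<Sum>t<?N. v (2 * ?N + t) * (v t - v (?N + t))) = (\<Sum>t<?N. if t = c then b * (a i c - a j c) else 0)"
          by (intro sum.cong) (auto simp: v_def)
        then have "ev e v = b * (a i c - a j c) - 1" using cN by (simp add: 5 inv_eq_def)
        then show ?thesis using b(2) by simp
      qed
    qed
    moreover have "v t \<in> R" for t using aR b(1) subring_setD(2)[OF R(1)] by (simp add: v_def)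
    ultimately have "ev 1 v \<in> M"
      using R(2) by (intro S1(2)[rule_format, of R M v, OF R(1) _ id]) auto
    then show False using finite_residue_primeD(2)[OF M] by simp
  qed
  have cong_succ: "cong (Suc i) (Suc j)" if "cong i j" for i j
    unfolding cong_def
  proof
    fix c
    show "a (Suc i) c - a (Suc j) c \<in> M"
    proof (cases "c < ?N")
      case True
      have "ev (Fm c) (a i) - ev (Fm c) (a j) \<in> M"
        by (rule coeffs_in_cong[OF S3(2) R(1) _ id]) (use R True aR that in \<open>auto simp: cong_def\<close>)
      then show ?thesis by (simp add: Fma)
    qed (simp add: far M0)
  qed
  have trans: "cong i k" if "cong i j" "cong j k" for i j k
    unfolding cong_def
  proof
    fix c
    have "(a i c - a j c) + (a j c - a k c) \<in> M"
      by (rule ideal_inD(3)[OF id]) (use that in \<open>simp_all add: cong_def\<close>)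
    then show "a i c - a k c \<in> M" by simp
  qed

  \<comment> \<open>Only finitely many residue patterns exist for the first \<open>?N\<close>
    coordinates, so two points of the orbit are congruent.\<close>
  obtain i l where il: "cong i (i + l)" "l > 0"
  proof -
    obtain T where T: "finite T" "T \<subseteq> R" "\<And>x. x \<in> R \<Longrightarrow> \<exists>t\<in>T. x - t \<in> M"
      using finite_residue_primeD(4)[OF M] unfolding finite_index_def by blast
    have "\<forall>n c. \<exists>t\<in>T. a n c - t \<in> M" using T(3) aR by blast
    then obtain t where t: "\<And>n c. t n c \<in> T" "\<And>n c. a n c - t n c \<in> M" by metis
    define \<phi> where "\<phi> n = restrict (t n) {..<?N}" for n
    have "\<phi> n \<in> PiE {..<?N} (\<lambda>_. T)" for n by (simp add: \<phi>_def restrict_PiE_iff t(1))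
    then have "range \<phi> \<subseteq> PiE {..<?N} (\<lambda>_. T)" by blast
    then have "finite (range \<phi>)" by (rule finite_subset) (intro finite_PiE finite_lessThan T(1))
    then have "\<not> inj \<phi>" using finite_imageD[of \<phi> UNIV] by auto
    then obtain i j where ij: "i < j" "\<phi> i = \<phi> j" unfolding inj_def by (metis linorder_neqE_nat)
    have "cong i j" unfolding cong_def
    proof
      fix c
      show "a i c - a j c \<in> M"
      proof (cases "c < ?N")
        case True
        then have "t i c = t j c" using fun_cong[OF ij(2), of c] by (simp add: \<phi>_def)
        then have "a i c - a j c = (a i c - t i c) - (a j c - t j c)" by simp
        then show ?thesis using ideal_in_diff[OF R(1) id t(2) t(2)] by metis
      qed (simp add: far M0)
    qed
    then show ?thesis using that[of i "j - i"] ij(1) by simp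
  qed
  have "cong 0 l" using il(1) by (induction i) (auto dest: cong_pred)
  then have step: "cong n (n + l)" for n by (induction n) (auto dest: cong_succ)
  have mult: "cong 0 (k * l)" for k
  proof (induction k)
    case 0 then show ?case by (simp add: cong_def M0)
  next
    case (Suc k) then show ?case using trans step[of "k * l"] by (metis add.commute mult_Suc)
  qed
  have y_iter: "(F ^^ k) (y n) = y (n + k)" for k n by (induction k) (auto simp: y(2))
  have "m \<le> m * l" using il(2) by simp
  \<comment> \<open>The multiple \<open>m * l\<close> of the period is at least \<open>m\<close>;
    going back \<open>m\<close> steps from it gives a point that \<open>F ^^ m\<close> sends to one
    congruent to \<open>y 0\<close>.\<close>
  define x where "x = a (m * l - m)"
  have Fx: "(F ^^ m) (block 0 x) = y (m * l)" using \<open>m \<le> m * l\<close> by (simp add: x_def block_a y_iter)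
  have "ev e x \<in> M" if e: "e \<in> E2" for e
  proof -
    consider "e \<in> E" | k where "k < ?N" "e = G k - Cst (a 0 k)" using e unfolding E2_def by blast
    then show ?thesis
    proof cases
      case 1
      then show ?thesis using EX[of e x] y(1) M0 by (simp add: x_def block_a)
    next
      case 2
      have "0 - (a 0 k - a (m * l) k) \<in> M" using mult[of m] by (intro ideal_in_diff[OF R(1) id M0]) (simp add: cong_def)
      then show ?thesis unfolding 2 by (simp add: G Fx a_def)
    qed
  qed
  moreover have "x t \<in> R" for t by (simp add: x_def aR)
  ultimately have "ev 1 x \<in> M"
    using R(2) by (intro S2(2)[rule_format, of R M x, OF R(1) _ id]) auto
  then show False using finite_residue_primeD(2)[OF M] by simp
qed

section \<open>Passing to a cofinite invariant subset\<close>

lemma funpow_invariant: "f ` A \<subseteq> A \<Longrightarrow> (f ^^ k) ` A \<subseteq> A"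
  by (induction k) (auto simp: image_subset_iff)

lemma finite_diff_funpow_image:
  assumes "finite (X - f ` X)"
  shows "finite (X - (f ^^ k) ` X)"
proof (induction k)
  case (Suc k)
  have "X - (f ^^ Suc k) ` X \<subseteq> (X - f ` X) \<union> f ` (X - (f ^^ k) ` X)" by (auto simp: image_iff)
  then show ?case using assms Suc by (meson finite_UnI finite_imageI finite_subset)
qed simp

text \<open>Points of \<open>Y\<close> mapped into \<open>Y - Z\<close> lie in \<open>Y - Z\<close>,
  since \<open>Z\<close> is invariant, and their images cover \<open>Y - Z\<close>. By finiteness
  they are all of \<open>Y - Z\<close>, so preimages in \<open>Y\<close> of points of
  \<open>Z\<close> lie in \<open>Z\<close>.\<close>

lemma surj_on_cofinite_invariant:
  assumes "f ` Y = Y" "f ` Z \<subseteq> Z" "finite (Y - Z)"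
  shows "f ` (Z \<inter> Y) = Z \<inter> Y"
proof
  show "f ` (Z \<inter> Y) \<subseteq> Z \<inter> Y" using assms(1,2) by blast
  define P where "P = {x \<in> Y. f x \<in> Y - Z}"
  have PE: "P \<subseteq> Y - Z" using assms(2) by (auto simp: P_def)
  have "Y - Z \<subseteq> f ` P"
  proof
    fix w assume w: "w \<in> Y - Z"
    then obtain x where "x \<in> Y" "w = f x" using assms(1) by blast
    then show "w \<in> f ` P" using w by (auto simp: P_def)
  qed
  then have "card (Y - Z) \<le> card P"
    using PE assms(3) by (meson card_image_le card_mono finite_imageI finite_subset le_trans)
  then have P: "P = Y - Z" using PE assms(3) by (simp add: card_seteq)
  show "Z \<inter> Y \<subseteq> f ` (Z \<inter> Y)"
  proof
    fix w assume w: "w \<in> Z \<inter> Y"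
    then obtain x where x: "x \<in> Y" "w = f x" using assms(1) by blast
    have "x \<notin> P" using x w by (auto simp: P_def)
    then show "w \<in> f ` (Z \<inter> Y)" using x P by blast
  qed
qed

theorem theorem1:
  fixes X \<Omega> :: "(complex ^ 'n) set" and F :: "complex ^ 'n \<Rightarrow> complex ^ 'n"
  assumes "algebraic_set X"
    and "poly_map F"
    and "F ` X \<subseteq> X"
    and "\<And>U. openin (top_of_set X) U \<Longrightarrow> openin (top_of_set X) (F ` U)"
    and "finite (X - F ` X)"
    and "\<Omega> \<subseteq> X"
    and "finite (X - \<Omega>)"
    and "F ` \<Omega> \<subseteq> \<Omega>"
  shows "(\<exists>K::nat. K > 0 \<and> (\<forall>k\<ge>K. (F ^^ k) ` \<Omega> = (F ^^ K) ` \<Omega>))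
     \<and> openin (top_of_set X) (\<Inter>k\<in>{0<..}. (F ^^ k) ` \<Omega>)
     \<and> (\<Inter>k\<in>{0<..}. (F ^^ k) ` \<Omega>) \<subseteq> \<Omega>
     \<and> finite (\<Omega> - (\<Inter>k\<in>{0<..}. (F ^^ k) ` \<Omega>))"
proof -
  have "\<exists>k. (F ^^ k) ` X = (F ^^ Suc k) ` X"
  proof (rule ccontr)
    assume "\<nexists>k. (F ^^ k) ` X = (F ^^ Suc k) ` X"
    then have ne: "(F ^^ k) ` X \<noteq> (F ^^ Suc k) ` X" for k by blast
    show False
      by (rule orbit_of_unstable_images[OF assms(3,5) ne]) (rule unstable_orbit_impossible[OF assms(1,2,4)])
  qed
  then obtain k0 where k0: "(F ^^ k0) ` X = (F ^^ Suc k0) ` X" by blast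
  define Y where "Y = (F ^^ k0) ` X"
  have "F ` Y = (F ^^ Suc k0) ` X" by (simp add: Y_def image_comp)
  then have FY: "F ` Y = Y" unfolding Y_def k0 .
  have YX: "Y \<subseteq> X" unfolding Y_def using assms(3) by (rule funpow_invariant)
  have finY: "finite (X - Y)" unfolding Y_def using assms(5) by (rule finite_diff_funpow_image)
  have FYk: "(F ^^ k) ` Y = Y" for k
  proof (induction k)
    case (Suc k)
    have "(F ^^ Suc k) ` Y = F ` ((F ^^ k) ` Y)" by (simp add: image_comp)
    then show ?case using Suc FY by simp
  qed simp
  \<comment> \<open>This is the stable image: \<open>F\<close> maps it onto itself, and from step
    \<open>k0\<close> on the images of \<open>\<Omega>\<close> are squeezed onto it.\<close>
  define S where "S = \<Omega> \<inter> Y"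
  have "finite (Y - \<Omega>)" by (rule finite_subset[OF _ assms(7)]) (use YX in blast)
  then have FS: "F ` S = S" unfolding S_def by (rule surj_on_cofinite_invariant[OF FY assms(8)])
  have FSk: "(F ^^ k) ` S = S" for k
  proof (induction k)
    case (Suc k)
    have "(F ^^ Suc k) ` S = F ` ((F ^^ k) ` S)" by (simp add: image_comp)
    then show ?case using Suc FS by simp
  qed simp
  have lower: "S \<subseteq> (F ^^ k) ` \<Omega>" for k
    using image_mono[of S \<Omega> "F ^^ k"] FSk[of k] by (auto simp: S_def)
  have upper: "(F ^^ k) ` \<Omega> \<subseteq> S" if "k \<ge> k0" for k
  proof -
    have "(F ^^ k) ` X = (F ^^ (k - k0)) ` ((F ^^ k0) ` X)"
      using that by (simp only: image_comp funpow_add[symmetric] le_add_diff_inverse2)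
    then have "(F ^^ k) ` X = Y" using FYk[of "k - k0"] by (simp only: Y_def)
    then have "(F ^^ k) ` \<Omega> \<subseteq> Y" using image_mono[OF assms(6), of "F ^^ k"] by simp
    then show ?thesis using funpow_invariant[OF assms(8), of k] by (simp add: S_def)
  qed
  have eq: "(F ^^ k) ` \<Omega> = S" if "k \<ge> k0" for k using lower upper[OF that] by blast
  have "(\<Inter>k\<in>{0<..}. (F ^^ k) ` \<Omega>) \<subseteq> (F ^^ Suc k0) ` \<Omega>" by (rule INT_lower) simp
  then have stable: "(\<Inter>k\<in>{0<..}. (F ^^ k) ` \<Omega>) = S"
    using eq[of "Suc k0"] by (intro equalityI INT_greatest lower) (simp del: funpow.simps)
  have fin: "finite (X - S)"
    by (rule finite_subset[OF _ finite_UnI[OF assms(7) finY]]) (auto simp: S_def)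
  then have "open (- (X - S))" by (intro open_Compl finite_imp_closed)
  moreover have "S = X \<inter> - (X - S)" using YX by (auto simp: S_def)
  ultimately have "openin (top_of_set X) S" unfolding openin_open by blast
  \<comment> \<open>\<open>k0\<close> may be 0, hence the successor as witness.\<close>
  moreover have "\<exists>K>0. \<forall>k\<ge>K. (F ^^ k) ` \<Omega> = (F ^^ K) ` \<Omega>"
    by (rule exI[of _ "Suc k0"]) (simp add: eq del: funpow.simps)
  moreover have "finite (\<Omega> - S)" by (rule finite_subset[OF _ fin]) (use assms(6) in blast)
  ultimately show ?thesis unfolding stable by (simp add: S_def)
qed

end
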